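(* Let $(A_n)_{n\ge1}$ (claim amounts) be independent with common distribution function $L$, let $(T_n)_{n\ge1}$ (interclaim times) be independent, nonnegative, with common distribution function $K$, and independent of $(A_n)_{n\ge 1}$, and let $c>0$ be the intensity of the gross risk premium. Put $X_n=A_n-cT_n$, let $F(x)=\int_0^\infty L(x+ct)\,dK(t)$ be the common distribution function of the $X_n$, let $S_0=0$, $S_n=X_1+\cdots+X_n$, and let $\psi(x)=P\{\max_{n\ge0}S_n>x\}$ be the probability of eventual ruin given initial capital $x$. Let $F_+$ and $F_-$ be the strict ascending and weak descending ladder height distributions of the random walk $(S_n)$, and let $p=P\{\tau<\infty\}$ with $\tau=\min\{n\ge1:S_n>0\}$. Let $m\ge 1$ be an integer. Assume that $\overline L=1-L$ is smoothly varying of index $-\alpha$ and order $m+1$, that $\mu=EA_1-cET_1$ is finite and negative, and that $m<\alpha$. Then, as $x\to\infty$, $$\psi(x)=(1-p)\,\bigl(\mathrm{Id}-\mathsf L_{F_+,m-1}\bigr)^{-2}\bigl(\mathsf S\,\mathsf L_{F_-,m}\bigr)^{-1}\,\mathrm D^{-1}\overline F(x)+o\bigl(x^{-m+2}\,\overline F(x)\bigr),$$ where the inverses and the product are taken in the ring $\mathbb{R}_{m-1}[\mathrm D]$ and the resulting polynomial in $\mathrm D$ is applied to the function $\mathrm D^{-1}\overline F$.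
   Context: Ladder heights: with $\tau=\min\{n\ge1:S_n>0\}$ ($\min\emptyset=+\infty$), $F_+(x)=P\{S_\tau\le x,\ \tau<\infty\}$ is the (defective) strict ascending ladder height distribution, of total mass $p=P\{\tau<\infty\}<1$. With $\tau_-=\min\{n\ge1:S_n\le 0\}$, $F_-(x)=P\{S_{\tau_-}\le x\}$ is the weak descending ladder height distribution. Tails and moments: for a possibly defective distribution function $G$, $\overline G(x)=\lim_{t\to\infty}G(t)-G(x)$, and $\mu_{G,k}=\int x^k\,dG(x)$ is its $k$-th moment ($\mu_{G,0}$ is its total mass). Regular variation: a measurable function $f$, ultimately nonzero and of constant sign, is regularly varying of index $\rho$ if $f(\lambda t)/f(t)\to\lambda^\rho$ as $t\to\infty$ for every $\lambda>0$. Smooth variation: for a nonnegative integer $k$, a real measurable function $h$ is smoothly varying of index $-\alpha$ and order $k$ if it is ultimately $k$ times continuously differentiable and $h^{(k)}$ is regularly varying of index $-\alpha-k$. Algebra: $\mathbb{R}_m[\mathrm D]$ is the ring of real polynomials in $\mathrm D$ modulo the ideal generated by $\mathrm D^{m+1}$; $\mathrm{Id}=\mathrm D^0$ is its unit. Elements act on sufficiently differentiable functions by letting $\mathrm D^k$ act as $k$-fold differentiation, the representative being the one of degree at most $m$. For a possibly defective distribution $G$ with finite $m$-th moment, its Laplace character of order $m$ is $\mathsf L_{G,m}=\sum_{0\le k\le m}\frac{(-1)^k}{k!}\mu_{G,k}\mathrm D^k\in\mathbb{R}_m[\mathrm D]$. The backward signed shift $\mathsf S$ is the linear map with $\mathsf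 S\,\mathrm D^0=0$ and $\mathsf S\,\mathrm D^j=-\mathrm D^{j-1}$ for $j\ge1$; it maps $\mathbb{R}_m[\mathrm D]$ to $\mathbb{R}_{m-1}[\mathrm D]$. For $f$ regularly varying of index less than $-1$, $\mathrm D^{-1}f(t)=-\int_t^\infty f(x)\,dx$, so that $\mathrm D^k\mathrm D^{-1}f=f^{(k-1)}$ for $k\ge1$.
   Formalization: The weak descending ladder height distribution F_- is additionally assumed to have a finite m-th moment; without this (possible for m ≥ 2, as only the mean of T_1 is assumed finite) the Laplace character L_{F_-,m} in the formula is undefined. *)

theory Defs
  imports
    "HOL-Algebra.Ring"
    "HOL-Computational_Algebra.Polynomial"
    "HOL-Library.Extended_Nat"
    "HOL-Library.Landau_Symbols"
    "HOL-Probability.Probability"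
begin

section \<open>Random walks, ladder heights, ruin probability\<close>

definition walk :: "(nat \<Rightarrow> 'a \<Rightarrow> real) \<Rightarrow> nat \<Rightarrow> 'a \<Rightarrow> real" where
  "walk X n \<omega> = (\<Sum>i=1..n. X i \<omega>)"

text \<open>The infimum of the empty set is \<open>\<infinity>\<close> in \<^typ>\<open>enat\<close>.\<close>

definition asc_ladder_time :: "(nat \<Rightarrow> 'a \<Rightarrow> real) \<Rightarrow> 'a \<Rightarrow> enat" where
  "asc_ladder_time S \<omega> = Inf (enat ` {n. n \<ge> 1 \<and> S n \<omega> > 0})"

definition desc_ladder_time :: "(nat \<Rightarrow> 'a \<Rightarrow> real) \<Rightarrow> 'a \<Rightarrow> enat" where
  "desc_ladder_time S \<omega> = Inf (enat ` {n. n \<ge> 1 \<and> S n \<omega> \<le> 0})"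

definition asc_ladder_df :: "'a measure \<Rightarrow> (nat \<Rightarrow> 'a \<Rightarrow> real) \<Rightarrow> real \<Rightarrow> real" where
  "asc_ladder_df M S x = measure M {\<omega> \<in> space M.
     asc_ladder_time S \<omega> < \<infinity> \<and> S (the_enat (asc_ladder_time S \<omega>)) \<omega> \<le> x}"

definition desc_ladder_df :: "'a measure \<Rightarrow> (nat \<Rightarrow> 'a \<Rightarrow> real) \<Rightarrow> real \<Rightarrow> real" where
  "desc_ladder_df M S x = measure M {\<omega> \<in> space M.
     desc_ladder_time S \<omega> < \<infinity> \<and> S (the_enat (desc_ladder_time S \<omega>)) \<omega> \<le> x}"

definition asc_ladder_mass :: "'a measure \<Rightarrow> (nat \<Rightarrow> 'a \<Rightarrow> real) \<Rightarrow> real" where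
  "asc_ladder_mass M S = measure M {\<omega> \<in> space M. asc_ladder_time S \<omega> < \<infinity>}"

definition ruin_prob :: "'a measure \<Rightarrow> (nat \<Rightarrow> 'a \<Rightarrow> real) \<Rightarrow> real \<Rightarrow> real" where
  "ruin_prob M S x = measure M {\<omega> \<in> space M. (SUP n. ereal (S n \<omega>)) > ereal x}"


section \<open>Possibly defective distribution functions\<close>

definition tail :: "(real \<Rightarrow> real) \<Rightarrow> real \<Rightarrow> real" where
  "tail G x = Lim at_top G - G x"

text \<open>Integrals against \<open>dG\<close> are taken with respect to the Lebesgue--Stieltjes measure
  \<^term>\<open>interval_measure G\<close>.\<close>

definition finite_moment :: "(real \<Rightarrow> real) \<Rightarrow> nat \<Rightarrow> bool" where
  "finite_moment G k \<longleftrightarrow> integrable (interval_measure G) (\<lambda>x. x ^ k)"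

definition moment :: "(real \<Rightarrow> real) \<Rightarrow> nat \<Rightarrow> real" where
  "moment G k = (LINT x|interval_measure G. x ^ k)"


section \<open>Regular and smooth variation\<close>

text \<open>Measurability is only asked for on a neighbourhood of infinity, because regular variation is
  also applied to derivatives, which need only exist there.\<close>

definition regularly_varying :: "(real \<Rightarrow> real) \<Rightarrow> real \<Rightarrow> bool" where
  "regularly_varying f \<rho> \<longleftrightarrow>
     (\<exists>a. set_borel_measurable borel {a..} f) \<and>
     ((\<forall>\<^sub>F t in at_top. f t > 0) \<or> (\<forall>\<^sub>F t in at_top. f t < 0)) \<and>
     (\<forall>l>0. ((\<lambda>t. f (l * t) / f t) \<longlongrightarrow> l powr \<rho>) at_top)"

definition ultimately_C :: "nat \<Rightarrow> (real \<Rightarrow> real) \<Rightarrow> bool" where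
  "ultimately_C k h \<longleftrightarrow> (\<exists>a.
     (\<forall>j<k. \<forall>x>a. ((deriv ^^ j) h) differentiable (at x)) \<and>
     continuous_on {a<..} ((deriv ^^ k) h))"

text \<open>Here \<open>i\<close> is the index; a function of index \<open>-\<alpha>\<close> in the usual terminology
  has \<open>i = - \<alpha>\<close>.\<close>

definition smoothly_varying :: "(real \<Rightarrow> real) \<Rightarrow> real \<Rightarrow> nat \<Rightarrow> bool" where
  "smoothly_varying h i k \<longleftrightarrow>
     h \<in> borel_measurable borel \<and> ultimately_C k h \<and>
     regularly_varying ((deriv ^^ k) h) (i - real k)"


section \<open>Truncated polynomials in the differentiation operator\<close>

text \<open>The ring of real polynomials in \<open>D\<close> modulo the ideal generated by \<open>D\<^sup>m\<^sup>+\<^sup>1\<close>. As with the residue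
  rings of integers in the library, its elements are the reduced representatives, here the
  polynomials of degree at most \<open>m\<close>.\<close>

definition trunc_ring :: "nat \<Rightarrow> real poly ring" where
  "trunc_ring m = \<lparr>carrier = {P. degree P \<le> m},
     monoid.mult = (\<lambda>P Q. (P * Q) mod monom 1 (m + 1)), one = 1, zero = 0, add = (+)\<rparr>"

definition apply_D :: "real poly \<Rightarrow> (real \<Rightarrow> real) \<Rightarrow> real \<Rightarrow> real" where
  "apply_D P h x = (\<Sum>k\<le>degree P. coeff P k * (deriv ^^ k) h x)"

definition laplace_char :: "(real \<Rightarrow> real) \<Rightarrow> nat \<Rightarrow> real poly" where
  "laplace_char G m = (\<Sum>k\<le>m. monom ((-1) ^ k / fact k * moment G k) k)"

definition signed_shift :: "real poly \<Rightarrow> real poly" where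
  "signed_shift P = - poly_shift 1 P"

definition D_inv :: "(real \<Rightarrow> real) \<Rightarrow> real \<Rightarrow> real" where
  "D_inv f t = - (LINT x:{t..}|lborel. f x)"


lemma signed_shift_1: "signed_shift 1 = 0"
  and signed_shift_monom: "j \<ge> 1 \<Longrightarrow> signed_shift (monom 1 j) = - monom 1 (j - 1)"
  by (auto simp: signed_shift_def poly_eq_iff coeff_poly_shift)

lemma mod_monom_in: "degree ((P :: real poly) mod monom 1 (m + 1)) \<le> m"
  using degree_mod_less[of "monom 1 (m + 1) :: real poly" P] by (auto simp: degree_monom_eq)

lemma trunc_ring_cring: "cring (trunc_ring m)"
proof (rule cringI)
  show "abelian_group (trunc_ring m)"
  proof (rule abelian_groupI)
    fix x assume "x \<in> carrier (trunc_ring m)"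
    then show "\<exists>y\<in>carrier (trunc_ring m). y \<oplus>\<^bsub>trunc_ring m\<^esub> x = \<zero>\<^bsub>trunc_ring m\<^esub>"
      by (intro bexI[of _ "- x"]) (auto simp: trunc_ring_def)
  qed (auto simp: trunc_ring_def degree_add_le)
  show "comm_monoid (trunc_ring m)"
  proof (rule comm_monoidI)
    fix x y assume "x \<in> carrier (trunc_ring m)" "y \<in> carrier (trunc_ring m)"
    show "x \<otimes>\<^bsub>trunc_ring m\<^esub> y \<in> carrier (trunc_ring m)"
      using mod_monom_in by (simp add: trunc_ring_def)
  next
    fix x assume "x \<in> carrier (trunc_ring m)"
    then show "\<one>\<^bsub>trunc_ring m\<^esub> \<otimes>\<^bsub>trunc_ring m\<^esub> x = x"
      by (auto simp: trunc_ring_def degree_monom_eq intro!: mod_poly_less)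
  qed (auto simp: trunc_ring_def mod_mult_left_eq mod_mult_right_eq ac_simps)
  show "(x \<oplus>\<^bsub>trunc_ring m\<^esub> y) \<otimes>\<^bsub>trunc_ring m\<^esub> z =
      x \<otimes>\<^bsub>trunc_ring m\<^esub> z \<oplus>\<^bsub>trunc_ring m\<^esub> y \<otimes>\<^bsub>trunc_ring m\<^esub> z" for x y z
    by (simp add: trunc_ring_def distrib_right poly_mod_add_left)
qed

end

theory Submission
  imports Defs "HOL-Real_Asymp.Real_Asymp"
begin

text \<open>
Write \<open>F\<^sub>+\<close>, \<open>F\<^sub>-\<close> for the ladder height laws, \<open>B\<close> for the tail of \<open>F\<^sub>+\<close>, and \<open>L\<^sub>+\<close>, \<open>L\<^sub>-\<close> for
their Laplace characters. The expansion comes from two convolution equations, one for \<open>B\<close> and one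
for \<open>\<psi>\<close>. Convolution with a law whose moments are finite acts on a smoothly varying function as the
Laplace character of the law, by Taylor's formula (\<open>act_convolution\<close>); so each equation
becomes a linear equation in the ring of truncated polynomials, whose solution is a candidate for the
expansion. It then remains to see that the equation is stable: a small residual changes the solution
by little.

The functions in play are \<open>\<phi> = D\<^sup>-\<^sup>1 tail F\<close> and its derivatives. Since \<open>tail F\<close> is a mixture of
translates of \<open>tail L\<close>, they inherit from \<open>tail L\<close> alternating signs, monotone absolute values and
regular variation, the latter pulled down from the top derivative by l'Hopital's rule
(\<open>smoothly_varying_derivs\<close>, locale \<open>smooth_mixture\<close>). The locale
\<open>deriv_scale\<close> collects these properties; monotonicity is the source of all uniform
estimates.

The first equation is the Wiener--Hopf factorization on the positive half line,
\<open>B(x) = tail F(x) + E B(x + U)\<close> with \<open>-U\<close> distributed as \<open>F\<^sub>-\<close> (\<open>wiener_hopf\<close>).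
It is obtained by reversing time up to the first ascending ladder epoch and cutting the reversed path
at the last argmin. Formally it reads \<open>(1 - L\<^sub>-) B = D \<phi>\<close>, and \<open>1 - L\<^sub>- = (S L\<^sub>-) D\<close> because
\<open>F\<^sub>-\<close> is a probability law, so the candidate is \<open>(S L\<^sub>-)\<^sup>-\<^sup>1 \<phi>\<close>. Its residual is
\<open>o(\<phi>\<^sup>(\<^sup>m\<^sup>))\<close>. Since \<open>U\<close> is bounded below by some \<open>\<delta> > 0\<close> with positive probability, a small
multiple of \<open>\<phi>\<^sup>(\<^sup>m\<^sup>-\<^sup>1\<^sup>)\<close> decreases by more than the residual along the walk with steps \<open>U\<close>, and a
maximum principle yields the error \<open>o(\<phi>\<^sup>(\<^sup>m\<^sup>-\<^sup>1\<^sup>))\<close> (\<open>ladder_expansion\<close>).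

The second equation says that the maximum \<open>M\<close> of the walk is either \<open>0\<close>, with probability
\<open>1 - p\<close>, or a ladder height plus an independent copy of \<open>M\<close>. In terms of characters,
\<open>L\<^sub>M = (1 - p) (1 - L\<^sub>+)\<^sup>-\<^sup>1\<close>. In the event \<open>M > x\<close> the large contribution comes from the ladder
height or from the copy of \<open>M\<close>, but hardly ever from both, so that formally
\<open>\<psi> = L\<^sub>+ \<psi> + L\<^sub>M B\<close>; this is the origin of the exponent \<open>-2\<close>. Both being large has probability
\<open>O(\<phi>\<^sup>2)\<close>, which is negligible because \<open>m < \<alpha>\<close>. Stability holds because \<open>F\<^sub>+\<close> has total mass
\<open>p < 1\<close>, so the equation is a contraction for the error (\<open>renewal_inequality\<close>,
\<open>compound_expansion\<close>).

That \<open>p < 1\<close> is Garsia's maximal inequality (\<open>asc_mass_less_1\<close>). It also shows that the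
walk has a finite maximum and, after adding a small constant to the increments, that the walk
drifts to \<open>-\<infinity>\<close>, so \<open>F\<^sub>-\<close> is not defective.
\<close>

section \<open>Regular variation\<close>

text \<open>Regular variation controls dilations; monotonicity turns this into control of translations, as \<open>x +
u \<le> l * x\<close> ultimately, for each \<open>l > 1\<close>.\<close>

lemma long_tailed:
  fixes f :: "real \<Rightarrow> real"
  assumes pos: "\<And>x. a < x \<Longrightarrow> 0 < f x" and anti: "\<And>x y. a < x \<Longrightarrow> x \<le> y \<Longrightarrow> f y \<le> f x"
    and rv: "\<And>l. 0 < l \<Longrightarrow> ((\<lambda>x. f (l * x) / f x) \<longlongrightarrow> l powr \<rho>) at_top" and u: "0 \<le> u"
  shows "((\<lambda>x. f (x + u) / f x) \<longlongrightarrow> 1) at_top"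
proof (rule order_tendstoI)
  fix b :: real assume b: "b < 1"
  have "((\<lambda>l. l powr \<rho>) \<longlongrightarrow> 1 powr \<rho>) (at_right 1)"
    by (intro tendsto_intros) auto
  then have "eventually (\<lambda>l. b < l powr \<rho>) (at_right 1)"
    using b by (auto dest: order_tendstoD(1))
  moreover have "eventually (\<lambda>l::real. 1 < l) (at_right 1)"
    by (simp add: eventually_at_right_less)
  ultimately have "eventually (\<lambda>l. b < l powr \<rho> \<and> 1 < l) (at_right 1)"
    by eventually_elim simp
  then obtain l where l: "1 < l" "b < l powr \<rho>"
    using eventually_happens'[of "at_right (1::real)"] by force
  have "eventually (\<lambda>x. b < f (l * x) / f x) at_top"
    using rv[of l] l by (auto dest: order_tendstoD(1))
  then show "eventually (\<lambda>x. b < f (x + u) / f x) at_top"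
    using eventually_gt_at_top[of a] eventually_ge_at_top[of "u / (l - 1)"]
  proof eventually_elim
    case (elim x)
    have le: "x + u \<le> l * x"
      using elim(3) l by (simp add: field_simps)
    have "f (l * x) / f x \<le> f (x + u) / f x"
      using elim u le pos[of x] by (intro divide_right_mono anti) auto
    then show ?case using elim by linarith
  qed
next
  fix b :: real assume b: "1 < b"
  show "eventually (\<lambda>x. f (x + u) / f x < b) at_top"
    using eventually_gt_at_top[of a]
  proof eventually_elim
    case (elim x)
    then have "f (x + u) / f x \<le> 1"
      using u anti[of x "x + u"] pos[of x] by (simp add: divide_le_eq)
    then show ?case using b by linarith
  qed
qed

lemma nonpos_deriv_tendsto_0:
  fixes u :: "real \<Rightarrow> real"
  assumes "\<And>z. a < z \<Longrightarrow> (u has_real_derivative u' z) (at z)" "\<And>z. a < z \<Longrightarrow> u' z \<le> 0"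
    and lim: "(u \<longlongrightarrow> 0) at_top" and x: "a < x"
  shows "0 \<le> u x"
proof (rule tendsto_upperbound[OF lim])
  show "eventually (\<lambda>y. u y \<le> u x) at_top"
    using eventually_ge_at_top[of x]
  proof eventually_elim
    case (elim y)
    show ?case
      by (rule DERIV_nonpos_imp_nonincreasing[OF elim], rule exI, rule conjI[OF assms(1) assms(2)]) (use x in auto)
  qed
qed simp

lemma pos_deriv_tendsto_0:
  fixes f :: "real \<Rightarrow> real"
  assumes der: "\<And>z. a < z \<Longrightarrow> (f has_real_derivative g z) (at z)" and pos: "\<And>z. a < z \<Longrightarrow> 0 < g z"
    and lim: "(f \<longlongrightarrow> 0) at_top" and x: "a < x"
  shows "f x < 0"
proof -
  have "f x < f (x + 1)"
    by (rule DERIV_pos_imp_increasing, simp, rule exI, rule conjI[OF der pos]) (use x in auto)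
  moreover have "0 \<le> - f (x + 1)"
    using x
    by (intro nonpos_deriv_tendsto_0[of a "\<lambda>z. - f z" "\<lambda>z. - g z"])
      (auto intro!: DERIV_minus der less_imp_le[OF pos] tendsto_minus[OF lim, simplified])
  ultimately show ?thesis by simp
qed

text \<open>L'Hopital's rule for \<open>f (l * x)\<close> against \<open>f x\<close>, both of which vanish at
infinity. The quotient of their derivatives is \<open>l * g (l * x) / g x\<close>, and \<open>l\<close> stays fixed.
The parameter \<open>s\<close> is the sign of \<open>g\<close>.\<close>

lemma regular_variation_antiderivative:
  fixes f g :: "real \<Rightarrow> real"
  assumes der: "\<And>z. a < z \<Longrightarrow> (f has_real_derivative g z) (at z)" and pos: "\<And>z. a < z \<Longrightarrow> 0 < s * g z"
    and s: "\<bar>s\<bar> = 1"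
    and lim: "(f \<longlongrightarrow> 0) at_top" and a: "0 \<le> a" and l: "0 < l"
    and rv: "((\<lambda>x. g (l * x) / g x) \<longlongrightarrow> c) at_top"
  shows "((\<lambda>x. f (l * x) / f x) \<longlongrightarrow> l * c) at_top"
proof (rule tendstoI)
  fix e :: real assume e: "0 < e"
  define \<epsilon> where "\<epsilon> = e / (2 * l)"
  have \<epsilon>: "0 < \<epsilon>" using e l by (simp add: \<epsilon>_def)
  have f_neg: "s * f x < 0" if "a < x" for x
    using that tendsto_mult_left[OF lim, of s]
    by (intro pos_deriv_tendsto_0[of a "\<lambda>z. s * f z" "\<lambda>z. s * g z"]) (auto intro!: DERIV_cmult der pos)
  have "eventually (\<lambda>x. dist (g (l * x) / g x) c < \<epsilon>) at_top" by (rule tendstoD[OF rv \<epsilon>])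
  then obtain X where X: "\<And>x. X \<le> x \<Longrightarrow> \<bar>g (l * x) / g x - c\<bar> < \<epsilon>"
    by (auto simp: eventually_at_top_linorder dist_real_def)
  define b where "b = max (max a (a / l)) X"
  have b: "a < x" "a < l * x" "X \<le> x" if "b < x" for x
    using that l by (auto simp: b_def field_simps)
  have lim_l: "((\<lambda>z. f (l * z)) \<longlongrightarrow> 0) at_top"
    using l by (intro filterlim_compose[OF lim] filterlim_tendsto_pos_mult_at_top[OF tendsto_const]) (auto intro: filterlim_ident)
  \<comment> \<open>In absolute value, the derivative of \<open>\<phi>\<close> is at most that of \<open>l * \<epsilon> * s * f\<close>, and both functions vanish at infinity.\<close>
  define \<phi> where "\<phi> z = f (l * z) - l * c * f z" for z
  have \<phi>_der: "(\<phi> has_real_derivative l * (g (l * z) - c * g z)) (at z)" if "b < z" for z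
    unfolding \<phi>_def
    by (rule derivative_eq_intros DERIV_chain2[where f = f and g = "\<lambda>z. l * z"] der b that refl | simp)+ (simp add: algebra_simps)
  have \<phi>_bound: "\<bar>l * (g (l * z) - c * g z)\<bar> \<le> l * \<epsilon> * (s * g z)" if z: "b < z" for z
  proof -
    have g0: "0 < s * g z" using pos b z by auto
    then have gz: "g z \<noteq> 0" "\<bar>g z\<bar> = s * g z" using s by (auto simp: abs_if split: if_splits)
    have "g (l * z) - c * g z = (g (l * z) / g z - c) * g z" using gz by (simp add: field_simps)
    then have "\<bar>g (l * z) - c * g z\<bar> = \<bar>g (l * z) / g z - c\<bar> * (s * g z)" using gz by (simp add: abs_mult)
    also have "\<dots> \<le> \<epsilon> * (s * g z)" using X[OF b(3)[OF z]] g0 by (intro mult_right_mono) auto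
    finally show ?thesis using l by (simp add: abs_mult)
  qed
  have \<phi>_lim: "(\<phi> \<longlongrightarrow> 0) at_top"
    unfolding \<phi>_def using tendsto_diff[OF lim_l tendsto_mult_left[OF lim, of "l * c"]] by simp
  have main: "0 \<le> t * \<phi> x - l * \<epsilon> * (s * f x)" if t: "\<bar>t\<bar> = 1" and x: "b < x" for t x
  proof (rule nonpos_deriv_tendsto_0[OF _ _ _ x])
    fix z assume z: "b < z"
    show "((\<lambda>x. t * \<phi> x - l * \<epsilon> * (s * f x)) has_real_derivative
        t * (l * (g (l * z) - c * g z)) - l * \<epsilon> * (s * g z)) (at z)"
      by (intro DERIV_diff DERIV_cmult \<phi>_der der b z)
    have "t * (l * (g (l * z) - c * g z)) \<le> \<bar>t * (l * (g (l * z) - c * g z))\<bar>" by (rule abs_ge_self)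
    also have "\<dots> = \<bar>l * (g (l * z) - c * g z)\<bar>" using t by (simp add: abs_mult)
    finally show "t * (l * (g (l * z) - c * g z)) - l * \<epsilon> * (s * g z) \<le> 0" using \<phi>_bound[OF z] by simp
  next
    have "((\<lambda>x. t * \<phi> x - l * \<epsilon> * (s * f x)) \<longlongrightarrow> t * 0 - l * \<epsilon> * (s * 0)) at_top"
      by (intro tendsto_intros \<phi>_lim lim)
    then show "((\<lambda>x. t * \<phi> x - l * \<epsilon> * (s * f x)) \<longlongrightarrow> 0) at_top" by simp
  qed
  show "eventually (\<lambda>x. dist (f (l * x) / f x) (l * c) < e) at_top"
    using eventually_gt_at_top[of b]
  proof eventually_elim
    case (elim x)
    have "s * f x < 0" by (rule f_neg[OF b(1)[OF elim]])
    then have f0: "f x \<noteq> 0" "\<bar>f x\<bar> = - (s * f x)" using s by (auto simp: abs_if split: if_splits)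
    have "\<bar>\<phi> x\<bar> \<le> l * \<epsilon> * \<bar>f x\<bar>" using main[of 1 x] main[of "-1" x] elim f0 by (simp add: abs_le_iff)
    moreover have "f (l * x) / f x - l * c = \<phi> x / f x" using f0 by (simp add: \<phi>_def field_simps)
    ultimately have "\<bar>f (l * x) / f x - l * c\<bar> \<le> l * \<epsilon>"
      using f0(1) by (simp add: abs_divide pos_divide_le_eq)
    also have "\<dots> < e" using e l by (simp add: \<epsilon>_def)
    finally show ?case by (simp add: dist_real_def)
  qed
qed

text \<open>As \<open>g\<close> is monotone, \<open>g x\<close> lies between \<open>f x - f (x - 1)\<close> and
\<open>f (x + 1) - f x\<close>.\<close>

lemma deriv_tendsto_0:
  fixes f g k :: "real \<Rightarrow> real"
  assumes f: "\<And>z. a < z \<Longrightarrow> (f has_real_derivative g z) (at z)"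
    and g: "\<And>z. a < z \<Longrightarrow> (g has_real_derivative k z) (at z)" and k: "\<And>z. a < z \<Longrightarrow> 0 < s * k z"
    and lim: "(f \<longlongrightarrow> 0) at_top" and s: "\<bar>s\<bar> = 1"
  shows "(g \<longlongrightarrow> 0) at_top"
proof -
  have mono: "s * g x \<le> s * g y" if "a < x" "x \<le> y" for x y
    by (rule DERIV_nonneg_imp_nondecreasing[OF that(2)], rule exI, rule conjI[OF DERIV_cmult[OF g] less_imp_le[OF k]])
      (use that in auto)
  have sh: "((\<lambda>x. f (x + u)) \<longlongrightarrow> 0) at_top" for u :: real
    by (rule filterlim_compose[OF lim]) real_asymp
  have "((\<lambda>x. s * g x) \<longlongrightarrow> 0) at_top"
  proof (rule tendsto_sandwich)
    show "((\<lambda>x. s * (f x - f (x + - 1))) \<longlongrightarrow> 0) at_top" "((\<lambda>x. s * (f (x + 1) - f x)) \<longlongrightarrow> 0) at_top"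
      using tendsto_mult_left[OF tendsto_diff[OF lim sh[of "- 1"]], of s]
        tendsto_mult_left[OF tendsto_diff[OF sh[of 1] lim], of s] by simp_all
    show "eventually (\<lambda>x. s * (f x - f (x + - 1)) \<le> s * g x) at_top"
      using eventually_gt_at_top[of "a + 1"]
    proof eventually_elim
      case (elim x)
      obtain z where "x - 1 < z" "z < x" "f x - f (x - 1) = (x - (x - 1)) * g z"
        using MVT2[of "x - 1" x f g] f elim by auto
      then show ?case using mono[of z x] elim by simp
    qed
    show "eventually (\<lambda>x. s * g x \<le> s * (f (x + 1) - f x)) at_top"
      using eventually_gt_at_top[of a]
    proof eventually_elim
      case (elim x)
      obtain z where "x < z" "z < x + 1" "f (x + 1) - f x = (x + 1 - x) * g z"
        using MVT2[of x "x + 1" f g] f elim by auto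
      then show ?case using mono[of x z] elim by simp
    qed
  qed
  from tendsto_mult_left[OF this, of s] have "((\<lambda>x. s * (s * g x)) \<longlongrightarrow> 0) at_top" by simp
  moreover have "s * (s * y) = y" for y using s by (auto simp: abs_if split: if_splits)
  ultimately show ?thesis by simp
qed

lemma eventual_sign_antiderivative:
  fixes f g :: "real \<Rightarrow> real"
  assumes f: "\<And>z. a < z \<Longrightarrow> (f has_real_derivative g z) (at z)" and g: "\<And>z. a < z \<Longrightarrow> 0 < s * g z"
    and s: "\<bar>s\<bar> = 1"
  shows "\<exists>b s'. a \<le> b \<and> \<bar>s'\<bar> = 1 \<and> (\<forall>z>b. 0 < s' * f z)"
proof -
  have mono: "s * f x < s * f y" if "a < x" "x < y" for x y
    by (rule DERIV_pos_imp_increasing[OF that(2)], rule exI, rule conjI[OF DERIV_cmult[OF f] g]) (use that in auto)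
  show ?thesis
  proof (cases "\<exists>x>a. 0 \<le> s * f x")
    case True
    then obtain x where x: "a < x" "0 \<le> s * f x" by blast
    then show ?thesis using mono[of x] s by (intro exI[of _ x] exI[of _ s]) force
  next
    case False
    then show ?thesis using s by (intro exI[of _ a] exI[of _ "- s"]) (auto simp: not_le)
  qed
qed

text \<open>Signs are propagated downwards from the top derivative, as a function with a derivative of constant sign
has ultimately constant sign itself. Upwards from \<open>h \<longlongrightarrow> 0\<close>, every derivative with
monotone behaviour vanishes at infinity; this makes the signs alternate and puts l'Hopital's rule in force.\<close>

theorem smoothly_varying_derivs:
  assumes sv: "smoothly_varying h (- \<alpha>) (Suc m)" and lim: "(h \<longlongrightarrow> 0) at_top" and nonneg: "\<And>x. 0 \<le> h x"
  obtains b where "0 \<le> b"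
    "\<And>j x. j \<le> m \<Longrightarrow> b < x \<Longrightarrow> ((deriv ^^ j) h has_real_derivative (deriv ^^ Suc j) h x) (at x)"
    "\<And>j x. j \<le> Suc m \<Longrightarrow> b < x \<Longrightarrow> 0 < (-1) ^ j * (deriv ^^ j) h x"
    "\<And>j l. j \<le> Suc m \<Longrightarrow> 0 < l \<Longrightarrow>
      ((\<lambda>x. (deriv ^^ j) h (l * x) / (deriv ^^ j) h x) \<longlongrightarrow> l powr (- \<alpha> - real j)) at_top"
proof -
  define D where "D j = (deriv ^^ j) h" for j
  from sv obtain a where a: "\<And>j x. j \<le> m \<Longrightarrow> a < x \<Longrightarrow> D j differentiable (at x)"
    by (auto simp: smoothly_varying_def ultimately_C_def D_def less_Suc_eq_le)
  have der: "(D j has_real_derivative D (Suc j) x) (at x)" if "j \<le> m" "a < x" for j x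
    using DERIV_deriv_iff_real_differentiable[THEN iffD2, OF a[OF that]] by (simp add: D_def)
  have top: "regularly_varying (D (Suc m)) (- \<alpha> - real (Suc m))"
    using sv by (simp add: smoothly_varying_def D_def)
  have top_sign: "\<exists>b s. a \<le> b \<and> \<bar>s\<bar> = 1 \<and> (\<forall>z>b. 0 < s * D (Suc m) z)"
  proof -
    have "(\<forall>\<^sub>F t in at_top. 0 < 1 * D (Suc m) t) \<or> (\<forall>\<^sub>F t in at_top. 0 < (-1) * D (Suc m) t)"
      using top by (auto simp: regularly_varying_def)
    then obtain s b where s: "\<bar>s\<bar> = (1 :: real)" "\<And>z. b \<le> z \<Longrightarrow> 0 < s * D (Suc m) z"
      unfolding eventually_at_top_linorder by (metis abs_1 abs_minus_cancel)
    then show ?thesis by (intro exI[of _ "max a b"] exI[of _ s]) auto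
  qed
  have "\<exists>b\<ge>a. \<forall>j\<in>{Suc m - i..Suc m}. \<exists>s. \<bar>s\<bar> = 1 \<and> (\<forall>z>b. 0 < s * D j z)" if "i \<le> Suc m" for i
    using that
  proof (induction i)
    case 0
    then show ?case using top_sign by auto
  next
    case (Suc i)
    then obtain b where b: "a \<le> b" "\<And>j. j \<in> {Suc m - i..Suc m} \<Longrightarrow> \<exists>s. \<bar>s\<bar> = 1 \<and> (\<forall>z>b. 0 < s * D j z)" by auto
    define k where "k = Suc m - Suc i"
    have k: "Suc k = Suc m - i" "k \<le> m" using Suc.prems by (auto simp: k_def)
    have "Suc k \<in> {Suc m - i..Suc m}" using k by simp
    then obtain s where s: "\<bar>s\<bar> = 1" "\<And>z. b < z \<Longrightarrow> 0 < s * D (Suc k) z" using b(2) by blast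
    obtain b' s' where b': "b \<le> b'" "\<bar>s'\<bar> = 1" "\<And>z. b' < z \<Longrightarrow> 0 < s' * D k z"
      using eventual_sign_antiderivative[of b "D k" "D (Suc k)" s] der[OF k(2)] s b(1) by force
    have "\<exists>s. \<bar>s\<bar> = 1 \<and> (\<forall>z>b'. 0 < s * D j z)" if j: "j \<in> {Suc m - Suc i..Suc m}" for j
    proof (cases "j = k")
      case True
      then show ?thesis using b' by blast
    next
      case False
      then have "j \<in> {Suc m - i..Suc m}" using j k by (auto simp: k_def)
      then show ?thesis using b(2)[of j] b'(1) by force
    qed
    then show ?case using b(1) b'(1) by (intro exI[of _ b']) auto
  qed
  from this[of "Suc m"] obtain b0 where b0: "a \<le> b0" "\<And>j. j \<le> Suc m \<Longrightarrow> \<exists>s. \<bar>s\<bar> = 1 \<and> (\<forall>z>b0. 0 < s * D j z)"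
    by auto
  define b where "b = max b0 0"
  have b: "a \<le> b" "0 \<le> b" and sgn: "\<And>j. j \<le> Suc m \<Longrightarrow> \<exists>s. \<bar>s\<bar> = 1 \<and> (\<forall>z>b. 0 < s * D j z)"
    using b0 by (auto simp: b_def) (metis b0(2))
  have derb: "(D j has_real_derivative D (Suc j) x) (at x)" if "j \<le> m" "b < x" for j x
    using der that b by auto
  have lim_D: "(D j \<longlongrightarrow> 0) at_top" if "j \<le> m" for j
    using that
  proof (induction j)
    case 0
    then show ?case using lim by (simp add: D_def)
  next
    case (Suc j)
    obtain s where s: "\<bar>s\<bar> = 1" "\<And>z. b < z \<Longrightarrow> 0 < s * D (Suc (Suc j)) z" using sgn[of "Suc (Suc j)"] Suc.prems by auto
    show ?case
      by (rule deriv_tendsto_0[where f = "D j" and k = "D (Suc (Suc j))" and s = s and a = b])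
        (use Suc derb s in auto)
  qed
  have sign: "0 < (-1) ^ j * D j x" if "j \<le> Suc m" "b < x" for j x
    using that
  proof (induction j)
    case 0
    obtain s where s: "\<bar>s\<bar> = 1" "\<And>z. b < z \<Longrightarrow> 0 < s * D 0 z" using sgn[of 0] by auto
    then have "D 0 x \<noteq> 0" using 0 by fastforce
    then show ?case using nonneg[of x] by (simp add: D_def)
  next
    case (Suc j)
    obtain s where s: "\<bar>s\<bar> = 1" "\<And>z. b < z \<Longrightarrow> 0 < s * D (Suc j) z" using sgn[of "Suc j"] Suc.prems by auto
    have "s * D j x < 0"
      using Suc.prems tendsto_mult_left[OF lim_D[of j], of s]
      by (intro pos_deriv_tendsto_0[of b "\<lambda>z. s * D j z" "\<lambda>z. s * D (Suc j) z"]) (auto intro!: DERIV_cmult derb s)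
    moreover have "0 < (-1) ^ j * D j x" using Suc by simp
    ultimately have "s = (-1) ^ Suc j"
      using s(1) by (cases "even j") (auto simp: abs_if mult_less_0_iff zero_less_mult_iff split: if_splits)
    then show ?case using s(2) Suc.prems by blast
  qed
  have rv: "((\<lambda>x. D j (l * x) / D j x) \<longlongrightarrow> l powr (- \<alpha> - real j)) at_top" if "j \<le> Suc m" "0 < l" for j l
    using that(1)
  proof (induction j rule: inc_induct)
    case base
    show ?case using top that(2) by (auto simp: regularly_varying_def)
  next
    case (step j)
    have "((\<lambda>x. D j (l * x) / D j x) \<longlongrightarrow> l * l powr (- \<alpha> - real (Suc j))) at_top"
      using step.hyps sign[of "Suc j"] b that(2)
      by (intro regular_variation_antiderivative[where a = b and s = "(-1) ^ Suc j" and g = "D (Suc j)"] derb lim_D step.IH)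
        (auto simp: power_abs)
    also have "l * l powr (- \<alpha> - real (Suc j)) = l powr (1 + (- \<alpha> - real (Suc j)))"
      using that(2) by (intro powr_mult_base) simp
    finally show ?case by (simp add: algebra_simps)
  qed
  show thesis using that[OF b(2)] derb sign rv by (simp add: D_def)
qed

section \<open>Scales of derivatives and convolution\<close>

text \<open>The Laplace character of a measure rather than of a distribution function: the arguments below integrate
against the ladder height laws.\<close>

definition lchar :: "real measure \<Rightarrow> nat \<Rightarrow> real poly" where
  "lchar \<nu> n = (\<Sum>k\<le>n. monom ((-1) ^ k / fact k * (LINT y|\<nu>. y ^ k)) k)"

lemma coeff_lchar: "coeff (lchar \<nu> n) i = (if i \<le> n then (-1) ^ i / fact i * (LINT y|\<nu>. y ^ i) else 0)"
  by (simp add: lchar_def coeff_sum coeff_monom if_distrib[of "\<lambda>x. _ = x"] if_distrib cong: if_cong)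

lemma cmult_smallo: "f \<in> o[F](g) \<Longrightarrow> (\<lambda>x. c * f x) \<in> o[F](g)" for c :: real
  by (cases "c = 0") auto

lemma integrable_power_le:
  fixes \<nu> :: "real measure"
  assumes "finite_measure \<nu>" "sets \<nu> = sets borel" "integrable \<nu> (\<lambda>y. y ^ n)" "i \<le> n"
  shows "integrable \<nu> (\<lambda>y. y ^ i)"
proof -
  interpret finite_measure \<nu> by fact
  have [measurable_cong]: "sets \<nu> = sets borel" by fact
  show ?thesis
  proof (rule Bochner_Integration.integrable_bound)
    show "integrable \<nu> (\<lambda>y. 1 + \<bar>y ^ n\<bar>)" using assms by auto
    show "AE y in \<nu>. norm (y ^ i) \<le> norm (1 + \<bar>y ^ n\<bar>)"
    proof (intro AE_I2)
      fix y :: real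
      have "\<bar>y\<bar> ^ i \<le> 1 + \<bar>y\<bar> ^ n"
      proof (cases "\<bar>y\<bar> \<le> 1")
        case True
        then have "\<bar>y\<bar> ^ i \<le> 1" by (simp add: power_le_one)
        then show ?thesis by (simp add: add_increasing2)
      next
        case False
        then show ?thesis using power_increasing[OF assms(4), of "\<bar>y\<bar>"] by linarith
      qed
      then show "norm (y ^ i) \<le> norm (1 + \<bar>y ^ n\<bar>)" by (simp add: power_abs)
    qed
  qed measurable
qed

lemma le_suminf: "f k \<le> suminf f" for f :: "nat \<Rightarrow> ennreal"
  using sum_le_suminf[of f "{k}"] by simp

text \<open>Bounds a moment by the tail at powers of two, to which the ratio test applies.\<close>

lemma nn_power_dyadic:
  fixes y :: real
  assumes "0 \<le> y"
  shows "ennreal (y ^ n) \<le> 1 + (\<Sum>k. ennreal (2 ^ (Suc k * n) * indicator {2 ^ k<..} y))"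
proof (cases "y \<le> 1")
  case True
  then have "ennreal (y ^ n) \<le> 1" using assms by (simp add: power_le_one)
  then show ?thesis by (simp add: add_increasing2)
next
  case False
  define K where "K = (LEAST K. y \<le> 2 ^ K)"
  have ex: "\<exists>K. y \<le> 2 ^ K" using real_arch_pow[of 2 y] by (auto intro: less_imp_le)
  have K: "y \<le> 2 ^ K" unfolding K_def by (rule LeastI_ex[OF ex])
  then have "K \<noteq> 0" using False by (intro notI) simp
  then obtain k where k: "K = Suc k" by (cases K) auto
  have "\<not> y \<le> 2 ^ k" using not_less_Least[of k "\<lambda>K. y \<le> 2 ^ K"] k by (simp add: K_def)
  then have y: "2 ^ k < y" by simp
  have "y ^ n \<le> (2 ^ Suc k) ^ n" using K k assms by (intro power_mono) auto
  also have "\<dots> = 2 ^ (Suc k * n)" by (simp only: power_mult)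
  finally have "ennreal (y ^ n) \<le> ennreal (2 ^ (Suc k * n) * indicator {2 ^ k<..} y)"
    using y by (intro ennreal_leI) simp
  also have "\<dots> \<le> (\<Sum>k. ennreal (2 ^ (Suc k * n) * indicator {2 ^ k<..} y))"
    by (rule le_suminf)
  finally show ?thesis by (simp add: add_increasing)
qed

lemma borel_measurable_tail:
  assumes "finite_measure N" "sets N = sets borel"
  shows "(\<lambda>x::real. measure N {x<..}) \<in> borel_measurable borel"
proof -
  interpret finite_measure N by fact
  have "(\<lambda>x. - measure N {x<..}) \<in> borel_measurable borel"
  proof (rule borel_measurable_mono, rule monoI)
    fix x y :: real assume "x \<le> y"
    then have "measure N {y<..} \<le> measure N {x<..}"
      using assms(2) by (intro finite_measure_mono) auto
    then show "- measure N {x<..} \<le> - measure N {y<..}" by simp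
  qed
  then show ?thesis by simp
qed

text \<open>The functions \<open>d j = \<phi>\<^sup>(\<^sup>j\<^sup>)\<close> for a primitive \<open>\<phi>\<close> of
a tail of index \<open>- \<beta> - 1\<close>. Each is smaller than the preceding one by a factor of exact order
\<open>x\<close>, so they form an asymptotic scale. The alternating signs are those of the derivatives of a primitive
that vanishes at infinity; they make the absolute values monotone, and estimates that hold at one point hold beyond
it.\<close>

locale deriv_scale =
  fixes d :: "nat \<Rightarrow> real \<Rightarrow> real" and m :: nat and \<beta> a :: real
  assumes order_pos: "1 \<le> m" and expo: "real m < \<beta> + 1" and a_nonneg: "0 \<le> a"
    and meas [measurable]: "\<And>j. d j \<in> borel_measurable borel"
    and deriv: "\<And>j x. j < m \<Longrightarrow> a < x \<Longrightarrow> (d j has_real_derivative d (Suc j) x) (at x)"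
    and sign: "\<And>j x. j \<le> m \<Longrightarrow> a < x \<Longrightarrow> 0 < (-1) ^ Suc j * d j x"
    and anti: "\<And>j x y. j \<le> m \<Longrightarrow> a < x \<Longrightarrow> x \<le> y \<Longrightarrow> \<bar>d j y\<bar> \<le> \<bar>d j x\<bar>"
    and rv: "\<And>j l. j \<le> m \<Longrightarrow> 0 < l \<Longrightarrow>
      ((\<lambda>x. d j (l * x) / d j x) \<longlongrightarrow> l powr (- \<beta> - real j)) at_top"
begin

lemma beta_pos: "0 < \<beta>"
  using order_pos expo by linarith

lemma nonzero: "j \<le> m \<Longrightarrow> a < x \<Longrightarrow> d j x \<noteq> 0"
  using sign[of j x] by auto

lemma eventually_nonzero: "j \<le> m \<Longrightarrow> eventually (\<lambda>x. d j x \<noteq> 0) at_top"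
  using eventually_gt_at_top[of a] by eventually_elim (simp add: nonzero)

lemma same_sign: "j \<le> m \<Longrightarrow> a < x \<Longrightarrow> a < y \<Longrightarrow> 0 < d j x * d j y"
  using mult_pos_pos[OF sign[of j x] sign[of j y]]
  by (cases "even j") (auto simp: mult.commute)

lemma ratio_eq: "j \<le> m \<Longrightarrow> a < x \<Longrightarrow> a < y \<Longrightarrow> d j x / d j y = \<bar>d j x\<bar> / \<bar>d j y\<bar>"
  using same_sign[of j x y] by (auto simp: zero_less_mult_iff)

lemma diff_le: "j \<le> m \<Longrightarrow> a < x \<Longrightarrow> x \<le> y \<Longrightarrow> \<bar>d j x - d j y\<bar> = \<bar>d j x\<bar> - \<bar>d j y\<bar>"
  using same_sign[of j x y] anti[of j x y] by (auto simp: zero_less_mult_iff)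

lemma shift_ratio_nonneg:
  assumes j: "j \<le> m" and u: "0 \<le> u"
  shows "((\<lambda>x. d j (x + u) / d j x) \<longlongrightarrow> 1) at_top"
proof -
  have abs_rv: "((\<lambda>x. \<bar>d j (l * x)\<bar> / \<bar>d j x\<bar>) \<longlongrightarrow> l powr (- \<beta> - real j)) at_top" if "0 < l" for l
    using tendsto_rabs[OF rv[OF j that]] by (simp add: abs_divide)
  have "((\<lambda>x. \<bar>d j (x + u)\<bar> / \<bar>d j x\<bar>) \<longlongrightarrow> 1) at_top"
    using j nonzero[OF j] by (intro long_tailed[where a = a and \<rho> = "- \<beta> - real j"] anti abs_rv u) auto
  then show ?thesis
  proof (rule Lim_transform_eventually)
    show "eventually (\<lambda>x. \<bar>d j (x + u)\<bar> / \<bar>d j x\<bar> = d j (x + u) / d j x) at_top"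
      using eventually_gt_at_top[of a] by eventually_elim (use j u in \<open>simp add: ratio_eq\<close>)
  qed
qed

text \<open>For negative \<open>u\<close>, exchange the two arguments.\<close>

lemma shift_ratio:
  assumes j: "j \<le> m"
  shows "((\<lambda>x. d j (x + u) / d j x) \<longlongrightarrow> 1) at_top"
proof (cases "0 \<le> u")
  case False
  have "((\<lambda>x. inverse (d j (x + u + - u) / d j (x + u))) \<longlongrightarrow> inverse 1) at_top"
    using False
    by (intro tendsto_inverse filterlim_compose[OF shift_ratio_nonneg[OF j, of "- u"]])
       (auto intro!: filterlim_tendsto_add_at_top[OF tendsto_const filterlim_ident, of u, simplified add.commute])
  then show ?thesis by simp
qed (use shift_ratio_nonneg j in auto)

lemma scaled_bigo:
  assumes j: "j \<le> m" and l: "0 < l"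
  shows "(\<lambda>x. d j (l * x)) \<in> O(d j)"
  by (rule bigoI_tendsto[OF rv[OF j l] eventually_nonzero[OF j]])

lemma half_bigo: "j \<le> m \<Longrightarrow> (\<lambda>x. d j (x / 2)) \<in> O(d j)"
  using scaled_bigo[of j "1/2"] by simp

text \<open>Mean value theorem on \<open>[x/2, x]\<close>, where the derivative is in absolute value at least what it
is at \<open>x\<close>.\<close>

lemma deriv_bigo:
  assumes j: "j < m"
  shows "(\<lambda>x. x * d (Suc j) x) \<in> O(d j)"
proof -
  have "(\<lambda>x. x * d (Suc j) x) \<in> O(\<lambda>x. d j (x / 2))"
  proof (rule bigoI[where c = 2])
    show "eventually (\<lambda>x. norm (x * d (Suc j) x) \<le> 2 * norm (d j (x / 2))) at_top"
      using eventually_gt_at_top[of "2 * a"]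
    proof eventually_elim
      case (elim x)
      then have x: "x / 2 < x" "a < x / 2" "0 < x" "a < x" using a_nonneg by auto
      obtain z where z: "x / 2 < z" "z < x" "d j x - d j (x / 2) = (x - x / 2) * d (Suc j) z"
        using MVT2[of "x/2" x "d j" "d (Suc j)"] deriv[OF j] x by (meson less_le_trans)
      have "x / 2 * \<bar>d (Suc j) x\<bar> \<le> x / 2 * \<bar>d (Suc j) z\<bar>"
        using j x z by (intro mult_left_mono anti) auto
      also have "\<dots> = \<bar>(x - x / 2) * d (Suc j) z\<bar>"
        using x by (simp add: abs_mult)
      also have "\<dots> = \<bar>d j (x / 2) - d j x\<bar>"
        by (simp only: z(3) abs_minus_commute)
      also have "\<dots> \<le> \<bar>d j (x / 2)\<bar>"
        using j x by (subst diff_le) auto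
      finally show ?case using x by (simp add: abs_mult)
    qed
  qed
  also have "(\<lambda>x. d j (x / 2)) \<in> O(d j)" using j by (intro half_bigo) auto
  finally show ?thesis .
qed

text \<open>Mean value theorem on \<open>[x, 2 x]\<close>; the decrease there is at least a fixed fraction of \<open>d
j x\<close>, because the index \<open>- \<beta> - j\<close> is negative.\<close>

lemma bigo_deriv:
  assumes j: "j < m"
  shows "d j \<in> O(\<lambda>x. x * d (Suc j) x)"
proof -
  define r where "r = 2 powr (- \<beta> - real j)"
  have r: "r < 1" unfolding r_def using beta_pos by (subst powr_less_one) auto
  define q where "q = (1 + r) / 2"
  have q: "r < q" "q < 1" using r by (auto simp: q_def)
  have ev: "eventually (\<lambda>x. d j (2 * x) / d j x < q) at_top"
    using rv[of j 2] j q by (auto simp: r_def dest: order_tendstoD(2))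
  show ?thesis
  proof (rule bigoI[where c = "1 / (1 - q)"])
    show "eventually (\<lambda>x. norm (d j x) \<le> 1 / (1 - q) * norm (x * d (Suc j) x)) at_top"
      using eventually_gt_at_top[of a] ev
    proof eventually_elim
      case (elim x)
      then have x: "x < 2 * x" "a < 2 * x" "0 < x" using a_nonneg by auto
      obtain z where z: "x < z" "z < 2 * x" "d j (2 * x) - d j x = (2 * x - x) * d (Suc j) z"
        using MVT2[of x "2*x" "d j" "d (Suc j)"] deriv[OF j] x elim by (meson less_le_trans)
      have "\<bar>d j (2 * x)\<bar> \<le> q * \<bar>d j x\<bar>"
        using elim j x nonzero[of j x] by (simp add: ratio_eq divide_less_eq)
      then have "(1 - q) * \<bar>d j x\<bar> \<le> \<bar>d j x\<bar> - \<bar>d j (2 * x)\<bar>" by (simp add: algebra_simps)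
      also have "\<dots> = \<bar>d j x - d j (2 * x)\<bar>" using j elim x by (subst diff_le) auto
      also have "\<dots> = x * \<bar>d (Suc j) z\<bar>"
        using z x by (subst abs_minus_commute) (simp add: abs_mult)
      also have "\<dots> \<le> x * \<bar>d (Suc j) x\<bar>"
        using j x z elim by (intro mult_left_mono anti) auto
      finally show ?case using q x by (simp add: abs_mult field_simps)
    qed
  qed
qed

lemma bigo_power:
  assumes "j + n \<le> m"
  shows "d j \<in> O(\<lambda>x. x ^ n * d (j + n) x)" "(\<lambda>x. x ^ n * d (j + n) x) \<in> O(d j)"
  using assms
proof (induction n)
  case (Suc n)
  { case 1
    have "d j \<in> O(\<lambda>x. x ^ n * d (j + n) x)" using 1 Suc.IH by simp
    also have "(\<lambda>x. x ^ n * d (j + n) x) \<in> O(\<lambda>x. x ^ n * (x * d (Suc (j + n)) x))"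
      using 1 by (intro landau_o.big.mult_left bigo_deriv) auto
    finally show ?case by (simp add: mult.assoc mult.left_commute) }
  { case 2
    have "(\<lambda>x. x ^ n * (x * d (Suc (j + n)) x)) \<in> O(\<lambda>x. x ^ n * d (j + n) x)"
      using 2 by (intro landau_o.big.mult_left deriv_bigo) auto
    also have "(\<lambda>x. x ^ n * d (j + n) x) \<in> O(d j)" using 2 Suc.IH by simp
    finally show ?case by (simp add: mult.assoc mult.left_commute) }
qed simp_all

text \<open>In Lagrange's remainder the intermediate point is replaced by the end point \<open>x - y\<close>, as the
last derivative is monotone.\<close>

lemma taylor_bound:
  assumes k: "k + n \<le> m" and x: "2 * a < x" and y: "y \<le> x / 2"
  shows "\<bar>d k (x - y) - (\<Sum>i\<le>n. (- y) ^ i / fact i * d (k + i) x)\<bar>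
    \<le> \<bar>y\<bar> ^ n * \<bar>d (k + n) (x - y) - d (k + n) x\<bar>"
proof -
  have ax: "a < x" "a < x - y" using x y a_nonneg by auto
  consider "n = 0" | "y = 0" | "0 < n" "y \<noteq> 0" by blast
  then show ?thesis
  proof cases
    case 2
    have "(\<Sum>i\<le>n. 0 ^ i / fact i * d (k + i) x) = (\<Sum>i\<in>{0}. 0 ^ i / fact i * d (k + i) x)"
      by (rule sum.mono_neutral_right) auto
    then show ?thesis using 2 by simp
  next
    case 3
    have "\<exists>t. (if x - y < x then x - y < t \<and> t < x else x < t \<and> t < x - y) \<and>
      d k (x - y) = (\<Sum>i<n. d (k + i) x / fact i * (x - y - x) ^ i) + d (k + n) t / fact n * (x - y - x) ^ n"
      using 3 k ax
      by (intro Taylor[where a = "min x (x - y)" and b = "max x (x - y)" and f = "d k"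
            and diff = "\<lambda>i. d (k + i)"]) (auto intro!: deriv)
    then obtain t where t: "if x - y < x then x - y < t \<and> t < x else x < t \<and> t < x - y"
      "d k (x - y) = (\<Sum>i<n. d (k + i) x / fact i * (- y) ^ i) + d (k + n) t / fact n * (- y) ^ n"
      by auto
    have "{..n} = insert n {..<n}" by auto
    then have "d k (x - y) - (\<Sum>i\<le>n. (- y) ^ i / fact i * d (k + i) x) =
      (- y) ^ n / fact n * (d (k + n) t - d (k + n) x)"
      unfolding t(2) by (simp add: algebra_simps)
    then have "\<bar>d k (x - y) - (\<Sum>i\<le>n. (- y) ^ i / fact i * d (k + i) x)\<bar> =
      \<bar>y\<bar> ^ n / fact n * \<bar>d (k + n) t - d (k + n) x\<bar>"
      by (simp add: abs_mult power_abs)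
    also have "\<dots> \<le> \<bar>y\<bar> ^ n * \<bar>d (k + n) (x - y) - d (k + n) x\<bar>"
    proof (rule mult_mono)
      show "\<bar>y\<bar> ^ n / fact n \<le> \<bar>y\<bar> ^ n"
        using fact_ge_1[of n, where 'a = real] by (simp add: divide_le_eq mult_le_cancel_left1)
      show "\<bar>d (k + n) t - d (k + n) x\<bar> \<le> \<bar>d (k + n) (x - y) - d (k + n) x\<bar>"
      proof (cases "x - y < x")
        case True
        then show ?thesis
          using t(1) ax k diff_le[of "k + n" t x] diff_le[of "k + n" "x - y" x] anti[of "k + n" "x - y" t]
          by auto
      next
        case False
        then have "x < t" "t < x - y" using t(1) by auto
        then show ?thesis
          using ax k diff_le[of "k + n" x t] diff_le[of "k + n" x "x - y"] anti[of "k + n" t "x - y"]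
          by (auto simp: abs_minus_commute[of _ "d (k + n) x"])
      qed
    qed auto
    finally show ?thesis .
  qed simp
qed

text \<open>For \<open>y \<le> x / 2\<close> the last derivative is evaluated beyond \<open>x / 2\<close>, where it is
at most a multiple of its value at \<open>x\<close>; this dominates the remainder by the \<open>n\<close>-th power of
\<open>y\<close>. Pointwise the relative remainder vanishes since the scale is long tailed.\<close>

lemma taylor_remainder_tendsto:
  assumes \<nu>: "sets \<nu> = sets borel" "integrable \<nu> (\<lambda>y::real. y ^ n)" and k: "k + n \<le> m"
  shows "((\<lambda>x. (LINT y|\<nu>. indicator {..x/2} y * (d k (x - y) - (\<Sum>i\<le>n. (- y) ^ i / fact i * d (k + i) x))
    / d (k + n) x)) \<longlongrightarrow> (LINT y|\<nu>. 0)) at_top"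
proof -
  have [measurable_cong]: "sets \<nu> = sets borel" by fact
  obtain C where C: "eventually (\<lambda>x. norm (d (k + n) (x / 2)) \<le> C * norm (d (k + n) x)) at_top"
    using landau_o.bigE[OF half_bigo[OF k]] by blast
  have int: "integrable \<nu> (\<lambda>y. C * \<bar>y ^ n\<bar>)"
    using \<nu>(2) by (intro integrable_mult_right integrable_abs)
  show ?thesis
  proof (rule integral_dominated_convergence_at_top[OF _ _ int])
    show "eventually (\<lambda>x. AE y in \<nu>. norm (indicator {..x/2} y * (d k (x - y) - (\<Sum>i\<le>n. (- y) ^ i / fact i * d (k + i) x))
        / d (k + n) x) \<le> C * \<bar>y ^ n\<bar>) at_top"
      using C eventually_gt_at_top[of "2 * a"]
    proof eventually_elim
      case (elim x)
      have ax: "a < x" "a < x / 2" using elim a_nonneg by auto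
      have C0: "0 \<le> C" using elim(1) nonzero[OF k ax(1)]
        by (metis abs_ge_zero order_trans real_norm_def zero_le_mult_iff zero_less_abs_iff not_le)
      show ?case
      proof (intro AE_I2)
        fix y
        show "norm (indicator {..x/2} y * (d k (x - y) - (\<Sum>i\<le>n. (- y) ^ i / fact i * d (k + i) x))
          / d (k + n) x) \<le> C * \<bar>y ^ n\<bar>"
        proof (cases "y \<le> x / 2")
          case True
          then have y: "x / 2 \<le> x - y" "a < x - y" using ax by auto
          have "\<bar>d (k + n) (x - y) - d (k + n) x\<bar> \<le> \<bar>d (k + n) (x / 2)\<bar>"
          proof (cases "x - y \<le> x")
            case True
            then show ?thesis
              using k y ax diff_le[of "k + n" "x - y" x] anti[of "k + n" "x / 2" "x - y"] by auto
          next
            case False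
            then show ?thesis
              using k y ax diff_le[of "k + n" x "x - y"] anti[of "k + n" "x / 2" x] elim a_nonneg
              by (auto simp: abs_minus_commute[of _ "d (k + n) x"])
          qed
          also have "\<dots> \<le> C * \<bar>d (k + n) x\<bar>" using elim by simp
          finally have *: "\<bar>y\<bar> ^ n * \<bar>d (k + n) (x - y) - d (k + n) x\<bar> \<le> \<bar>y\<bar> ^ n * (C * \<bar>d (k + n) x\<bar>)"
            by (intro mult_left_mono) auto
          show ?thesis
            using order_trans[OF taylor_bound[OF k elim(2) True] *] True nonzero[OF k ax(1)]
            by (simp add: divide_le_eq power_abs mult_ac)
        qed (use C0 in auto)
      qed
    qed
    show "AE y in \<nu>. ((\<lambda>x. indicator {..x/2} y * (d k (x - y) - (\<Sum>i\<le>n. (- y) ^ i / fact i * d (k + i) x))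
        / d (k + n) x) \<longlongrightarrow> 0) at_top"
    proof (intro AE_I2)
      fix y
      have *: "((\<lambda>x. \<bar>y\<bar> ^ n * \<bar>d (k + n) (x + - y) / d (k + n) x - 1\<bar>) \<longlongrightarrow> \<bar>y\<bar> ^ n * \<bar>1 - 1\<bar>) at_top"
        by (intro tendsto_intros shift_ratio k)
      show "((\<lambda>x. indicator {..x/2} y * (d k (x - y) - (\<Sum>i\<le>n. (- y) ^ i / fact i * d (k + i) x))
        / d (k + n) x) \<longlongrightarrow> 0) at_top"
      proof (rule Lim_null_comparison)
        show "((\<lambda>x. \<bar>y\<bar> ^ n * \<bar>d (k + n) (x + - y) / d (k + n) x - 1\<bar>) \<longlongrightarrow> 0) at_top"
          using * by simp
        show "eventually (\<lambda>x. norm (indicator {..x/2} y * (d k (x - y) - (\<Sum>i\<le>n. (- y) ^ i / fact i * d (k + i) x))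
          / d (k + n) x) \<le> \<bar>y\<bar> ^ n * \<bar>d (k + n) (x + - y) / d (k + n) x - 1\<bar>) at_top"
          using eventually_gt_at_top[of "2 * a"]
        proof eventually_elim
          case (elim x)
          have ax: "a < x" using elim a_nonneg by auto
          have "d (k + n) (x + - y) / d (k + n) x - 1 = (d (k + n) (x - y) - d (k + n) x) / d (k + n) x"
            using nonzero[OF k ax] by (simp add: field_simps)
          then show ?case
            using taylor_bound[OF k elim, of y] nonzero[OF k ax]
            by (simp add: indicator_def divide_right_mono)
        qed
      qed
    qed
  qed measurable
qed

text \<open>On \<open>y > x / 2\<close> one has \<open>x ^ (n - i) * y ^ i \<le> 2 ^ (n - i) * y ^ n\<close>, so
exchanging a truncated moment for the full one costs no more than the truncated \<open>n\<close>-th moment, which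
tends to \<open>0\<close>.\<close>

lemma tail_moment_smallo:
  assumes \<nu>: "finite_measure \<nu>" "sets \<nu> = sets borel" "integrable \<nu> (\<lambda>y::real. y ^ n)" and k: "k + n \<le> m"
    and i: "i \<le> n"
  shows "(\<lambda>x. (LINT y|\<nu>. indicator {x/2<..} y * y ^ i) * d (k + i) x) \<in> o(d (k + n))"
proof -
  interpret finite_measure \<nu> by fact
  have [measurable_cong]: "sets \<nu> = sets borel" by fact
  define T where "T i x = (LINT y|\<nu>. indicator {x/2<..} y * y ^ i)" for i and x :: real
  have "((\<lambda>x::real. LINT y|\<nu>. indicator {x/2<..} y * y ^ n) \<longlongrightarrow> (LINT y|\<nu>. 0)) at_top"
  proof (rule integral_dominated_convergence_at_top[where w = "\<lambda>y. \<bar>y ^ n\<bar>"])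
    show "AE y in \<nu>. ((\<lambda>x. indicator {x / 2<..} y * y ^ n) \<longlongrightarrow> (0::real)) at_top"
    proof (intro AE_I2 tendsto_eventually)
      fix y :: real show "eventually (\<lambda>x. indicator {x / 2<..} y * y ^ n = 0) at_top"
        using eventually_gt_at_top[of "2 * y"] by eventually_elim (simp add: indicator_def)
    qed
  qed (use \<nu> in \<open>auto intro!: always_eventually simp: indicator_def\<close>)
  then have Tn: "(T n \<longlongrightarrow> 0) at_top" by (simp add: T_def[abs_def])
  then have Tn': "T n \<in> o(\<lambda>_. 1)" by (intro smalloI_tendsto) auto
  have "(\<lambda>x. x ^ (n - i) * T i x) \<in> O(T n)"
  proof (rule bigoI[where c = "2 ^ (n - i)"])
    show "eventually (\<lambda>x. norm (x ^ (n - i) * T i x) \<le> 2 ^ (n - i) * norm (T n x)) at_top"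
      using eventually_gt_at_top[of 0]
    proof eventually_elim
      case (elim x)
      have I: "integrable \<nu> (\<lambda>y. indicator {x/2<..} y * y ^ j)" if "j \<le> n" for j
        using integrable_mult_indicator[OF _ integrable_power_le[OF \<nu> that], of "{x/2<..}"] by simp
      have T0: "0 \<le> T j x" for j
        unfolding T_def using elim by (intro integral_nonneg_AE AE_I2) (auto simp: indicator_def)
      have "x ^ (n - i) * T i x = (LINT y|\<nu>. x ^ (n - i) * (indicator {x/2<..} y * y ^ i))"
        by (simp add: T_def)
      also have "\<dots> \<le> (LINT y|\<nu>. 2 ^ (n - i) * (indicator {x/2<..} y * y ^ n))"
      proof (intro integral_mono integrable_mult_right I)
        fix y
        show "x ^ (n - i) * (indicator {x/2<..} y * y ^ i) \<le> 2 ^ (n - i) * (indicator {x/2<..} y * y ^ n)"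
        proof (cases "x / 2 < y")
          case True
          have "x ^ (n - i) * y ^ i \<le> (2 * y) ^ (n - i) * y ^ i"
            using True elim by (intro mult_right_mono power_mono) auto
          also have "\<dots> = 2 ^ (n - i) * y ^ n" 
            using i by (simp add: power_mult_distrib flip: power_add)
          finally show ?thesis using True by simp
        qed simp
      qed (use i in auto)
      also have "\<dots> = 2 ^ (n - i) * T n x" by (simp add: T_def)
      finally show ?case using T0 elim by (simp add: abs_mult)
    qed
  qed
  then have "(\<lambda>x. x ^ (n - i) * T i x) \<in> o(\<lambda>_. 1)"
    using Tn' by (rule landau_o.big_small_trans)
  then have 1: "(\<lambda>x. x ^ (n - i) * T i x * d (k + n) x) \<in> o(d (k + n))"
    using landau_o.small_big_mult[of _ _ "\<lambda>_. 1" "d (k + n)" "d (k + n)"] by simp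
  have "(\<lambda>x. T i x * d (k + i) x) \<in> O(\<lambda>x. T i x * (x ^ (n - i) * d (k + i + (n - i)) x))"
    using k i by (intro landau_o.big.mult_left bigo_power) auto
  also have "k + i + (n - i) = k + n" using i by simp
  finally show ?thesis
    using 1 by (auto simp: mult_ac T_def intro: landau_o.big_small_trans)
qed

text \<open>The truncation at \<open>x / 2\<close> serves both convolution equations. It has no effect on a law of the
negative half line, and for a law of the positive half line it selects the part of the convolution in which this
summand is not the large one.\<close>

theorem taylor_integral:
  assumes \<nu>: "finite_measure \<nu>" "sets \<nu> = sets borel" "integrable \<nu> (\<lambda>y::real. y ^ n)" and k: "k + n \<le> m"
  shows "(\<lambda>x. (LINT y|\<nu>. indicator {..x/2} y * d k (x - y)) -
    (\<Sum>i\<le>n. (-1) ^ i / fact i * (LINT y|\<nu>. y ^ i) * d (k + i) x)) \<in> o(d (k + n))"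
    and "eventually (\<lambda>x. integrable \<nu> (\<lambda>y. indicator {..x/2} y * d k (x - y))) at_top"
proof -
  interpret finite_measure \<nu> by fact
  have [measurable_cong]: "sets \<nu> = sets borel" by fact
  define R where "R x y = indicator {..x/2} y * (d k (x - y) - (\<Sum>i\<le>n. (- y) ^ i / fact i * d (k + i) x))" for x y
  have R: "(\<lambda>x. LINT y|\<nu>. R x y) \<in> o(d (k + n))"
    using taylor_remainder_tendsto[OF \<nu>(2,3) k]
    by (intro smalloI_tendsto eventually_nonzero[OF k]) (simp add: R_def)
  have I: "integrable \<nu> (\<lambda>y. indicator B y * y ^ i)" if "i \<le> n" "B \<in> sets borel" for i B
    using integrable_mult_indicator[OF _ integrable_power_le[OF \<nu> that(1)], of B] that(2) \<nu>(2) by simp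
  show ev: "eventually (\<lambda>x. integrable \<nu> (\<lambda>y. indicator {..x/2} y * d k (x - y))) at_top"
    using eventually_gt_at_top[of "2 * a"]
  proof eventually_elim
    case (elim x)
    show ?case
    proof (rule Bochner_Integration.integrable_bound)
      show "integrable \<nu> (\<lambda>_. d k (x / 2))" by simp
      show "AE y in \<nu>. norm (indicator {..x/2} y * d k (x - y)) \<le> norm (d k (x / 2))"
        using k elim by (auto simp: indicator_def intro!: anti)
    qed measurable
  qed
  have "eventually (\<lambda>x. (LINT y|\<nu>. R x y) - (\<Sum>i\<le>n. (-1) ^ i / fact i * ((LINT y|\<nu>. indicator {x/2<..} y * y ^ i) * d (k + i) x)) =
    (LINT y|\<nu>. indicator {..x/2} y * d k (x - y)) -
    (\<Sum>i\<le>n. (-1) ^ i / fact i * (LINT y|\<nu>. y ^ i) * d (k + i) x)) at_top"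
    using ev
  proof eventually_elim
    case (elim x)
    have 1: "R x y = indicator {..x/2} y * d k (x - y) -
        (\<Sum>i\<le>n. ((-1) ^ i / fact i * d (k + i) x) * (indicator {..x/2} y * y ^ i))" for y
      by (simp add: R_def right_diff_distrib sum_distrib_left power_minus[of y] mult_ac)
    define c where "c i = (-1) ^ i / fact i * d (k + i) x" for i
    have "(LINT y|\<nu>. R x y) = (LINT y|\<nu>. indicator {..x/2} y * d k (x - y)) -
        (LINT y|\<nu>. (\<Sum>i\<le>n. c i * (indicator {..x/2} y * y ^ i)))"
      unfolding 1 c_def[symmetric]
      by (intro Bochner_Integration.integral_diff elim Bochner_Integration.integrable_sum integrable_mult_right I) auto
    also have "(LINT y|\<nu>. (\<Sum>i\<le>n. c i * (indicator {..x/2} y * y ^ i))) =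
        (\<Sum>i\<le>n. c i * (LINT y|\<nu>. indicator {..x/2} y * y ^ i))"
      by (subst Bochner_Integration.integral_sum) (auto intro!: integrable_mult_right I)
    finally have "(LINT y|\<nu>. R x y) = (LINT y|\<nu>. indicator {..x/2} y * d k (x - y)) -
        (\<Sum>i\<le>n. (-1) ^ i / fact i * d (k + i) x * (LINT y|\<nu>. indicator {..x/2} y * y ^ i))"
      by (simp only: c_def)
    moreover have "(LINT y|\<nu>. y ^ i) = (LINT y|\<nu>. indicator {..x/2} y * y ^ i) + (LINT y|\<nu>. indicator {x/2<..} y * y ^ i)"
      if "i \<le> n" for i
    proof -
      have "(LINT y|\<nu>. y ^ i) = (LINT y|\<nu>. indicator {..x/2} y * y ^ i + indicator {x/2<..} y * y ^ i)"
        by (intro Bochner_Integration.integral_cong) (auto simp: indicator_def)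
      then show ?thesis
        using that by (simp only: Bochner_Integration.integral_add[OF I[OF that, of "{..x/2}"] I[OF that, of "{x/2<..}"]]
          borel_comp atMost_borel greaterThan_borel)
    qed
    ultimately show ?case
      by (simp add: algebra_simps sum.distrib sum_subtractf add_divide_distrib)
  qed
  moreover have "(\<lambda>x. (LINT y|\<nu>. R x y) - (\<Sum>i\<le>n. (-1) ^ i / fact i * ((LINT y|\<nu>. indicator {x/2<..} y * y ^ i) * d (k + i) x))) \<in> o(d (k + n))"
    by (intro sum_in_smallo R big_sum_in_smallo landau_o.small.cmult_in_iff[THEN iffD2] )
       (auto intro!: tail_moment_smallo \<nu> k)
  ultimately show "(\<lambda>x. (LINT y|\<nu>. indicator {..x/2} y * d k (x - y)) -
    (\<Sum>i\<le>n. (-1) ^ i / fact i * (LINT y|\<nu>. y ^ i) * d (k + i) x)) \<in> o(d (k + n))"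
    by (subst (asm) landau_o.small.in_cong) auto
qed

end

context deriv_scale
begin

text \<open>The action on \<open>\<phi>\<close> of the class of \<open>P\<close> modulo \<open>D ^ (n +
1)\<close>.\<close>

definition act :: "nat \<Rightarrow> real poly \<Rightarrow> real \<Rightarrow> real" where
  "act n P x = (\<Sum>i\<le>n. coeff P i * d i x)"

lemma act_add: "act n (P + Q) x = act n P x + act n Q x"
  by (simp add: act_def distrib_right sum.distrib)

lemma act_diff: "act n (P - Q) x = act n P x - act n Q x"
  by (simp add: act_def left_diff_distrib sum_subtractf)

lemma measurable_act [measurable]: "act n P \<in> borel_measurable borel"
  unfolding act_def by measurable

text \<open>Polynomial multiplication is composition of actions, as \<open>d (k + i)\<close> is the
\<open>i\<close>-th derivative of \<open>d k\<close>.\<close>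

lemma act_mult:
  "act n (P * Q) x = (\<Sum>k\<le>n. coeff P k * (\<Sum>i\<le>n - k. coeff Q i * d (k + i) x))"
proof -
  have "act n (P * Q) x = (\<Sum>j\<le>n. \<Sum>i\<le>j. coeff P i * coeff Q (j - i) * d (i + (j - i)) x)"
    by (simp add: act_def coeff_mult sum_distrib_right)
  also have "\<dots> = (\<Sum>(i, j)\<in>{(i, j). i + j \<le> n}. coeff P i * coeff Q j * d (i + j) x)"
    by (subst sum.triangle_reindex_eq) simp
  also have "{(i, j). i + j \<le> n} = (SIGMA k:{..n}. {..n - k})" by auto
  also have "(\<Sum>(i, j)\<in>\<dots>. coeff P i * coeff Q j * d (i + j) x) =
      (\<Sum>k\<le>n. \<Sum>i\<le>n - k. coeff P k * coeff Q i * d (k + i) x)"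
    by (subst sum.Sigma) auto
  finally show ?thesis by (simp add: sum_distrib_left mult.assoc)
qed

lemma d_smallo_1: "j \<le> m \<Longrightarrow> (d j \<longlongrightarrow> 0) at_top"
proof -
  assume j: "j \<le> m"
  define r where "r = 2 powr (- \<beta> - real j)"
  have r: "0 < r" "r < 1" unfolding r_def using beta_pos by (auto simp: powr_less_one)
  have "eventually (\<lambda>x. \<bar>d j x\<bar> \<le> e) at_top" if e: "0 < e" for e
  proof -
    define q where "q = (1 + r) / 2"
    have q: "r < q" "0 < q" "q < 1" using r by (auto simp: q_def)
    have "eventually (\<lambda>x. d j (2 * x) / d j x < q) at_top"
      using rv[of j 2] j q by (auto simp: r_def dest: order_tendstoD(2))
    then obtain x0 where x0: "\<And>x. x0 \<le> x \<Longrightarrow> d j (2 * x) / d j x < q"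
      by (auto simp: eventually_at_top_linorder)
    define x1 where "x1 = max x0 (a + 1)"
    have x1: "x0 \<le> x1" "a < x1" "0 < x1" using a_nonneg by (auto simp: x1_def)
    have pow: "\<bar>d j (2 ^ n * x1)\<bar> \<le> q ^ n * \<bar>d j x1\<bar>" for n
    proof (induction n)
      case (Suc n)
      have ge: "x1 \<le> 2 ^ n * x1" using x1 by simp
      have "\<bar>d j (2 * (2 ^ n * x1))\<bar> \<le> q * \<bar>d j (2 ^ n * x1)\<bar>"
        using x0[of "2 ^ n * x1"] ge x1 j nonzero[OF j, of "2 ^ n * x1"]
        by (simp add: ratio_eq divide_less_eq)
      also have "\<dots> \<le> q * (q ^ n * \<bar>d j x1\<bar>)" using Suc q by (intro mult_left_mono) auto
      finally show ?case by (simp add: mult_ac)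
    qed simp
    have "(\<lambda>n. q ^ n * \<bar>d j x1\<bar>) \<longlonglongrightarrow> 0 * \<bar>d j x1\<bar>" using q by (intro tendsto_intros LIMSEQ_realpow_zero) auto
    from order_tendstoD(2)[OF this, of e] have "eventually (\<lambda>n. q ^ n * \<bar>d j x1\<bar> < e) sequentially"
      using e by simp
    then obtain n where n: "q ^ n * \<bar>d j x1\<bar> < e" by (auto simp: eventually_sequentially)
    have ge: "x1 \<le> 2 ^ n * x1" using x1 by simp
    show ?thesis
      using eventually_ge_at_top[of "2 ^ n * x1"]
    proof eventually_elim
      case (elim x)
      then show ?case using anti[OF j, of "2 ^ n * x1" x] pow[of n] n x1 ge by linarith
    qed
  qed
  note ev = this
  show ?thesis
  proof (rule tendstoI)
    fix e :: real assume "0 < e"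
    then show "eventually (\<lambda>x. dist (d j x) 0 < e) at_top"
      using ev[of "e / 2"] by (auto elim!: eventually_mono)
  qed
qed

lemma act_tendsto_0: "n \<le> m \<Longrightarrow> (act n P \<longlongrightarrow> 0) at_top"
  unfolding act_def by (intro tendsto_null_sum tendsto_mult_right_zero d_smallo_1) auto

lemma act_bounded:
  assumes n: "n \<le> m" and x: "a < x1" "x1 \<le> x"
  shows "\<bar>act n P x\<bar> \<le> (\<Sum>i\<le>n. \<bar>coeff P i\<bar> * \<bar>d i x1\<bar>)"
  unfolding act_def using n x
  by (intro order_trans[OF sum_abs] sum_mono) (auto simp: abs_mult intro!: mult_left_mono anti)

text \<open>Taylor's formula for the term \<open>D ^ k\<close> of \<open>P\<close> is carried to order \<open>n -
k\<close> only, so that every term leaves the same error \<open>o(d n)\<close>. Taken together these expansions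
multiply \<open>P\<close> by the Laplace character.\<close>

theorem act_convolution:
  assumes \<nu>: "finite_measure \<nu>" "sets \<nu> = sets borel" "integrable \<nu> (\<lambda>y::real. y ^ n)" and n: "n \<le> m"
  shows "(\<lambda>x. (LINT y|\<nu>. indicator {..x/2} y * act n P (x - y)) - act n (P * lchar \<nu> n) x) \<in> o(d n)"
proof -
  let ?T = "\<lambda>k x. (LINT y|\<nu>. indicator {..x/2} y * d k (x - y)) -
    (\<Sum>i\<le>n - k. (-1) ^ i / fact i * (LINT y|\<nu>. y ^ i) * d (k + i) x)"
  have M: "integrable \<nu> (\<lambda>y. y ^ (n - k))" for k
    using integrable_power_le[OF \<nu>, of "n - k"] by simp
  have "?T k \<in> o(d n)" if "k \<le> n" for k
    using taylor_integral(1)[OF \<nu>(1,2) M, of k k] n that by simp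
  then have 1: "(\<lambda>x. \<Sum>k\<le>n. coeff P k * ?T k x) \<in> o(d n)"
    by (intro big_sum_in_smallo cmult_smallo) auto
  have ev: "eventually (\<lambda>x. \<forall>k\<in>{..n}. integrable \<nu> (\<lambda>y. indicator {..x/2} y * d k (x - y))) at_top"
    using taylor_integral(2)[OF \<nu>(1,2) M, of k k for k] n by (intro eventually_ball_finite) auto
  have "eventually (\<lambda>x. (\<Sum>k\<le>n. coeff P k * ?T k x) =
      (LINT y|\<nu>. indicator {..x/2} y * act n P (x - y)) - act n (P * lchar \<nu> n) x) at_top"
    using ev
  proof eventually_elim
    case (elim x)
    have "(LINT y|\<nu>. indicator {..x/2} y * act n P (x - y)) =
        (LINT y|\<nu>. (\<Sum>k\<le>n. coeff P k * (indicator {..x/2} y * d k (x - y))))"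
      by (intro Bochner_Integration.integral_cong refl) (simp add: act_def sum_distrib_left mult_ac)
    also have "\<dots> = (\<Sum>k\<le>n. coeff P k * (LINT y|\<nu>. indicator {..x/2} y * d k (x - y)))"
      using elim by (subst Bochner_Integration.integral_sum) (auto intro!: integrable_mult_right)
    finally have A: "(LINT y|\<nu>. indicator {..x/2} y * act n P (x - y)) =
        (\<Sum>k\<le>n. coeff P k * (LINT y|\<nu>. indicator {..x/2} y * d k (x - y)))" .
    have "(\<Sum>k\<le>n. coeff P k * (LINT y|\<nu>. indicator {..x/2} y * d k (x - y))) - act n (P * lchar \<nu> n) x = (\<Sum>k\<le>n. coeff P k * ?T k x)"
      unfolding act_mult sum_subtractf[symmetric] right_diff_distrib
      by (intro sum.cong refl arg_cong2[of _ _ _ _ "(-)"] arg_cong2[of _ _ _ _ "(*)"]) (auto simp: coeff_lchar)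
    then show ?case by (simp only: A)
  qed
  then show ?thesis using 1 by (subst (asm) landau_o.small.in_cong) auto
qed

end

context deriv_scale
begin

text \<open>The tail at \<open>2 ^ k\<close> decays like \<open>2 powr (- \<beta> * k)\<close>, up to a factor of
slower than geometric growth.\<close>

lemma integrable_power_of_tail:
  assumes \<nu>: "finite_measure \<nu>" "sets \<nu> = sets borel" and pos: "AE y in \<nu>. 0 \<le> y"
    and tail: "(\<lambda>x. measure \<nu> {x<..}) \<in> O(d 0)" and n: "real n < \<beta>"
  shows "integrable \<nu> (\<lambda>y::real. y ^ n)"
proof -
  interpret finite_measure \<nu> by (rule \<nu>(1))
  have [measurable_cong]: "sets \<nu> = sets borel" by (rule \<nu>(2))
  have sp: "space \<nu> = UNIV" using sets_eq_imp_space_eq[OF \<nu>(2)] by simp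
  define r where "r = 2 ^ n * 2 powr (- \<beta>)"
  have "r = 2 powr (real n - \<beta>)" by (simp add: r_def powr_diff powr_minus powr_realpow field_simps)
  then have r: "0 < r" "r < 1" using n by (auto simp: r_def powr_less_one)
  define q where "q = (1 + r) / 2"
  have q: "r < q" "q < 1" "0 < q" using r by (auto simp: q_def)
  define s where "s k = 2 ^ (Suc k * n) * \<bar>d 0 (2 ^ k)\<bar>" for k
  have "2 powr (- \<beta> - real 0) < q / 2 ^ n" using q by (simp add: r_def field_simps)
  from order_tendstoD(2)[OF rv[of 0 2] this]
  have "eventually (\<lambda>x. d 0 (2 * x) / d 0 x < q / 2 ^ n) at_top" by simp
  then have "eventually (\<lambda>x. d 0 (2 * x) / d 0 x < q / 2 ^ n \<and> a < x) at_top"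
    using eventually_gt_at_top[of a] by eventually_elim simp
  moreover have pow: "filterlim (\<lambda>k. 2 ^ k :: real) at_top sequentially"
    by real_asymp
  ultimately have "eventually (\<lambda>k. d 0 (2 * 2 ^ k) / d 0 (2 ^ k) < q / 2 ^ n \<and> a < 2 ^ k) sequentially"
    by (auto simp: filterlim_iff)
  then obtain N where N: "\<And>k. N \<le> k \<Longrightarrow> d 0 (2 * 2 ^ k) / d 0 (2 ^ k) < q / 2 ^ n" "\<And>k. N \<le> k \<Longrightarrow> a < 2 ^ k"
    by (auto simp: eventually_sequentially)
  have "summable s"
  proof (rule summable_ratio_test[OF q(2)])
    fix k assume k: "N \<le> k"
    have "(0::real) < 2 ^ k" by simp
    have ak: "a < 2 ^ k" "a < 2 * 2 ^ k" using N(2)[OF k] a_nonneg by auto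
    have "\<bar>d 0 (2 * 2 ^ k)\<bar> \<le> q / 2 ^ n * \<bar>d 0 (2 ^ k)\<bar>"
      using N(1)[OF k] ak nonzero[of 0 "2 ^ k"] by (simp add: ratio_eq pos_divide_less_eq)
    then have "2 ^ n * (2 ^ (Suc k * n) * \<bar>d 0 (2 * 2 ^ k)\<bar>) \<le> 2 ^ n * (2 ^ (Suc k * n) * (q / 2 ^ n * \<bar>d 0 (2 ^ k)\<bar>))"
      by (intro mult_left_mono) auto
    then show "norm (s (Suc k)) \<le> q * norm (s k)"
      by (simp add: s_def abs_mult power_add mult_ac)
  qed
  obtain C where C: "0 < C" "eventually (\<lambda>x. norm (measure \<nu> {x<..}) \<le> C * norm (d 0 x)) at_top"
    using landau_o.bigE[OF tail] by blast
  define c where "c k = 2 ^ (Suc k * n) * measure \<nu> {2 ^ k<..}" for k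
  have "summable c"
  proof (rule summable_comparison_test_ev)
    have "eventually (\<lambda>k. norm (measure \<nu> {2 ^ k<..}) \<le> C * norm (d 0 (2 ^ k))) sequentially"
      using C(2) pow by (auto simp: filterlim_iff)
    then show "eventually (\<lambda>k. norm (c k) \<le> C * s k) sequentially"
    proof eventually_elim
      case (elim k)
      from mult_left_mono[OF elim, of "2 ^ (Suc k * n)"] show ?case
        by (simp add: c_def s_def abs_mult mult_ac)
    qed
    show "summable (\<lambda>k. C * s k)" using \<open>summable s\<close> by (rule summable_mult)
  qed
  show ?thesis
  proof (rule integrableI_bounded)
    have "(\<integral>\<^sup>+y. ennreal (norm (y ^ n)) \<partial>\<nu>) \<le> (\<integral>\<^sup>+y. 1 + (\<Sum>k. ennreal (2 ^ (Suc k * n) * indicator {2 ^ k<..} y)) \<partial>\<nu>)"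
    proof (rule nn_integral_mono_AE)
      show "AE y in \<nu>. ennreal (norm (y ^ n)) \<le> 1 + (\<Sum>k. ennreal (2 ^ (Suc k * n) * indicator {2 ^ k<..} y))"
        using pos by eventually_elim (use nn_power_dyadic in auto)
    qed
    also have "\<dots> = emeasure \<nu> UNIV + (\<Sum>k. \<integral>\<^sup>+y. ennreal (2 ^ (Suc k * n) * indicator {2 ^ k<..} y) \<partial>\<nu>)"
      using sp by (subst nn_integral_add) (auto simp: nn_integral_suminf)
    also have "(\<lambda>k. \<integral>\<^sup>+y. ennreal (2 ^ (Suc k * n) * indicator {2 ^ k<..} y) \<partial>\<nu>) = (\<lambda>k. ennreal (c k))"
    proof
      fix k
      have "(\<integral>\<^sup>+y. ennreal (2 ^ (Suc k * n) * indicator {2 ^ k<..} y) \<partial>\<nu>) =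
          (\<integral>\<^sup>+y. ennreal (2 ^ (Suc k * n)) * indicator {2 ^ k<..} y \<partial>\<nu>)"
        by (intro nn_integral_cong) (auto simp: indicator_def)
      also have "\<dots> = ennreal (2 ^ (Suc k * n)) * emeasure \<nu> {2 ^ k<..}"
        by (rule nn_integral_cmult_indicator) simp
      also have "\<dots> = ennreal (c k)" by (simp add: c_def emeasure_eq_measure ennreal_mult)
      finally show "(\<integral>\<^sup>+y. ennreal (2 ^ (Suc k * n) * indicator {2 ^ k<..} y) \<partial>\<nu>) = ennreal (c k)" .
    qed
    also have "(\<Sum>k. ennreal (c k)) = ennreal (suminf c)"
      by (rule suminf_ennreal2[OF _ \<open>summable c\<close>]) (simp add: c_def)
    also have "emeasure \<nu> UNIV + \<dots> < \<infinity>" by (simp add: emeasure_eq_measure)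
    finally show "(\<integral>\<^sup>+y. ennreal (norm (y ^ n)) \<partial>\<nu>) < \<infinity>" .
  qed measurable
qed

end

section \<open>The ladder height equation\<close>

text \<open>The infimum \<open>\<theta> t\<close> of \<open>w\<close> over \<open>[t, \<infinity>)\<close> satisfies
\<open>\<theta> t \<ge> (1 - q) * \<theta> t + q * \<theta> (t + \<delta>)\<close>, where \<open>q\<close> is the
probability of a step of length at least \<open>\<delta>\<close>. Hence \<open>\<theta>\<close> does not increase
under translation by \<open>\<delta>\<close>, and it tends to \<open>0\<close>.\<close>

lemma max_principle:
  fixes w :: "real \<Rightarrow> real"
  assumes "prob_space \<nu>" and [measurable_cong]: "sets \<nu> = sets borel" and neg: "AE y in \<nu>. y \<le> 0"
    and \<delta>: "0 < \<delta>" "0 < measure \<nu> {..- \<delta>}"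
    and [measurable]: "w \<in> borel_measurable borel"
    and bnd: "\<And>x. x0 \<le> x \<Longrightarrow> \<bar>w x\<bar> \<le> K" and lim: "(w \<longlongrightarrow> 0) at_top"
    and super: "\<And>x. x0 \<le> x \<Longrightarrow> (LINT y|\<nu>. w (x - y)) \<le> w x"
    and x: "x0 \<le> x"
  shows "0 \<le> w x"
proof -
  interpret prob_space \<nu> by fact
  define \<theta> where "\<theta> t = Inf (w ` {t..})" for t
  have lower: "bdd_below (w ` {t..})" if "x0 \<le> t" for t
  proof (rule bdd_belowI2)
    fix y assume "y \<in> {t..}"
    then show "- K \<le> w y" using bnd[of y] that by auto
  qed
  have \<theta>_le: "\<theta> t \<le> w y" if "x0 \<le> t" "t \<le> y" for t y
    unfolding \<theta>_def using lower[OF that(1)] that by (intro cInf_lower) auto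
  have step: "\<theta> (t + \<delta>) \<le> \<theta> t" if t: "x0 \<le> t" for t
  proof -
    define q where "q = measure \<nu> {..- \<delta>}"
    have mono: "\<theta> t \<le> \<theta> y" if "t \<le> y" for y
      unfolding \<theta>_def using that by (intro cInf_superset_mono lower t) auto
    have "q * \<theta> (t + \<delta>) + (1 - q) * \<theta> t \<le> w y" if y: "t \<le> y" for y
    proof -
      have sp: "space \<nu> = UNIV" using sets_eq_imp_space_eq[OF assms(2)] by simp
      define D where "D = \<theta> (t + \<delta>) - \<theta> t"
      have int: "integrable \<nu> (\<lambda>z. D * indicator {..- \<delta>} z)"
        by (intro integrable_mult_right integrable_real_indicator) (auto simp: less_top[symmetric])
      have "q * \<theta> (t + \<delta>) + (1 - q) * \<theta> t = \<theta> t + D * q" by (simp add: D_def algebra_simps)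
      also have "\<dots> = (LINT z|\<nu>. \<theta> t + D * indicator {..- \<delta>} z)"
        using sp by (subst Bochner_Integration.integral_add[OF _ int]) (auto simp: q_def prob_space[unfolded sp])
      also have "\<dots> \<le> (LINT z|\<nu>. w (y - z))"
      proof (rule integral_mono_AE)
        show "integrable \<nu> (\<lambda>z. w (y - z))"
        proof (rule integrable_const_bound[of _ K])
          show "AE z in \<nu>. norm (w (y - z)) \<le> K" using neg by eventually_elim (use t y in \<open>auto intro!: bnd\<close>)
        qed measurable
        show "integrable \<nu> (\<lambda>z. \<theta> t + D * indicator {..- \<delta>} z)" using int by simp
        show "AE z in \<nu>. \<theta> t + D * indicator {..- \<delta>} z \<le> w (y - z)"
          using neg
        proof eventually_elim
          case (elim z)
          show ?case
          proof (cases "z \<le> - \<delta>")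
            case True
            then show ?thesis using \<theta>_le[of "t + \<delta>" "y - z"] t y \<delta> by (auto simp: indicator_def D_def)
          next
            case False
            then show ?thesis using \<theta>_le[of t "y - z"] t y elim by (auto simp: indicator_def)
          qed
        qed
      qed
      also have "\<dots> \<le> w y" using super t y by auto
      finally show ?thesis .
    qed
    then have "q * \<theta> (t + \<delta>) + (1 - q) * \<theta> t \<le> \<theta> t"
      unfolding \<theta>_def[of t] by (intro cInf_greatest) (auto simp: \<theta>_def[of t])
    then have "q * \<theta> (t + \<delta>) \<le> q * \<theta> t" by (simp add: algebra_simps)
    then show ?thesis using \<delta> by (simp add: q_def)
  qed
  have iter: "\<theta> (x0 + real n * \<delta>) \<le> \<theta> x0" for n
  proof (induction n)
    case (Suc n)
    have "\<theta> (x0 + real n * \<delta> + \<delta>) \<le> \<theta> (x0 + real n * \<delta>)" using \<delta> by (intro step) auto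
    then show ?case using Suc by (simp add: algebra_simps)
  qed simp
  have "0 \<le> \<theta> x0"
  proof (rule field_le_epsilon)
    fix e :: real assume "0 < e"
    then have "eventually (\<lambda>y. - e < w y) at_top" using order_tendstoD(1)[OF lim, of "- e"] by simp
    then obtain N where N: "\<And>y. N \<le> y \<Longrightarrow> - e < w y" by (auto simp: eventually_at_top_linorder)
    obtain n where n: "N - x0 < real n * \<delta>" using \<delta> reals_Archimedean3 by blast
    have "- e \<le> \<theta> (x0 + real n * \<delta>)"
      unfolding \<theta>_def using n by (intro cInf_greatest) (auto intro!: less_imp_le N)
    then show "0 \<le> \<theta> x0 + e" using iter[of n] by linarith
  qed
  also have "\<theta> x0 \<le> w x" using x by (intro \<theta>_le) auto
  finally show ?thesis .
qed

context deriv_scale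
begin

text \<open>The hypothesis on \<open>P\<close> says \<open>P * (1 - L) = D\<close> modulo \<open>D ^ (m + 1)\<close>,
so that \<open>act m P\<close> solves the equation for \<open>B\<close> up to \<open>o(d m)\<close>. A multiple
\<open>b\<close> of \<open>d (m - 1)\<close> is a barrier for this residual: by the mean value theorem \<open>b x - b
(x + \<delta>)\<close> is of the order of \<open>d m x\<close>. The maximum principle, applied to \<open>b
\<plusminus> \<Delta>\<close>, bounds the error \<open>\<Delta>\<close> by \<open>b\<close>.\<close>

theorem ladder_expansion:
  fixes B :: "real \<Rightarrow> real"
  assumes \<nu>: "prob_space \<nu>" "sets \<nu> = sets borel" "integrable \<nu> (\<lambda>y::real. y ^ m)"
    and neg: "AE y in \<nu>. y \<le> 0" and \<delta>: "0 < \<delta>" "0 < measure \<nu> {..- \<delta>}"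
    and B [measurable]: "B \<in> borel_measurable borel" and bnd: "\<And>x. \<bar>B x\<bar> \<le> K" and lim: "(B \<longlongrightarrow> 0) at_top"
    and eqn: "eventually (\<lambda>x. B x = d 1 x + (LINT y|\<nu>. B (x - y))) at_top"
    and P: "degree P < m" "\<And>i. i \<le> m \<Longrightarrow> coeff (P * (1 - lchar \<nu> m)) i = (if i = 1 then 1 else 0)"
  shows "(\<lambda>x. B x - act (m - 1) P x) \<in> o(d (m - 1))"
proof -
  interpret prob_space \<nu> by (rule \<nu>(1))
  have [measurable_cong]: "sets \<nu> = sets borel" by (rule \<nu>(2))
  have m1: "Suc (m - 1) = m" using order_pos by simp
  define g where "g = act m P"
  define \<Delta> where "\<Delta> x = B x - g x" for x
  have [measurable]: "g \<in> borel_measurable borel" "\<Delta> \<in> borel_measurable borel"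
    unfolding g_def \<Delta>_def by measurable
  have g_eq: "g x = act (m - 1) P x" for x
    using P(1) sum.atMost_Suc[of "\<lambda>i. coeff P i * d i x" "m - 1"] by (simp add: g_def act_def m1 coeff_eq_0)
  have int_B: "integrable \<nu> (\<lambda>y. B (x - y))" for x
    by (rule integrable_const_bound[of _ K]) (auto intro!: bnd)
  have bnd_g: "\<exists>K. \<forall>x\<ge>x1. \<bar>g x\<bar> \<le> K" if "a < x1" for x1
    unfolding g_def using act_bounded[OF order_refl that] by blast
  have int_g: "integrable \<nu> (\<lambda>y. g (x - y))" if x: "a < x" for x
  proof -
    obtain K' where "\<And>y. x \<le> y \<Longrightarrow> \<bar>g y\<bar> \<le> K'" using bnd_g[OF x] by blast
    then show ?thesis using neg by (intro integrable_const_bound[of _ K']) auto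
  qed
  define r where "r x = \<Delta> x - (LINT y|\<nu>. \<Delta> (x - y))" for x
  have "r \<in> o(d m)"
  proof -
    have conv: "(\<lambda>x. (LINT y|\<nu>. indicator {..x/2} y * act m P (x - y)) - act m (P * lchar \<nu> m) x) \<in> o(d m)"
      using act_convolution[OF finite_measure_axioms \<nu>(2,3)] by simp
    have "eventually (\<lambda>x. (LINT y|\<nu>. indicator {..x/2} y * act m P (x - y)) - act m (P * lchar \<nu> m) x = r x) at_top"
      using eqn eventually_gt_at_top[of a]
    proof eventually_elim
      case (elim x)
      have "(LINT y|\<nu>. indicator {..x/2} y * act m P (x - y)) = (LINT y|\<nu>. g (x - y))"
        using neg elim a_nonneg
        by (intro integral_cong_AE) (auto simp: g_def elim!: eventually_mono)
      moreover have "act m (P * lchar \<nu> m) x = act m P x - act m (P * (1 - lchar \<nu> m)) x"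
        by (simp add: act_diff[symmetric] algebra_simps)
      moreover have "act m (P * (1 - lchar \<nu> m)) x = (\<Sum>i\<le>m. (if i = 1 then 1 else 0) * d i x)"
        unfolding act_def by (intro sum.cong) (auto simp: P(2))
      moreover have "\<dots> = (\<Sum>i\<in>{1}. (if i = 1 then 1 else 0) * d i x)"
        using order_pos by (intro sum.mono_neutral_right) auto
      moreover have "r x = B x - g x - ((LINT y|\<nu>. B (x - y)) - (LINT y|\<nu>. g (x - y)))"
        unfolding r_def \<Delta>_def using int_B int_g elim by (subst Bochner_Integration.integral_diff) auto
      ultimately show ?case using elim by (simp add: g_def)
    qed
    then show ?thesis using conv by (subst (asm) landau_o.small.in_cong) auto
  qed
  have lim_\<Delta>: "(\<Delta> \<longlongrightarrow> 0) at_top"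
    unfolding \<Delta>_def g_def using tendsto_diff[OF lim act_tendsto_0[OF order_refl, of P]] by simp
  have "\<Delta> \<in> o(d (m - 1))"
  proof (rule landau_o.smallI)
    fix c :: real assume c: "0 < c"
    define q where "q = measure \<nu> {..- \<delta>}"
    have "eventually (\<lambda>x. 1 / 2 < d m (x + \<delta>) / d m x) at_top"
      using order_tendstoD(1)[OF shift_ratio[OF order_refl, of \<delta>], of "1/2"] by simp
    moreover have "eventually (\<lambda>x. norm (r x) \<le> (c * q * \<delta> / 2) * norm (d m x)) at_top"
      using landau_o.smallD[OF \<open>r \<in> o(d m)\<close>, of "c * q * \<delta> / 2"] c \<delta> by (simp add: q_def)
    ultimately have "eventually (\<lambda>x. 1 / 2 < d m (x + \<delta>) / d m x \<and>
        norm (r x) \<le> (c * q * \<delta> / 2) * norm (d m x) \<and> a < x) at_top"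
      using eventually_gt_at_top[of a] by eventually_elim simp
    then obtain x0 where x0: "\<And>x. x0 \<le> x \<Longrightarrow> 1 / 2 < d m (x + \<delta>) / d m x"
      "\<And>x. x0 \<le> x \<Longrightarrow> \<bar>r x\<bar> \<le> (c * q * \<delta> / 2) * \<bar>d m x\<bar>" "a < x0"
      by (auto simp: eventually_at_top_linorder)
    obtain Kg where Kg: "\<And>x. x0 \<le> x \<Longrightarrow> \<bar>g x\<bar> \<le> Kg" using bnd_g[OF x0(3)] by blast
    have int_\<Delta>: "integrable \<nu> (\<lambda>y. \<Delta> (x - y))" if "a < x" for x
      unfolding \<Delta>_def by (intro Bochner_Integration.integrable_diff int_B int_g that)
    \<comment> \<open>The residual was required below \<open>c * q * \<delta> / 2\<close> times \<open>d m\<close> so that it fits under the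
      expected decrease of this barrier.\<close>
    define b where "b x = c * \<bar>d (m - 1) x\<bar>" for x
    have [measurable]: "b \<in> borel_measurable borel" unfolding b_def by measurable
    have int_b: "integrable \<nu> (\<lambda>y. b (x - y))" if "a < x" for x
      using neg that order_pos c
      by (intro integrable_const_bound[of _ "b x"]) (auto simp: b_def elim!: eventually_mono intro!: anti)
    have super: "(LINT y|\<nu>. b (x - y)) + \<bar>r x\<bar> \<le> b x" if x: "x0 \<le> x" for x
    proof -
      have ax: "a < x" using x x0(3) by simp
      obtain z where z: "x < z" "z < x + \<delta>" "d (m - 1) (x + \<delta>) - d (m - 1) x = (x + \<delta> - x) * d m z"
        using MVT2[of x "x + \<delta>" "d (m - 1)" "d m"] deriv[of "m - 1"] ax \<delta>(1) order_pos m1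
        by (metis diff_less less_add_same_cancel1 less_le_trans zero_less_one less_le_trans order_less_le_trans)
      have half: "\<bar>d m x\<bar> / 2 \<le> \<bar>d m (x + \<delta>)\<bar>"
        using x0(1)[OF x] ax \<delta>(1) nonzero[OF order_refl ax] by (simp add: ratio_eq less_divide_eq)
      have "\<delta> * (\<bar>d m x\<bar> / 2) \<le> \<delta> * \<bar>d m z\<bar>"
        using half anti[of m z "x + \<delta>"] z ax \<delta> by (intro mult_left_mono) auto
      also have "\<dots> = \<bar>d (m - 1) (x + \<delta>) - d (m - 1) x\<bar>"
        using z(3) \<delta>(1) by (simp add: abs_mult)
      also have "\<dots> = \<bar>d (m - 1) x\<bar> - \<bar>d (m - 1) (x + \<delta>)\<bar>"
        using diff_le[of "m - 1" x "x + \<delta>"] ax \<delta>(1) by (simp add: abs_minus_commute)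
      finally have drop: "c * (\<delta> * (\<bar>d m x\<bar> / 2)) \<le> b x - b (x + \<delta>)"
        using c by (simp add: b_def flip: right_diff_distrib)
      define D where "D = b x - b (x + \<delta>)"
      have int: "integrable \<nu> (\<lambda>z. D * indicator {..- \<delta>} z)"
        by (intro integrable_mult_right integrable_real_indicator) (auto simp: less_top[symmetric])
      have sp: "space \<nu> = UNIV" using sets_eq_imp_space_eq[OF \<nu>(2)] by simp
      have "(LINT y|\<nu>. b (x - y)) \<le> (LINT y|\<nu>. b x - D * indicator {..- \<delta>} y)"
      proof (rule integral_mono_AE[OF int_b[OF ax]])
        show "integrable \<nu> (\<lambda>y. b x - D * indicator {..- \<delta>} y)" using int by simp
        show "AE y in \<nu>. b (x - y) \<le> b x - D * indicator {..- \<delta>} y"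
          using neg
        proof eventually_elim
          case (elim y)
          show ?case
          proof (cases "y \<le> - \<delta>")
            case True
            then show ?thesis using anti[of "m - 1" "x + \<delta>" "x - y"] c ax \<delta>(1) by (simp add: D_def b_def)
          next
            case False
            then show ?thesis using anti[of "m - 1" x "x - y"] c ax elim by (simp add: b_def)
          qed
        qed
      qed
      also have "\<dots> = b x - D * q"
        using sp by (subst Bochner_Integration.integral_diff[OF _ int]) (auto simp: q_def prob_space[unfolded sp])
      finally have "(LINT y|\<nu>. b (x - y)) \<le> b x - D * q" .
      moreover have "\<bar>r x\<bar> \<le> D * q"
        using x0(2)[OF x] mult_right_mono[OF drop, of q] by (simp add: D_def q_def mult_ac)
      ultimately show ?thesis by linarith
    qed
    have lim_b: "(b \<longlongrightarrow> 0) at_top"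
      unfolding b_def using d_smallo_1[of "m - 1"] by (intro tendsto_mult_right_zero tendsto_rabs_zero) auto
    have main: "0 \<le> b x + s * \<Delta> x" if s: "\<bar>s\<bar> = 1" and x: "x0 \<le> x" for s x
    proof (rule max_principle[OF \<nu>(1,2) neg \<delta>, where w = "\<lambda>x. b x + s * \<Delta> x" and ?x0.0 = x0 and K = "b x0 + (K + Kg)"])
      show "\<bar>b y + s * \<Delta> y\<bar> \<le> b x0 + (K + Kg)" if y: "x0 \<le> y" for y
      proof -
        have "\<bar>b y\<bar> \<le> b x0" using anti[of "m - 1" x0 y] y x0(3) c by (simp add: b_def)
        moreover have "\<bar>s * \<Delta> y\<bar> \<le> K + Kg"
          using s bnd[of y] Kg[OF y] by (simp add: abs_mult \<Delta>_def)
        ultimately show ?thesis by linarith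
      qed
      have "((\<lambda>x. b x + s * \<Delta> x) \<longlongrightarrow> 0 + s * 0) at_top" by (intro tendsto_intros lim_b lim_\<Delta>)
      then show "((\<lambda>x. b x + s * \<Delta> x) \<longlongrightarrow> 0) at_top" by simp
      show "(LINT y|\<nu>. b (x - y) + s * \<Delta> (x - y)) \<le> b x + s * \<Delta> x" if x: "x0 \<le> x" for x
      proof -
        have ax: "a < x" using x x0(3) by simp
        have "(LINT y|\<nu>. b (x - y) + s * \<Delta> (x - y)) = (LINT y|\<nu>. b (x - y)) + s * (LINT y|\<nu>. \<Delta> (x - y))"
          using int_b[OF ax] int_\<Delta>[OF ax] by (subst Bochner_Integration.integral_add) auto
        also have "\<dots> = (LINT y|\<nu>. b (x - y)) + s * \<Delta> x - s * r x" by (simp add: r_def algebra_simps)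
        also have "\<dots> \<le> b x + s * \<Delta> x"
          using super[OF x] s abs_le_D2[of "s * r x" "\<bar>r x\<bar>"] by (simp add: abs_mult)
        finally show ?thesis .
      qed
    qed (use x in \<open>auto intro: borel_measurable_add borel_measurable_times\<close>)
    show "eventually (\<lambda>x. norm (\<Delta> x) \<le> c * norm (d (m - 1) x)) at_top"
      using eventually_ge_at_top[of x0]
    proof eventually_elim
      case (elim x)
      then show ?case using main[of 1 x] main[of "-1" x] by (simp add: b_def abs_le_iff)
    qed
  qed
  then show ?thesis by (simp add: \<Delta>_def[abs_def] g_eq)
qed

end

section \<open>Compound geometric laws\<close>

text \<open>The inverse is a partial sum of the geometric series.\<close>

lemma inverse_mod_monom:
  fixes A :: "real poly"
  assumes "coeff A 0 \<noteq> 0"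
  shows "\<exists>B. degree B \<le> n \<and> monom 1 (Suc n) dvd A * B - 1"
proof -
  define c where "c = coeff A 0"
  have c: "c \<noteq> 0" using assms by (simp add: c_def)
  define R where "R = 1 - smult (1 / c) A"
  have "coeff R 0 = 0" using c by (simp add: R_def c_def)
  then have "monom 1 1 dvd R" by (simp add: monom_1_dvd_iff')
  then have "monom 1 1 ^ Suc n dvd R ^ Suc n" by (rule dvd_power_same)
  then have R: "monom 1 (Suc n) dvd R ^ Suc n" by (simp only: monom_power power_one mult_1)
  define B where "B = smult (1 / c) (\<Sum>i<Suc n. R ^ i)"
  have A: "A = smult c (1 - R)" using c by (simp add: R_def)
  have "A * B = (1 - R) * (\<Sum>i<Suc n. R ^ i)" using c by (simp add: A B_def)
  also have "\<dots> = 1 - R ^ Suc n" by (rule one_diff_power_eq[symmetric])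
  finally have AB: "monom 1 (Suc n) dvd A * B - 1" using R by simp
  define M :: "real poly" where "M = monom 1 (Suc n)"
  define D where "D = B div M"
  have "B mod M = B - M * D" by (simp add: D_def minus_mult_div_eq_mod)
  moreover have "A * (B - M * D) - 1 = A * B - 1 - M * (A * D)" by (simp add: algebra_simps)
  ultimately have "A * (B mod M) - 1 = A * B - 1 - M * (A * D)" by (simp only:)
  then have "M dvd A * (B mod M) - 1"
    using AB[folded M_def] by (simp only: dvd_diff dvd_triv_left)
  moreover have "degree (B mod M) \<le> n" using mod_monom_in[of B n] by (simp add: M_def)
  ultimately show ?thesis unfolding M_def by blast
qed

lemma cancel_mod_monom:
  fixes A :: "real poly"
  assumes "coeff A 0 \<noteq> 0" "monom 1 (Suc n) dvd A * R"
  shows "monom 1 (Suc n) dvd R"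
proof -
  obtain B where B: "monom 1 (Suc n) dvd A * B - 1" using inverse_mod_monom[OF assms(1)] by blast
  have "R = B * (A * R) - (A * B - 1) * R" by (simp add: algebra_simps)
  then show ?thesis using assms(2) B by (metis dvd_diff dvd_mult dvd_mult2)
qed

context deriv_scale
begin

text \<open>Convolution with \<open>\<nu>\<close> multiplies \<open>d n\<close> asymptotically by the mass of
\<open>\<nu>\<close>, hence by at most some \<open>q < 1\<close>. If \<open>h \<le> A * d n\<close> on \<open>[x / 2,
x]\<close>, then \<open>h x \<le> (A * q + C) * d n x\<close>; the iteration \<open>A \<mapsto> A * q + C\<close>
contracts to \<open>C / (1 - q)\<close>. That some \<open>A\<close> exists follows from the same inequality for the
supremum of \<open>h / d n\<close> over a compact interval.\<close>

lemma renewal_inequality: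
  assumes \<nu>: "finite_measure \<nu>" "sets \<nu> = sets borel" and mass: "measure \<nu> UNIV < 1" and pos: "AE y in \<nu>. 0 \<le> y"
    and n: "n \<le> m" and h [measurable]: "h \<in> borel_measurable borel"
    and bnd: "\<And>x. x1 \<le> x \<Longrightarrow> 0 \<le> h x \<and> h x \<le> K"
    and C: "0 \<le> C" "eventually (\<lambda>x. h x \<le> (LINT y|\<nu>. indicator {..x/2} y * h (x - y)) + C * \<bar>d n x\<bar>) at_top"
    and \<eta>: "0 < \<eta>"
  shows "eventually (\<lambda>x. h x \<le> (2 * C / (1 - measure \<nu> UNIV) + \<eta>) * \<bar>d n x\<bar>) at_top"
proof -
  interpret finite_measure \<nu> by (rule \<nu>(1))
  have [measurable_cong]: "sets \<nu> = sets borel" by (rule \<nu>(2))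
  have sp: "space \<nu> = UNIV" using sets_eq_imp_space_eq[OF \<nu>(2)] by simp
  define q where "q = (1 + measure \<nu> UNIV) / 2"
  have q: "0 < q" "q < 1" "measure \<nu> UNIV < q" 
    using mass measure_nonneg[of \<nu> UNIV] by (auto simp: q_def simp del: measure_nonneg)
  have q': "0 < q - measure \<nu> UNIV" using q by simp
  have Cq: "2 * C / (1 - measure \<nu> UNIV) = C / (1 - q)"
    using q by (simp add: q_def field_simps)
  define D where "D x = (-1) ^ Suc n * d n x" for x
  have D_abs: "D x = \<bar>d n x\<bar>" if "a < x" for x
    using sign[OF n that] unfolding D_def by (cases "even n") auto
  have D_pos: "0 < D x" if "a < x" for x using sign[OF n that] by (simp add: D_def)
  have [measurable]: "D \<in> borel_measurable borel" unfolding D_def by measurable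
  have T: "(\<lambda>x. (LINT y|\<nu>. indicator {..x/2} y * d n (x - y)) - measure \<nu> UNIV * d n x) \<in> o(d n)"
    "eventually (\<lambda>x. integrable \<nu> (\<lambda>y. indicator {..x/2} y * d n (x - y))) at_top"
    using taylor_integral[OF \<nu>, of 0 n] n sp by auto
  have ev1: "eventually (\<lambda>x. (LINT y|\<nu>. indicator {..x/2} y * D (x - y)) \<le> q * D x \<and>
      integrable \<nu> (\<lambda>y. indicator {..x/2} y * D (x - y))) at_top"
    using landau_o.smallD[OF T(1) q'] T(2) eventually_gt_at_top[of a]
  proof eventually_elim
    case (elim x)
    have 1: "(\<lambda>y. indicator {..x/2} y * D (x - y)) = (\<lambda>y. (-1) ^ Suc n * (indicator {..x/2} y * d n (x - y)))"
      by (auto simp: D_def)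
    define I where "I = (LINT y|\<nu>. indicator {..x/2} y * d n (x - y))"
    have 2: "(LINT y|\<nu>. indicator {..x/2} y * D (x - y)) = (-1) ^ Suc n * I"
      unfolding 1 I_def by (rule integral_mult_right_zero)
    have "\<bar>(-1) ^ Suc n * (I - measure \<nu> UNIV * d n x)\<bar> \<le> (q - measure \<nu> UNIV) * D x"
      using elim D_abs[of x] by (simp add: I_def abs_mult)
    then have "(-1) ^ Suc n * (I - measure \<nu> UNIV * d n x) \<le> (q - measure \<nu> UNIV) * D x" by linarith
    then have "(-1) ^ Suc n * I \<le> q * D x"
      by (simp add: D_def algebra_simps)
    then show ?case using elim unfolding 1 2[unfolded 1] by (auto intro!: integrable_mult_right)
  qed
  have "eventually (\<lambda>x. ((LINT y|\<nu>. indicator {..x/2} y * D (x - y)) \<le> q * D x \<and>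
      integrable \<nu> (\<lambda>y. indicator {..x/2} y * D (x - y))) \<and>
      h x \<le> (LINT y|\<nu>. indicator {..x/2} y * h (x - y)) + C * \<bar>d n x\<bar> \<and>
      2 * a < x \<and> 2 * x1 < x \<and> 0 < x \<and> x1 < x) at_top"
    by (intro eventually_conj[OF ev1] eventually_conj[OF C(2)] eventually_conj eventually_gt_at_top)
  then obtain x0 where "\<forall>x\<ge>x0. ((LINT y|\<nu>. indicator {..x/2} y * D (x - y)) \<le> q * D x \<and>
      integrable \<nu> (\<lambda>y. indicator {..x/2} y * D (x - y))) \<and>
      h x \<le> (LINT y|\<nu>. indicator {..x/2} y * h (x - y)) + C * \<bar>d n x\<bar> \<and>
      2 * a < x \<and> 2 * x1 < x \<and> 0 < x \<and> x1 < x"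
    unfolding eventually_at_top_linorder by blast
  then have x0: "\<And>x. x0 \<le> x \<Longrightarrow> (LINT y|\<nu>. indicator {..x/2} y * D (x - y)) \<le> q * D x"
    "\<And>x. x0 \<le> x \<Longrightarrow> integrable \<nu> (\<lambda>y. indicator {..x/2} y * D (x - y))"
    "\<And>x. x0 \<le> x \<Longrightarrow> h x \<le> (LINT y|\<nu>. indicator {..x/2} y * h (x - y)) + C * \<bar>d n x\<bar>"
    "2 * a < x0" "2 * x1 < x0" "0 < x0" "x1 < x0"
    by auto
  have ax: "a < x" if "x0 \<le> x" for x using x0(4,6) that a_nonneg by linarith
  have step: "h x \<le> (A * q + C) * D x"
    if x: "x0 \<le> x" and A: "0 \<le> A" "\<And>z. x / 2 \<le> z \<Longrightarrow> z \<le> x \<Longrightarrow> h z \<le> A * D z" for x A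
  proof -
    have "(LINT y|\<nu>. indicator {..x/2} y * h (x - y)) \<le> (LINT y|\<nu>. A * (indicator {..x/2} y * D (x - y)))"
    proof (rule integral_mono_AE)
      show "integrable \<nu> (\<lambda>y. indicator {..x/2} y * h (x - y))"
      proof (rule integrable_const_bound[of _ "K"])
        have *: "0 \<le> h z \<and> h z \<le> K" if "x / 2 \<le> z" for z using bnd[of z] that x x0(5) by auto
        have K0: "0 \<le> K" using *[of "x / 2"] by auto
        show "AE y in \<nu>. norm (indicator {..x / 2} y * h (x - y)) \<le> K"
          using * K0 by (intro AE_I2) (auto simp: indicator_def)
      qed measurable
      show "integrable \<nu> (\<lambda>y. A * (indicator {..x/2} y * D (x - y)))"
        by (intro integrable_mult_right x0(2) x)
      show "AE y in \<nu>. indicator {..x/2} y * h (x - y) \<le> A * (indicator {..x/2} y * D (x - y))"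
        using pos by eventually_elim (auto simp: indicator_def intro!: A(2))
    qed
    also have "\<dots> = A * (LINT y|\<nu>. indicator {..x/2} y * D (x - y))" by (rule integral_mult_right_zero)
    also have "\<dots> \<le> A * (q * D x)" using A x by (intro mult_left_mono x0(1))
    finally show ?thesis using x0(3)[OF x] D_abs[OF ax[OF x]] by (simp add: algebra_simps)
  qed
  have K0: "0 \<le> K" using bnd[of x1] by auto
  define B where "B = K / D (2 * x0) + C / (1 - q)"
  have D2: "0 < D (2 * x0)" using x0(6) by (intro D_pos ax) auto
  have B0: "0 \<le> B" using K0 D2 C q by (simp add: B_def)
  have bounded: "h x \<le> B * D x" if x: "x0 \<le> x" for x
  proof -
    \<comment> \<open>The supremum over a compact interval is finite as \<open>h\<close> is bounded; on \<open>[x0, 2 * x0]\<close>, where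
      the inequality cannot be iterated, the bound \<open>K\<close> is used.\<close>
    define X where "X = max x (2 * x0)"
    have X: "x \<le> X" "2 * x0 \<le> X" "x0 \<le> X" using x0(6) by (auto simp: X_def)
    define A where "A = Sup ((\<lambda>z. h z / D z) ` {x0..X})"
    have bdd: "bdd_above ((\<lambda>z. h z / D z) ` {x0..X})"
    proof (rule bdd_aboveI2)
      fix z assume z: "z \<in> {x0..X}"
      have "D X \<le> D z" using anti[OF n, of z X] D_abs[of X] D_abs[of z] ax[of z] ax[of X] z X by auto
      then show "h z / D z \<le> K / D X"
        using bnd[of z] z x0(7) ax[of z] ax[of X] X K0 by (intro frac_le D_pos) auto
    qed
    have le_A: "h z \<le> A * D z" if "x0 \<le> z" "z \<le> X" for z
    proof -
      have "h z / D z \<le> A" unfolding A_def using that by (intro cSup_upper bdd) auto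
      then show ?thesis using D_pos[OF ax[OF that(1)]] by (simp add: field_simps)
    qed
    have A0: "0 \<le> A"
    proof -
      have "0 \<le> h x0 / D x0" using bnd[of x0] x0(7) D_pos[OF ax, of x0] by auto
      also have "\<dots> \<le> A" unfolding A_def using X by (intro cSup_upper bdd) auto
      finally show ?thesis .
    qed
    have "A \<le> max (K / D (2 * x0)) (A * q + C)"
    proof (subst A_def, rule cSup_least)
      fix w assume "w \<in> (\<lambda>z. h z / D z) ` {x0..X}"
      then obtain z where z: "x0 \<le> z" "z \<le> X" "w = h z / D z" by auto
      show "w \<le> max (K / D (2 * x0)) (A * q + C)"
      proof (cases "z \<le> 2 * x0")
        case True
        have "D (2 * x0) \<le> D z"
          using anti[OF n ax[OF z(1)] True] D_abs[of "2 * x0"] D_abs[of z] ax[of z] ax[of "2 * x0"] z x0(6) by auto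
        then have "h z / D z \<le> K / D (2 * x0)"
          using bnd[of z] z x0(7) D2 K0 by (intro frac_le) auto
        then show ?thesis using z by simp
      next
        case False
        have "h z \<le> (A * q + C) * D z"
          using False z by (intro step A0 le_A) auto
        then have "h z / D z \<le> A * q + C" using D_pos[OF ax[OF z(1)]] by (simp add: pos_divide_le_eq)
        then show ?thesis using z by simp
      qed
    qed (use X in auto)
    then have "A \<le> B"
    proof (cases "A \<le> K / D (2 * x0)")
      case True
      then show ?thesis using C q by (simp add: B_def add_increasing2)
    next
      case False
      then have "A \<le> A * q + C" using \<open>A \<le> max _ _\<close> by simp
      then have "A \<le> C / (1 - q)" using q by (simp add: field_simps)
      then show ?thesis using K0 D2 by (simp add: B_def add_increasing)
    qed
    have "h x \<le> A * D x" by (rule le_A[OF x X(1)])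
    also have "\<dots> \<le> B * D x" using \<open>A \<le> B\<close> D_pos[OF ax[OF x]] by (intro mult_right_mono) auto
    finally show ?thesis .
  qed
  \<comment> \<open>Doubling the argument contracts the excess over the fixed point \<open>C / (1 - q)\<close>.\<close>
  have contract: "h x \<le> (C / (1 - q) + q ^ k * B) * D x" if "2 ^ k * x0 \<le> x" for k x
    using that
  proof (induction k arbitrary: x)
    case 0
    have "B * D x \<le> (C / (1 - q) + B) * D x"
      using 0 C q D_pos[OF ax, of x] by (intro mult_right_mono) auto
    then show ?case using bounded[of x] 0 by simp
  next
    case (Suc k)
    have "x0 \<le> 2 ^ Suc k * x0" using x0(6) one_le_power[of "2::real" "Suc k"] by simp
    then have x: "x0 \<le> x" using Suc.prems by linarith
    have "h x \<le> ((C / (1 - q) + q ^ k * B) * q + C) * D x"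
      using Suc.prems C q B0 by (intro step x Suc.IH) auto
    also have "(C / (1 - q) + q ^ k * B) * q + C = C / (1 - q) + q ^ Suc k * B"
      using q by (simp add: field_simps)
    finally show ?case .
  qed
  have "(\<lambda>k. q ^ k * B) \<longlonglongrightarrow> 0 * B" using q by (intro tendsto_intros LIMSEQ_realpow_zero) auto
  from order_tendstoD(2)[OF this, of \<eta>] obtain k where k: "q ^ k * B < \<eta>"
    using \<eta> by (auto simp: eventually_sequentially)
  show ?thesis
    using eventually_ge_at_top[of "2 ^ k * x0"] eventually_ge_at_top[of x0]
  proof eventually_elim
    case (elim x)
    have "h x \<le> (C / (1 - q) + q ^ k * B) * D x" by (rule contract[OF elim(1)])
    also have "\<dots> \<le> (C / (1 - q) + \<eta>) * D x"
      using k D_pos[OF ax[OF elim(2)]] by (intro mult_right_mono) auto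
    finally show ?case using D_abs[OF ax[OF elim(2)]] by (simp add: Cq)
  qed
qed

lemma renewal_bigo:
  assumes \<nu>: "finite_measure \<nu>" "sets \<nu> = sets borel" and mass: "measure \<nu> UNIV < 1" and pos: "AE y in \<nu>. 0 \<le> y"
    and n: "n \<le> m" and h: "h \<in> borel_measurable borel" "\<And>x. x1 \<le> x \<Longrightarrow> 0 \<le> h x \<and> h x \<le> K"
    and e: "e \<in> O(d n)" "eventually (\<lambda>x. h x \<le> (LINT y|\<nu>. indicator {..x/2} y * h (x - y)) + e x) at_top"
  shows "h \<in> O(d n)"
proof -
  obtain C where C: "0 < C" "eventually (\<lambda>x. norm (e x) \<le> C * norm (d n x)) at_top"
    using landau_o.bigE[OF e(1)] by blast
  have "eventually (\<lambda>x. h x \<le> (LINT y|\<nu>. indicator {..x/2} y * h (x - y)) + C * \<bar>d n x\<bar>) at_top"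
    using e(2) C(2) by eventually_elim auto
  from renewal_inequality[OF \<nu> mass pos n h _ this zero_less_one] C
  have "eventually (\<lambda>x. h x \<le> (2 * C / (1 - measure \<nu> UNIV) + 1) * \<bar>d n x\<bar>) at_top" by simp
  then have "eventually (\<lambda>x. norm (h x) \<le> (2 * C / (1 - measure \<nu> UNIV) + 1) * norm (d n x)) at_top"
    using eventually_ge_at_top[of x1] by eventually_elim (use h(2) in auto)
  then show ?thesis by (rule bigoI)
qed

lemma renewal_smallo:
  assumes \<nu>: "finite_measure \<nu>" "sets \<nu> = sets borel" and mass: "measure \<nu> UNIV < 1" and pos: "AE y in \<nu>. 0 \<le> y"
    and n: "n \<le> m" and h: "h \<in> borel_measurable borel" "\<And>x. x1 \<le> x \<Longrightarrow> 0 \<le> h x \<and> h x \<le> K"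
    and e: "e \<in> o(d n)" "eventually (\<lambda>x. h x \<le> (LINT y|\<nu>. indicator {..x/2} y * h (x - y)) + e x) at_top"
  shows "h \<in> o(d n)"
proof (rule landau_o.smallI)
  fix c :: real assume c: "0 < c"
  define C where "C = c * (1 - measure \<nu> UNIV) / 4"
  have C: "0 < C" using c mass by (simp add: C_def)
  have "eventually (\<lambda>x. norm (e x) \<le> C * norm (d n x)) at_top"
    by (rule landau_o.smallD[OF e(1) C])
  with e(2) have "eventually (\<lambda>x. h x \<le> (LINT y|\<nu>. indicator {..x/2} y * h (x - y)) + C * \<bar>d n x\<bar>) at_top"
    by eventually_elim auto
  from renewal_inequality[OF \<nu> mass pos n h less_imp_le[OF C] this, where \<eta> = "c / 2"] C c
  have "eventually (\<lambda>x. h x \<le> (2 * C / (1 - measure \<nu> UNIV) + c / 2) * \<bar>d n x\<bar>) at_top" by simp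
  moreover have "2 * C / (1 - measure \<nu> UNIV) + c / 2 = c" using mass by (simp add: C_def field_simps)
  ultimately have "eventually (\<lambda>x. h x \<le> c * \<bar>d n x\<bar>) at_top" by simp
  then show "eventually (\<lambda>x. norm (h x) \<le> c * norm (d n x)) at_top"
    using eventually_ge_at_top[of x1] by eventually_elim (use h(2) in auto)
qed

end

text \<open>The fixed point equation \<open>V = (1 - p) \<delta>\<^sub>0 + \<nu> * V\<close>, tested against
nonnegative functions. It characterizes the law \<open>V\<close> of a geometric number of independent summands,
\<open>\<nu>\<close> being defective of mass \<open>p\<close>.\<close>

locale compound_geometric =
  fixes \<nu> V :: "real measure"
  assumes \<nu>: "finite_measure \<nu>" "sets \<nu> = sets borel" and mass: "measure \<nu> UNIV < 1"
    and \<nu>_nonneg: "AE y in \<nu>. 0 \<le> y"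
    and V: "prob_space V" "sets V = sets borel" and V_nonneg: "AE z in V. 0 \<le> z"
    and compound: "\<And>f :: real \<Rightarrow> ennreal. f \<in> borel_measurable borel \<Longrightarrow>
      (\<integral>\<^sup>+z. f z \<partial>V) = ennreal (1 - measure \<nu> UNIV) * f 0 + (\<integral>\<^sup>+y. \<integral>\<^sup>+z. f (y + z) \<partial>V \<partial>\<nu>)"
begin

sublocale \<nu>: finite_measure \<nu> by (rule \<nu>(1))
sublocale V: prob_space V by (rule V(1))

declare \<nu>(2) [measurable_cong] V(2) [measurable_cong]

lemma space_simps [simp]: "space \<nu> = UNIV" "space V = UNIV"
  using sets_eq_imp_space_eq[OF \<nu>(2)] sets_eq_imp_space_eq[OF V(2)] by simp_all

lemma tail_measurable [measurable]:
  "(\<lambda>x. measure \<nu> {x<..}) \<in> borel_measurable borel" "(\<lambda>x. measure V {x<..}) \<in> borel_measurable borel"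
  using borel_measurable_tail[OF \<nu>] borel_measurable_tail[OF V.finite_measure_axioms V(2)] by simp_all

text \<open>Two summands with a sum above \<open>x\<close> cannot both be at most \<open>x / 2\<close>.\<close>

lemma tail_split:
  assumes x: "0 \<le> x"
  shows "measure V {x<..} = (LINT y|\<nu>. indicator {..x/2} y * measure V {x - y<..}) +
    ((LINT z|V. indicator {..x/2} z * measure \<nu> {x - z<..}) + measure \<nu> {x/2<..} * measure V {x/2<..})"
proof -
  interpret P: pair_sigma_finite \<nu> V ..
  have le1: "measure \<nu> A \<le> 1" for A using \<nu>.bounded_measure[of A] mass by simp
  have sum: "indicator {x<..} (y + z) = (indicator {..x/2} y * indicator {x<..} (y + z) +
      (indicator {..x/2} z * indicator {x<..} (y + z) + indicator {x/2<..} y * indicator {x/2<..} z) :: ennreal)" for y z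
    by (auto simp: indicator_def)
  have em: "emeasure V A = ennreal (measure V A)" "emeasure \<nu> A = ennreal (measure \<nu> A)" for A
    by (simp_all add: V.emeasure_eq_measure \<nu>.emeasure_eq_measure)
  have 1: "(\<integral>\<^sup>+y. \<integral>\<^sup>+z. indicator {..x/2} y * indicator {x<..} (y + z) \<partial>V \<partial>\<nu>) =
      ennreal (LINT y|\<nu>. indicator {..x/2} y * measure V {x - y<..})"
  proof -
    have "(\<integral>\<^sup>+y. \<integral>\<^sup>+z. indicator {..x/2} y * indicator {x<..} (y + z) \<partial>V \<partial>\<nu>) =
        (\<integral>\<^sup>+y. \<integral>\<^sup>+z. indicator {..x/2} y * indicator {x - y<..} z \<partial>V \<partial>\<nu>)"
      by (intro nn_integral_cong) (auto simp: indicator_def)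
    also have "\<dots> = (\<integral>\<^sup>+y. ennreal (indicator {..x/2} y * measure V {x - y<..}) \<partial>\<nu>)"
      by (intro nn_integral_cong) (auto simp: em nn_integral_cmult indicator_def[of "{..x/2}"])
    also have "\<dots> = ennreal (LINT y|\<nu>. indicator {..x/2} y * measure V {x - y<..})"
      by (intro nn_integral_eq_integral \<nu>.integrable_const_bound[of _ 1]) (auto simp: indicator_def)
    finally show ?thesis .
  qed
  have 2: "(\<integral>\<^sup>+y. \<integral>\<^sup>+z. indicator {..x/2} z * indicator {x<..} (y + z) \<partial>V \<partial>\<nu>) =
      ennreal (LINT z|V. indicator {..x/2} z * measure \<nu> {x - z<..})"
  proof -
    have "(\<integral>\<^sup>+y. \<integral>\<^sup>+z. indicator {..x/2} z * indicator {x<..} (y + z) \<partial>V \<partial>\<nu>) =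
        (\<integral>\<^sup>+z. \<integral>\<^sup>+y. indicator {..x/2} z * indicator {x<..} (y + z) \<partial>\<nu> \<partial>V)"
      by (rule P.Fubini'[symmetric]) measurable
    also have "\<dots> = (\<integral>\<^sup>+z. \<integral>\<^sup>+y. indicator {..x/2} z * indicator {x - z<..} y \<partial>\<nu> \<partial>V)"
      by (intro nn_integral_cong) (auto simp: indicator_def)
    also have "\<dots> = (\<integral>\<^sup>+z. ennreal (indicator {..x/2} z * measure \<nu> {x - z<..}) \<partial>V)"
      by (intro nn_integral_cong) (auto simp: em nn_integral_cmult indicator_def[of "{..x/2}"])
    also have "\<dots> = ennreal (LINT z|V. indicator {..x/2} z * measure \<nu> {x - z<..})"
      using le1 by (intro nn_integral_eq_integral V.integrable_const_bound[of _ 1]) (auto simp: indicator_def)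
    finally show ?thesis .
  qed
  have 3: "(\<integral>\<^sup>+y. \<integral>\<^sup>+z. indicator {x/2<..} y * indicator {x/2<..} z \<partial>V \<partial>\<nu>) =
      ennreal (measure \<nu> {x/2<..} * measure V {x/2<..})"
    by (simp add: nn_integral_cmult nn_integral_multc em ennreal_mult)
  have "ennreal (measure V {x<..}) = (\<integral>\<^sup>+z. indicator {x<..} z \<partial>V)" by (simp add: em)
  also have "\<dots> = (\<integral>\<^sup>+y. \<integral>\<^sup>+z. indicator {x<..} (y + z) \<partial>V \<partial>\<nu>)"
    using x by (subst compound) (auto simp: indicator_def)
  also have "\<dots> = (\<integral>\<^sup>+y. (\<integral>\<^sup>+z. indicator {..x/2} y * indicator {x<..} (y + z) \<partial>V) +
      ((\<integral>\<^sup>+z. indicator {..x/2} z * indicator {x<..} (y + z) \<partial>V) +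
       (\<integral>\<^sup>+z. indicator {x/2<..} y * indicator {x/2<..} z \<partial>V)) \<partial>\<nu>)"
  proof (rule nn_integral_cong)
    fix y
    have "(\<integral>\<^sup>+z. indicator {x<..} (y + z) \<partial>V) = (\<integral>\<^sup>+z. indicator {..x/2} y * indicator {x<..} (y + z) +
        (indicator {..x/2} z * indicator {x<..} (y + z) + indicator {x/2<..} y * indicator {x/2<..} z) \<partial>V)"
      by (rule nn_integral_cong) (rule sum)
    then show "(\<integral>\<^sup>+z. indicator {x<..} (y + z) \<partial>V) = (\<integral>\<^sup>+z. indicator {..x/2} y * indicator {x<..} (y + z) \<partial>V) +
      ((\<integral>\<^sup>+z. indicator {..x/2} z * indicator {x<..} (y + z) \<partial>V) +
       (\<integral>\<^sup>+z. indicator {x/2<..} y * indicator {x/2<..} z \<partial>V))"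
      by (simp add: nn_integral_add)
  qed
  also have "\<dots> = (\<integral>\<^sup>+y. \<integral>\<^sup>+z. indicator {..x/2} y * indicator {x<..} (y + z) \<partial>V \<partial>\<nu>) +
      ((\<integral>\<^sup>+y. \<integral>\<^sup>+z. indicator {..x/2} z * indicator {x<..} (y + z) \<partial>V \<partial>\<nu>) +
       (\<integral>\<^sup>+y. \<integral>\<^sup>+z. indicator {x/2<..} y * indicator {x/2<..} z \<partial>V \<partial>\<nu>))"
    by (subst nn_integral_add, measurable, subst nn_integral_add, measurable)
  also have "\<dots> = ennreal ((LINT y|\<nu>. indicator {..x/2} y * measure V {x - y<..}) +
    ((LINT z|V. indicator {..x/2} z * measure \<nu> {x - z<..}) + measure \<nu> {x/2<..} * measure V {x/2<..}))"
    unfolding 1 2 3 by (simp add: integral_nonneg_AE flip: ennreal_plus)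
  finally show ?thesis
    by (subst (asm) ennreal_inj) (auto intro!: add_nonneg_nonneg integral_nonneg_AE)
qed

text \<open>The binomial theorem, integrated.\<close>

lemma moment_recursion:
  assumes \<nu>N: "integrable \<nu> (\<lambda>y. y ^ N)" and VN: "integrable V (\<lambda>z. z ^ N)" and k: "k \<le> N"
  shows "(LINT z|V. z ^ k) = (1 - measure \<nu> UNIV) * 0 ^ k +
    (\<Sum>i\<le>k. real (k choose i) * (LINT y|\<nu>. y ^ i) * (LINT z|V. z ^ (k - i)))"
proof -
  have I\<nu>: "integrable \<nu> (\<lambda>y. y ^ i)" if "i \<le> k" for i
    using integrable_power_le[OF \<nu> \<nu>N] that k by simp
  have IV: "integrable V (\<lambda>y. y ^ i)" if "i \<le> k" for i
    using integrable_power_le[OF V.finite_measure_axioms V(2) VN] that k by simp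
  have inner: "(\<integral>\<^sup>+z. ennreal ((y + z) ^ k) \<partial>V) =
      ennreal (\<Sum>i\<le>k. real (k choose i) * y ^ i * (LINT z|V. z ^ (k - i)))" if y: "0 \<le> y" for y
  proof -
    have "integrable V (\<lambda>z. (y + z) ^ k)"
      unfolding binomial_ring by (intro Bochner_Integration.integrable_sum integrable_mult_right IV) auto
    then have "(\<integral>\<^sup>+z. ennreal ((y + z) ^ k) \<partial>V) = ennreal (LINT z|V. (y + z) ^ k)"
      by (rule nn_integral_eq_integral) (use V_nonneg y in \<open>auto elim!: eventually_mono\<close>)
    also have "(LINT z|V. (y + z) ^ k) = (\<Sum>i\<le>k. real (k choose i) * y ^ i * (LINT z|V. z ^ (k - i)))"
      unfolding binomial_ring by (subst Bochner_Integration.integral_sum) (auto intro!: integrable_mult_right IV)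
    finally show ?thesis .
  qed
  have IV0: "0 \<le> (LINT z|V. z ^ i)" for i
    by (rule integral_nonneg_AE) (use V_nonneg in \<open>auto elim!: eventually_mono\<close>)
  have I\<nu>0: "0 \<le> (LINT z|\<nu>. z ^ i)" for i
    by (rule integral_nonneg_AE) (use \<nu>_nonneg in \<open>auto elim!: eventually_mono\<close>)
  have "ennreal (LINT z|V. z ^ k) = (\<integral>\<^sup>+z. ennreal (z ^ k) \<partial>V)"
    by (rule nn_integral_eq_integral[symmetric, OF IV]) (use V_nonneg in \<open>auto elim!: eventually_mono\<close>)
  also have "\<dots> = ennreal (1 - measure \<nu> UNIV) * ennreal (0 ^ k) + (\<integral>\<^sup>+y. \<integral>\<^sup>+z. ennreal ((y + z) ^ k) \<partial>V \<partial>\<nu>)"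
    by (rule compound) measurable
  also have "(\<integral>\<^sup>+y. \<integral>\<^sup>+z. ennreal ((y + z) ^ k) \<partial>V \<partial>\<nu>) =
      (\<integral>\<^sup>+y. ennreal (\<Sum>i\<le>k. real (k choose i) * y ^ i * (LINT z|V. z ^ (k - i))) \<partial>\<nu>)"
    using \<nu>_nonneg by (intro nn_integral_cong_AE) (auto elim!: eventually_mono simp: inner)
  also have "\<dots> = ennreal (LINT y|\<nu>. (\<Sum>i\<le>k. real (k choose i) * y ^ i * (LINT z|V. z ^ (k - i))))"
  proof (rule nn_integral_eq_integral)
    show "integrable \<nu> (\<lambda>y. \<Sum>i\<le>k. real (k choose i) * y ^ i * (LINT z|V. z ^ (k - i)))"
      by (intro Bochner_Integration.integrable_sum integrable_mult_left integrable_mult_right I\<nu>) auto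
    show "AE y in \<nu>. 0 \<le> (\<Sum>i\<le>k. real (k choose i) * y ^ i * (LINT z|V. z ^ (k - i)))"
      using \<nu>_nonneg by eventually_elim (auto intro!: sum_nonneg mult_nonneg_nonneg IV0)
  qed
  also have "(LINT y|\<nu>. (\<Sum>i\<le>k. real (k choose i) * y ^ i * (LINT z|V. z ^ (k - i)))) =
      (\<Sum>i\<le>k. real (k choose i) * (LINT y|\<nu>. y ^ i) * (LINT z|V. z ^ (k - i)))"
    by (subst Bochner_Integration.integral_sum) (auto intro!: integrable_mult_left integrable_mult_right I\<nu>)
  also have "ennreal (1 - measure \<nu> UNIV) * ennreal (0 ^ k) + ennreal \<dots> =
      ennreal ((1 - measure \<nu> UNIV) * 0 ^ k + (\<Sum>i\<le>k. real (k choose i) * (LINT y|\<nu>. y ^ i) * (LINT z|V. z ^ (k - i))))"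
    using mass by (subst ennreal_plus) (auto simp: ennreal_mult intro!: sum_nonneg mult_nonneg_nonneg I\<nu>0 IV0)
  finally show ?thesis
    using mass by (subst (asm) ennreal_inj) (auto intro!: add_nonneg_nonneg sum_nonneg mult_nonneg_nonneg I\<nu>0 IV0)
qed

text \<open>The fixed point equation in terms of characters, \<open>(1 - L\<^sub>\<nu>) L\<^sub>V = 1 -
p\<close>.\<close>

lemma lchar_compound:
  assumes \<nu>N: "integrable \<nu> (\<lambda>y. y ^ N)" and VN: "integrable V (\<lambda>z. z ^ N)" and k: "k \<le> N"
  shows "coeff ((1 - lchar \<nu> N) * lchar V N) k = coeff [:1 - measure \<nu> UNIV:] k"
proof -
  have "coeff (lchar \<nu> N * lchar V N) k = (\<Sum>i\<le>k. ((-1) ^ i / fact i * (LINT y|\<nu>. y ^ i)) *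
      ((-1) ^ (k - i) / fact (k - i) * (LINT z|V. z ^ (k - i))))"
    unfolding coeff_mult using k by (intro sum.cong) (auto simp: coeff_lchar)
  also have "\<dots> = (\<Sum>i\<le>k. (-1) ^ k / fact k * (real (k choose i) * (LINT y|\<nu>. y ^ i) * (LINT z|V. z ^ (k - i))))"
  proof (rule sum.cong)
    fix i assume "i \<in> {..k}"
    then have "(-1 :: real) ^ i * (-1) ^ (k - i) = (-1) ^ k" "real (k choose i) = fact k / (fact i * fact (k - i))"
      by (simp_all add: binomial_fact flip: power_add)
    then show "((-1) ^ i / fact i * (LINT y|\<nu>. y ^ i)) * ((-1) ^ (k - i) / fact (k - i) * (LINT z|V. z ^ (k - i))) =
        (-1) ^ k / fact k * (real (k choose i) * (LINT y|\<nu>. y ^ i) * (LINT z|V. z ^ (k - i)))"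
      by (simp add: field_simps)
  qed simp
  also have "\<dots> = (-1) ^ k / fact k * ((LINT z|V. z ^ k) - (1 - measure \<nu> UNIV) * 0 ^ k)"
    unfolding moment_recursion[OF assms] by (simp only: sum_distrib_left add_diff_cancel_left')
  finally have "coeff (lchar \<nu> N * lchar V N) k = (-1) ^ k / fact k * ((LINT z|V. z ^ k) - (1 - measure \<nu> UNIV) * 0 ^ k)" .
  moreover have "coeff (lchar V N) k = (-1) ^ k / fact k * (LINT z|V. z ^ k)" using k by (simp add: coeff_lchar)
  ultimately show ?thesis
    by (cases k) (auto simp: left_diff_distrib algebra_simps)
qed

end

context deriv_scale
begin

lemma d_bigo_0:
  assumes i: "i \<le> m"
  shows "d i \<in> O(d 0)"
proof -
  have "d i \<in> O(\<lambda>x. x ^ i * d i x)"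
  proof (rule bigoI[where c = 1])
    show "eventually (\<lambda>x. norm (d i x) \<le> 1 * norm (x ^ i * d i x)) at_top"
      using eventually_ge_at_top[of 1]
    proof eventually_elim
      case (elim x)
      then have "1 * \<bar>d i x\<bar> \<le> x ^ i * \<bar>d i x\<bar>" by (intro mult_right_mono) auto
      then show ?case using elim by (simp add: abs_mult)
    qed
  qed
  also have "(\<lambda>x. x ^ i * d i x) \<in> O(d 0)" using bigo_power(2)[of 0 i] i by simp
  finally show ?thesis .
qed

lemma act_bigo_0: "n \<le> m \<Longrightarrow> act n P \<in> O(d 0)"
  unfolding act_def by (intro big_sum_in_bigo landau_o.big.cmult_in_iff' d_bigo_0) (auto intro!: landau_o.big.mult_in_1 d_bigo_0)

text \<open>In the splitting at \<open>x / 2\<close>, the part in which the summand from \<open>V\<close> is small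
contributes \<open>L\<^sub>V P\<close>, the part in which the summand from \<open>\<nu>\<close> is small reproduces
the unknown tail of \<open>V\<close>, and the remaining product of tails is negligible. The polynomial
\<open>Q\<close> solves \<open>Q = Q L\<^sub>\<nu> + P L\<^sub>V\<close> modulo \<open>D ^ m\<close>: multiply by
\<open>1 - L\<^sub>\<nu>\<close> and use \<open>(1 - L\<^sub>\<nu>) L\<^sub>V = 1 - p\<close>. The difference between
the tail of \<open>V\<close> and \<open>act (m - 1) Q\<close> then satisfies a renewal inequality with a negligible
inhomogeneity. A first use of that inequality, with rough bounds, supplies the moments of \<open>V\<close>.\<close>

theorem compound_expansion:
  assumes cg: "compound_geometric \<nu> V"
    and tail: "(\<lambda>x. measure \<nu> {x<..} - act (m - 1) P x) \<in> o(d (m - 1))"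
    and Q: "monom 1 m dvd Q * (1 - lchar \<nu> (m - 1)) ^ 2 - smult (1 - measure \<nu> UNIV) P"
  shows "(\<lambda>x. measure V {x<..} - act (m - 1) Q x) \<in> o(d (m - 1))"
proof -
  interpret compound_geometric \<nu> V by (rule cg)
  define N where "N = m - 1"
  have N: "Suc N = m" "N \<le> m" "real N < \<beta>" using order_pos expo by (auto simp: N_def)
  define B where "B x = measure \<nu> {x<..}" for x
  define Vb where "Vb x = measure V {x<..}" for x
  have [measurable]: "B \<in> borel_measurable borel" "Vb \<in> borel_measurable borel"
    unfolding B_def Vb_def by measurable
  have B: "0 \<le> B x" "B x \<le> 1" "x \<le> y \<Longrightarrow> B y \<le> B x" for x y
    using \<nu>.bounded_measure[of "{x<..}"] mass
    by (auto simp: B_def intro!: \<nu>.finite_measure_mono)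
  have Vb: "0 \<le> Vb x" "Vb x \<le> 1" for x by (auto simp: Vb_def)
  have split: "Vb x = (LINT y|\<nu>. indicator {..x/2} y * Vb (x - y)) +
      ((LINT z|V. indicator {..x/2} z * B (x - z)) + B (x/2) * Vb (x/2))" if "0 \<le> x" for x
    using tail_split[OF that] by (simp add: B_def Vb_def)
  have half_lim: "filterlim (\<lambda>x::real. x / 2) at_top at_top" by real_asymp
  have B_bigo: "B \<in> O(d 0)"
  proof -
    have "(\<lambda>x. B x - act N P x) \<in> O(d 0)"
      using tail d_bigo_0[OF N(2)] by (auto simp: B_def N_def intro: landau_o.small_imp_big landau_o.small_big_trans)
    from sum_in_bigo(1)[OF this act_bigo_0[OF N(2), of P]] show ?thesis by simp
  qed
  have B_half: "(\<lambda>x. B (x / 2)) \<in> O(d 0)"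
    using landau_o.big.compose[OF B_bigo half_lim] half_bigo[of 0] by (auto intro: landau_o.big_trans)
  have B_conv: "\<bar>LINT z|V. indicator {..x/2} z * B (x - z)\<bar> \<le> B (x/2)" for x
  proof -
    have "\<bar>LINT z|V. indicator {..x/2} z * B (x - z)\<bar> \<le> (LINT z|V. \<bar>indicator {..x/2} z * B (x - z)\<bar>)"
      by (rule integral_abs_bound)
    also have "\<dots> \<le> (LINT z|V. B (x/2))"
      using B by (intro integral_mono V.integrable_const_bound[of _ 1]) (auto simp: indicator_def)
    finally show ?thesis by (simp add: V.prob_space[simplified])
  qed
  have Vb_bigo: "Vb \<in> O(d 0)"
  proof (rule renewal_bigo[OF \<nu> mass \<nu>_nonneg])
    show "0 \<le> Vb x \<and> Vb x \<le> 1" if "0 \<le> x" for x using Vb by auto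
    show "(\<lambda>x. (LINT z|V. indicator {..x/2} z * B (x - z)) + B (x/2) * Vb (x/2)) \<in> O(d 0)"
    proof (rule landau_o.big_trans[OF _ B_half], rule bigoI[where c = 2], intro always_eventually allI)
      fix x
      have "\<bar>B (x/2) * Vb (x/2)\<bar> \<le> B (x/2)" using B[of "x/2"] Vb[of "x/2"] by (simp add: abs_mult mult_left_le)
      then show "norm ((LINT z|V. indicator {..x/2} z * B (x - z)) + B (x/2) * Vb (x/2)) \<le> 2 * norm (B (x/2))"
        using B_conv[of x] B(1)[of "x/2"] by simp
    qed
    show "eventually (\<lambda>x. Vb x \<le> (LINT y|\<nu>. indicator {..x/2} y * Vb (x - y)) +
       ((LINT z|V. indicator {..x/2} z * B (x - z)) + B (x/2) * Vb (x/2))) at_top"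
      using eventually_ge_at_top[of 0] by eventually_elim (rule eq_refl[OF split])
  qed auto
  have \<nu>N: "integrable \<nu> (\<lambda>y. y ^ N)"
    using B_bigo by (intro integrable_power_of_tail \<nu> \<nu>_nonneg N(3)) (simp add: B_def[abs_def])
  have VN: "integrable V (\<lambda>y. y ^ N)"
    using Vb_bigo by (intro integrable_power_of_tail V V.finite_measure_axioms V_nonneg N(3)) (simp add: Vb_def[abs_def])
  define L where "L = lchar \<nu> N"
  define LV where "LV = lchar V N"
  have "monom 1 (Suc N) dvd (1 - L) * (Q * L + P * LV - Q)"
  proof -
    have "monom 1 (Suc N) dvd (1 - L) * LV - [:1 - measure \<nu> UNIV:]"
      using lchar_compound[OF \<nu>N VN] by (simp add: monom_1_dvd_iff' L_def LV_def less_Suc_eq_le)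
    then have 1: "monom 1 (Suc N) dvd P * ((1 - L) * LV - [:1 - measure \<nu> UNIV:])" by (rule dvd_mult)
    have 2: "monom 1 (Suc N) dvd Q * (1 - L) ^ 2 - smult (1 - measure \<nu> UNIV) P"
      using Q[folded N_def] by (simp only: L_def N(1))
    have "(1 - L) * (Q * L + P * LV - Q) =
        P * ((1 - L) * LV - [:1 - measure \<nu> UNIV:]) - (Q * (1 - L) ^ 2 - smult (1 - measure \<nu> UNIV) P)"
      by (simp add: algebra_simps power2_eq_square)
    then show ?thesis using dvd_diff[OF 1 2] by (simp only:)
  qed
  moreover have "coeff (1 - L) 0 \<noteq> 0"
    using mass by (simp add: L_def coeff_lchar)
  ultimately have "monom 1 (Suc N) dvd Q * L + P * LV - Q" by (rule cancel_mod_monom[rotated])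
  then have "act N (Q * L + P * LV - Q) x = 0" for x
    by (simp add: act_def monom_1_dvd_iff' less_Suc_eq_le)
  then have alg: "act N (Q * L) x + act N (P * LV) x = act N Q x" for x
    by (simp add: act_add act_diff)
  define f where "f = act N P"
  define g where "g = act N Q"
  have [measurable]: "f \<in> borel_measurable borel" "g \<in> borel_measurable borel"
    unfolding f_def g_def by measurable
  have bnd: "\<exists>K. \<forall>x\<ge>x1. \<bar>f x\<bar> \<le> K \<and> \<bar>g x\<bar> \<le> K" if "a < x1" for x1
  proof -
    have "\<forall>x\<ge>x1. \<bar>f x\<bar> \<le> max (\<Sum>i\<le>N. \<bar>coeff P i\<bar> * \<bar>d i x1\<bar>) (\<Sum>i\<le>N. \<bar>coeff Q i\<bar> * \<bar>d i x1\<bar>) \<and>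
        \<bar>g x\<bar> \<le> max (\<Sum>i\<le>N. \<bar>coeff P i\<bar> * \<bar>d i x1\<bar>) (\<Sum>i\<le>N. \<bar>coeff Q i\<bar> * \<bar>d i x1\<bar>)"
      unfolding f_def g_def using act_bounded[OF N(2) that] by (auto simp: le_max_iff_disj)
    then show ?thesis by blast
  qed
  define \<Delta> where "\<Delta> x = Vb x - g x" for x
  have [measurable]: "\<Delta> \<in> borel_measurable borel" unfolding \<Delta>_def by measurable
  \<comment> \<open>The inhomogeneity: Taylor remainders for the two convolutions, the effect of replacing \<open>B\<close> by its
    expansion, and the event that both summands exceed \<open>x / 2\<close>.\<close>
  define e1 where "e1 x = (LINT y|\<nu>. indicator {..x/2} y * g (x - y)) - act N (Q * L) x" for x
  define e2 where "e2 x = (LINT z|V. indicator {..x/2} z * f (x - z)) - act N (P * LV) x" for x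
  define e3 where "e3 x = (LINT z|V. indicator {..x/2} z * (B (x - z) - f (x - z)))" for x
  define e4 where "e4 x = B (x/2) * Vb (x/2)" for x
  have e1: "e1 \<in> o(d N)"
    using act_convolution[OF \<nu> \<nu>N N(2), of Q] by (simp add: e1_def[abs_def] g_def L_def)
  have e2: "e2 \<in> o(d N)"
    using act_convolution[OF V.finite_measure_axioms V(2) VN N(2), of P] by (simp add: e2_def[abs_def] f_def LV_def)
  have e3: "e3 \<in> o(d N)"
  proof -
    have "e3 \<in> o(\<lambda>x. d N (x / 2))"
    proof (rule landau_o.smallI)
      fix c :: real assume c: "0 < c"
      have "(\<lambda>x. B x - f x) \<in> o(d N)" using tail by (simp add: B_def f_def N_def)
      from landau_o.smallD[OF this c] obtain X where X: "\<And>x. X \<le> x \<Longrightarrow> \<bar>B x - f x\<bar> \<le> c * \<bar>d N x\<bar>"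
        by (auto simp: eventually_at_top_linorder)
      show "eventually (\<lambda>x. norm (e3 x) \<le> c * norm (d N (x / 2))) at_top"
        using eventually_gt_at_top[of "2 * X"] eventually_gt_at_top[of "2 * a"]
      proof eventually_elim
        case (elim x)
        have *: "\<bar>indicator {..x/2} z * (B (x - z) - f (x - z))\<bar> \<le> c * \<bar>d N (x/2)\<bar>" for z
        proof (cases "z \<le> x / 2")
          case True
          then have "\<bar>B (x - z) - f (x - z)\<bar> \<le> c * \<bar>d N (x - z)\<bar>" using elim by (intro X) auto
          also have "\<dots> \<le> c * \<bar>d N (x/2)\<bar>" using True elim c N(2) by (intro mult_left_mono anti) auto
          finally show ?thesis using True by simp
        qed (use c in auto)
        have "\<bar>e3 x\<bar> \<le> (LINT z|V. \<bar>indicator {..x/2} z * (B (x - z) - f (x - z))\<bar>)"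
          unfolding e3_def by (rule integral_abs_bound)
        also have "\<dots> \<le> (LINT z|V. c * \<bar>d N (x/2)\<bar>)"
          using * c by (intro integral_mono V.integrable_const_bound[of _ "c * \<bar>d N (x/2)\<bar>"]) auto
        finally show ?case by (simp add: V.prob_space[simplified])
      qed
    qed
    then show ?thesis using half_bigo[OF N(2)] by (rule landau_o.small_big_trans)
  qed
  have e4: "e4 \<in> o(d N)"
  proof -
    have "(\<lambda>x. Vb (x/2) * B (x/2)) \<in> O(\<lambda>x. Vb (x/2) * d 0 x)"
      by (intro landau_o.big.mult_left B_half)
    moreover have "(\<lambda>x. Vb (x/2) * d 0 x) \<in> o(d N)"
      using tail_moment_smallo[OF V.finite_measure_axioms V(2) VN, of 0 0] N(2) by (simp add: Vb_def)
    ultimately show ?thesis unfolding e4_def by (simp add: mult.commute landau_o.big_small_trans)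
  qed
  obtain Kg where Kg: "\<And>x. a + 1 \<le> x \<Longrightarrow> \<bar>g x\<bar> \<le> Kg" using bnd[of "a + 1"] by auto
  have "(\<lambda>x. \<bar>\<Delta> x\<bar>) \<in> o(d N)"
  proof (rule renewal_smallo[OF \<nu> mass \<nu>_nonneg N(2)])
    show "0 \<le> \<bar>\<Delta> x\<bar> \<and> \<bar>\<Delta> x\<bar> \<le> 1 + Kg" if "a + 1 \<le> x" for x
      using Kg[OF that] Vb[of x] by (auto simp: \<Delta>_def)
    show "(\<lambda>x. \<bar>e1 x + e2 x + e3 x + e4 x\<bar>) \<in> o(d N)"
      using e1 e2 e3 e4 by (simp add: sum_in_smallo)
    show "eventually (\<lambda>x. \<bar>\<Delta> x\<bar> \<le> (LINT y|\<nu>. indicator {..x/2} y * \<bar>\<Delta> (x - y)\<bar>) + \<bar>e1 x + e2 x + e3 x + e4 x\<bar>) at_top"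
      using eventually_gt_at_top[of "2 * a"]
    proof eventually_elim
      case (elim x)
      have x: "a < x / 2" "0 \<le> x" using elim a_nonneg by auto
      obtain K where K: "\<And>y. x / 2 \<le> y \<Longrightarrow> \<bar>f y\<bar> \<le> K" "\<And>y. x / 2 \<le> y \<Longrightarrow> \<bar>g y\<bar> \<le> K"
        using bnd[OF x(1)] by blast
      have K0: "0 \<le> K" using K(1)[of "x/2"] by simp
      have ints: "integrable \<nu> (\<lambda>y. indicator {..x/2} y * Vb (x - y))" "integrable \<nu> (\<lambda>y. indicator {..x/2} y * g (x - y))"
        "integrable V (\<lambda>y. indicator {..x/2} y * B (x - y))" "integrable V (\<lambda>y. indicator {..x/2} y * f (x - y))"
        using K K0 B Vb
        by (intro \<nu>.integrable_const_bound[of _ 1] \<nu>.integrable_const_bound[of _ K]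
          V.integrable_const_bound[of _ 1] V.integrable_const_bound[of _ K]; auto simp: indicator_def)+
      have "(LINT y|\<nu>. indicator {..x/2} y * \<Delta> (x - y)) =
          (LINT y|\<nu>. indicator {..x/2} y * Vb (x - y)) - (LINT y|\<nu>. indicator {..x/2} y * g (x - y))"
        unfolding \<Delta>_def right_diff_distrib by (rule Bochner_Integration.integral_diff[OF ints(1,2)])
      moreover have "e3 x = (LINT z|V. indicator {..x/2} z * B (x - z)) - (LINT z|V. indicator {..x/2} z * f (x - z))"
        unfolding e3_def right_diff_distrib by (rule Bochner_Integration.integral_diff[OF ints(3,4)])
      ultimately have "\<Delta> x = (LINT y|\<nu>. indicator {..x/2} y * \<Delta> (x - y)) + (e1 x + e2 x + e3 x + e4 x)"
        using split[OF x(2)] alg[of x] by (simp add: \<Delta>_def e1_def e2_def e4_def g_def[symmetric])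
      moreover have "\<bar>LINT y|\<nu>. indicator {..x/2} y * \<Delta> (x - y)\<bar> \<le> (LINT y|\<nu>. \<bar>indicator {..x/2} y * \<Delta> (x - y)\<bar>)"
        by (rule integral_abs_bound)
      ultimately show ?case by (simp add: abs_mult)
    qed
  qed measurable
  then show ?thesis by (simp add: \<Delta>_def Vb_def g_def N_def)
qed

end

section \<open>Random walks on sequence space\<close>

definition psum :: "nat \<Rightarrow> (nat \<Rightarrow> real) \<Rightarrow> real" where
  "psum n \<omega> = (\<Sum>i<n. \<omega> i)"

definition drop_seq :: "nat \<Rightarrow> (nat \<Rightarrow> real) \<Rightarrow> nat \<Rightarrow> real" where
  "drop_seq j \<omega> i = \<omega> (j + i)"

text \<open>Ladder epochs are the cases \<open>C = {0<..\<close>} and \<open>C = {..0\<close>}; the starting point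
\<open>0\<close> must not count as a visit to the latter, hence \<open>1 \<le> j\<close>.\<close>

definition first_entry :: "real set \<Rightarrow> nat \<Rightarrow> (nat \<Rightarrow> real) \<Rightarrow> bool" where
  "first_entry C j \<omega> \<longleftrightarrow> 1 \<le> j \<and> psum j \<omega> \<in> C \<and> (\<forall>i\<in>{1..<j}. psum i \<omega> \<notin> C)"

lemma psum_0 [simp]: "psum 0 \<omega> = 0" by (simp add: psum_def)

lemma psum_Suc: "psum (Suc n) \<omega> = psum n \<omega> + \<omega> n" by (simp add: psum_def)

lemma psum_add: "psum (j + i) \<omega> = psum j \<omega> + psum i (drop_seq j \<omega>)"
  by (induction i) (simp_all add: psum_Suc drop_seq_def)

lemma psum_Suc_drop: "psum (Suc n) \<omega> = \<omega> 0 + psum n (drop_seq 1 \<omega>)"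
  using psum_add[of 1 n \<omega>] by (simp add: psum_Suc)

lemma psum_comb_seq: "i \<le> j \<Longrightarrow> psum i (comb_seq j \<omega> \<omega>') = psum i \<omega>"
  by (simp add: psum_def comb_seq_less)

lemma drop_comb_seq: "drop_seq j (comb_seq j \<omega> \<omega>') = \<omega>'"
  by (simp add: drop_seq_def fun_eq_iff comb_seq_def)

lemma first_entry_comb_seq: "first_entry C j (comb_seq j \<omega> \<omega>') = first_entry C j \<omega>"
  by (auto simp: first_entry_def psum_comb_seq)

lemma first_entry_unique: "first_entry C j \<omega> \<Longrightarrow> first_entry C k \<omega> \<Longrightarrow> j = k"
  unfolding first_entry_def by (metis atLeastLessThan_iff linorder_neqE_nat)

lemma ex_first_entry_iff: "(\<exists>j. first_entry C j \<omega>) \<longleftrightarrow> (\<exists>j\<ge>1. psum j \<omega> \<in> C)"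
proof
  assume ex: "\<exists>j\<ge>1. psum j \<omega> \<in> C"
  define j where "j = (LEAST j. 1 \<le> j \<and> psum j \<omega> \<in> C)"
  have "1 \<le> j \<and> psum j \<omega> \<in> C" unfolding j_def using LeastI_ex[of "\<lambda>j. 1 \<le> j \<and> psum j \<omega> \<in> C"] ex by blast
  moreover have "psum i \<omega> \<notin> C" if "i \<in> {1..<j}" for i
    using not_less_Least[of i "\<lambda>j. 1 \<le> j \<and> psum j \<omega> \<in> C"] that by (auto simp: j_def)
  ultimately show "\<exists>j. first_entry C j \<omega>" by (auto simp: first_entry_def)
qed (auto simp: first_entry_def)

lemma suminf_first_entry:
  fixes f :: "nat \<Rightarrow> ennreal"
  assumes "first_entry C j \<omega>"
  shows "(\<Sum>k. if first_entry C k \<omega> then f k else 0) = f j"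
proof -
  have "(\<lambda>k. if first_entry C k \<omega> then f k else 0) = (\<lambda>k. if k = j then f k else 0)"
    using assms first_entry_unique by (auto simp: fun_eq_iff)
  then show ?thesis using suminf_finite[of "{j}" "\<lambda>k. if k = j then f k else 0"] by simp
qed

locale iid_walk = sequence_space \<mu> for \<mu> :: "real measure" +
  assumes sets_mu [measurable_cong]: "sets \<mu> = sets borel"
begin

abbreviation Q :: "(nat \<Rightarrow> real) measure" where "Q \<equiv> \<Pi>\<^sub>M i\<in>(UNIV :: nat set). \<mu>"

lemma space_mu [simp]: "space \<mu> = UNIV" using sets_eq_imp_space_eq[OF sets_mu] by simp

lemma space_Q [simp]: "space Q = UNIV" by (simp add: space_PiM)

lemma coord_measurable [measurable]: "(\<lambda>\<omega>. \<omega> i) \<in> borel_measurable Q"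
  using measurable_component_singleton[of i UNIV "\<lambda>_. \<mu>"] measurable_cong_sets[OF refl sets_mu] by simp

lemma psum_measurable [measurable]: "psum n \<in> borel_measurable Q"
  unfolding psum_def by measurable

lemma drop_seq_measurable [measurable]: "drop_seq j \<in> measurable Q Q"
proof (rule measurable_PiM_single')
  show "(\<lambda>\<omega>. drop_seq j \<omega> i) \<in> measurable Q \<mu>" for i
    unfolding drop_seq_def by measurable
qed auto

lemma first_entry_measurable [measurable (raw)]:
  assumes C [measurable]: "C \<in> sets borel" and f [measurable]: "f \<in> measurable N Q"
  shows "Measurable.pred N (\<lambda>x. first_entry C j (f x))"
  unfolding first_entry_def by measurable

lemma psum_measurable' [measurable (raw)]: "f \<in> measurable N Q \<Longrightarrow> (\<lambda>x. psum n (f x)) \<in> borel_measurable N"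
  by (rule measurable_compose[OF _ psum_measurable])

lemma sets_Q_Collect: "Measurable.pred Q P \<Longrightarrow> {\<omega>. P \<omega>} \<in> sets Q"
  by (simp add: pred_def)

lemma distr_reindex:
  assumes "inj f"
  shows "distr Q Q (\<lambda>\<omega> i. \<omega> (f i)) = Q"
  using distr_PiM_reindex[of UNIV "\<lambda>_. \<mu>" f UNIV] assms by (simp add: M.prob_space_axioms restrict_def)

lemma distr_drop_seq: "distr Q Q (drop_seq j) = Q"
  using distr_reindex[of "\<lambda>i. j + i"] by (simp add: drop_seq_def[abs_def] inj_on_def)

lemma nn_integral_comb_seq:
  assumes [measurable]: "f \<in> borel_measurable Q"
  shows "(\<integral>\<^sup>+\<omega>. f \<omega> \<partial>Q) = (\<integral>\<^sup>+\<omega>. \<integral>\<^sup>+\<omega>'. f (comb_seq j \<omega> \<omega>') \<partial>Q \<partial>Q)"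
proof -
  have "(\<integral>\<^sup>+\<omega>. f \<omega> \<partial>Q) = (\<integral>\<^sup>+\<omega>. f \<omega> \<partial>distr (Q \<Otimes>\<^sub>M Q) Q (\<lambda>(\<omega>, \<omega>'). comb_seq j \<omega> \<omega>'))"
    by (subst PiM_comb_seq) simp
  also have "\<dots> = (\<integral>\<^sup>+x. f (case x of (\<omega>, \<omega>') \<Rightarrow> comb_seq j \<omega> \<omega>') \<partial>(Q \<Otimes>\<^sub>M Q))"
    by (rule nn_integral_distr) measurable
  also have "\<dots> = (\<integral>\<^sup>+\<omega>. \<integral>\<^sup>+\<omega>'. f (comb_seq j \<omega> \<omega>') \<partial>Q \<partial>Q)"
    by (subst P.nn_integral_fst[symmetric]) (auto simp: split_beta')
  finally show ?thesis .
qed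

text \<open>The defective law of the position at the first entry. The density discards the paths without entry, on
which \<open>LEAST\<close> is meaningless.\<close>

definition hit_law :: "real set \<Rightarrow> real measure" where
  "hit_law C = distr (density Q (indicator {\<omega>. \<exists>j. first_entry C j \<omega>})) borel (\<lambda>\<omega>. psum (LEAST j. first_entry C j \<omega>) \<omega>)"

lemma sets_hit_law [simp, measurable_cong]: "sets (hit_law C) = sets borel"
  by (simp add: hit_law_def)

lemma space_hit_law [simp]: "space (hit_law C) = UNIV"
  by (simp add: hit_law_def)

lemma Least_first_entry: "first_entry C j \<omega> \<Longrightarrow> (LEAST j. first_entry C j \<omega>) = j"
  by (rule Least_equality) (auto dest: first_entry_unique)

lemma hit_pos_measurable:
  assumes [measurable]: "C \<in> sets borel"
  shows "(\<lambda>\<omega>. psum (LEAST j. first_entry C j \<omega>) \<omega>) \<in> borel_measurable Q"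
proof (rule measurable_compose_countable)
  show "(\<lambda>\<omega>. LEAST j. first_entry C j \<omega>) \<in> measurable Q (count_space UNIV)" by measurable
qed measurable

lemma nn_integral_hit_law:
  assumes C [measurable]: "C \<in> sets borel" and G [measurable]: "G \<in> borel_measurable borel"
  shows "(\<integral>\<^sup>+y. G y \<partial>hit_law C) = (\<integral>\<^sup>+\<omega>. (\<Sum>j. if first_entry C j \<omega> then G (psum j \<omega>) else 0) \<partial>Q)"
proof -
  note [measurable] = hit_pos_measurable[OF C]
  have "(\<integral>\<^sup>+y. G y \<partial>hit_law C) = (\<integral>\<^sup>+\<omega>. indicator {\<omega>. \<exists>j. first_entry C j \<omega>} \<omega> * G (psum (LEAST j. first_entry C j \<omega>) \<omega>) \<partial>Q)"
    unfolding hit_law_def by (subst nn_integral_distr) (auto simp: nn_integral_density)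
  also have "\<dots> = (\<integral>\<^sup>+\<omega>. (\<Sum>j. if first_entry C j \<omega> then G (psum j \<omega>) else 0) \<partial>Q)"
  proof (rule nn_integral_cong)
    fix \<omega>
    show "indicator {\<omega>. \<exists>j. first_entry C j \<omega>} \<omega> * G (psum (LEAST j. first_entry C j \<omega>) \<omega>) =
        (\<Sum>j. if first_entry C j \<omega> then G (psum j \<omega>) else 0)"
    proof (cases "\<exists>j. first_entry C j \<omega>")
      case True
      then obtain j where j: "first_entry C j \<omega>" by blast
      show ?thesis using True unfolding suminf_first_entry[OF j] Least_first_entry[OF j] by simp
    qed simp
  qed
  finally show ?thesis .
qed

text \<open>Fixing the first entry time \<open>j\<close> leaves an event that depends on the first \<open>j\<close>
increments only, and the increments after \<open>j\<close> are an independent copy of the sequence.\<close>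

theorem strong_markov:
  assumes C [measurable]: "C \<in> sets borel" and g [measurable]: "(\<lambda>(y, \<omega>). g y \<omega>) \<in> borel_measurable (borel \<Otimes>\<^sub>M Q)"
  shows "(\<integral>\<^sup>+\<omega>. (\<Sum>j. if first_entry C j \<omega> then g (psum j \<omega>) (drop_seq j \<omega>) else 0) \<partial>Q) =
    (\<integral>\<^sup>+y. \<integral>\<^sup>+\<omega>. g y \<omega> \<partial>Q \<partial>hit_law C)"
proof -
  have [measurable]: "(\<lambda>x. g (u x) (v x)) \<in> borel_measurable N"
    if [measurable]: "u \<in> borel_measurable N" "v \<in> measurable N Q" for u v N
    using measurable_compose[OF measurable_Pair[OF that] g] by simp
  have [measurable]: "(\<lambda>y. \<integral>\<^sup>+\<omega>. g y \<omega> \<partial>Q) \<in> borel_measurable borel" by measurable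
  have "(\<integral>\<^sup>+\<omega>. (\<Sum>j. if first_entry C j \<omega> then g (psum j \<omega>) (drop_seq j \<omega>) else 0) \<partial>Q) =
      (\<Sum>j. \<integral>\<^sup>+\<omega>. (if first_entry C j \<omega> then g (psum j \<omega>) (drop_seq j \<omega>) else 0) \<partial>Q)"
    by (rule nn_integral_suminf) measurable
  also have "\<dots> = (\<Sum>j. \<integral>\<^sup>+\<omega>. (if first_entry C j \<omega> then \<integral>\<^sup>+\<omega>'. g (psum j \<omega>) \<omega>' \<partial>Q else 0) \<partial>Q)"
  proof (rule arg_cong[where f = suminf], rule ext)
    fix j
    have "(\<integral>\<^sup>+\<omega>. (if first_entry C j \<omega> then g (psum j \<omega>) (drop_seq j \<omega>) else 0) \<partial>Q) =
        (\<integral>\<^sup>+\<omega>. \<integral>\<^sup>+\<omega>'. (if first_entry C j \<omega> then g (psum j \<omega>) \<omega>' else 0) \<partial>Q \<partial>Q)"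
      by (subst nn_integral_comb_seq[where j = j]) (simp_all add: first_entry_comb_seq psum_comb_seq drop_comb_seq cong: if_cong)
    also have "\<dots> = (\<integral>\<^sup>+\<omega>. (if first_entry C j \<omega> then \<integral>\<^sup>+\<omega>'. g (psum j \<omega>) \<omega>' \<partial>Q else 0) \<partial>Q)"
      by (intro nn_integral_cong) auto
    finally show "(\<integral>\<^sup>+\<omega>. (if first_entry C j \<omega> then g (psum j \<omega>) (drop_seq j \<omega>) else 0) \<partial>Q) = \<dots>" .
  qed
  also have "\<dots> = (\<integral>\<^sup>+\<omega>. (\<Sum>j. if first_entry C j \<omega> then \<integral>\<^sup>+\<omega>'. g (psum j \<omega>) \<omega>' \<partial>Q else 0) \<partial>Q)"
    by (rule nn_integral_suminf[symmetric]) measurable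
  also have "\<dots> = (\<integral>\<^sup>+y. \<integral>\<^sup>+\<omega>. g y \<omega> \<partial>Q \<partial>hit_law C)"
    by (rule nn_integral_hit_law[symmetric]) measurable
  finally show ?thesis .
qed

lemma emeasure_hit_law:
  assumes [measurable]: "C \<in> sets borel" "A \<in> sets borel"
  shows "emeasure (hit_law C) A = emeasure Q {\<omega>. \<exists>j. first_entry C j \<omega> \<and> psum j \<omega> \<in> A}"
proof -
  have "emeasure (hit_law C) A = (\<integral>\<^sup>+y. indicator A y \<partial>hit_law C)" by simp
  also have "\<dots> = (\<integral>\<^sup>+\<omega>. (\<Sum>j. if first_entry C j \<omega> then indicator A (psum j \<omega>) else 0) \<partial>Q)"
    by (rule nn_integral_hit_law) measurable
  also have "\<dots> = (\<integral>\<^sup>+\<omega>. indicator {\<omega>. \<exists>j. first_entry C j \<omega> \<and> psum j \<omega> \<in> A} \<omega> \<partial>Q)"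
  proof (rule nn_integral_cong)
    fix \<omega>
    show "(\<Sum>j. if first_entry C j \<omega> then indicator A (psum j \<omega>) else 0) =
        (indicator {\<omega>. \<exists>j. first_entry C j \<omega> \<and> psum j \<omega> \<in> A} \<omega> :: ennreal)"
    proof (cases "\<exists>j. first_entry C j \<omega>")
      case True
      then obtain j where j: "first_entry C j \<omega>" by blast
      then have "(\<exists>j. first_entry C j \<omega> \<and> psum j \<omega> \<in> A) \<longleftrightarrow> psum j \<omega> \<in> A" by (auto dest: first_entry_unique)
      then show ?thesis unfolding suminf_first_entry[OF j] by (simp add: indicator_def)
    qed (simp add: indicator_def)
  qed
  also have "\<dots> = emeasure Q {\<omega>. \<exists>j. first_entry C j \<omega> \<and> psum j \<omega> \<in> A}"
    by (rule nn_integral_indicator) (rule sets_Q_Collect, measurable)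
  finally show ?thesis .
qed

lemma finite_hit_law: "C \<in> sets borel \<Longrightarrow> finite_measure (hit_law C)"
  by (rule finite_measureI) (simp add: emeasure_hit_law)

lemma measure_hit_law:
  "C \<in> sets borel \<Longrightarrow> A \<in> sets borel \<Longrightarrow> measure (hit_law C) A = measure Q {\<omega>. \<exists>j. first_entry C j \<omega> \<and> psum j \<omega> \<in> A}"
  by (simp add: measure_def emeasure_hit_law)

lemma AE_hit_law:
  assumes [measurable]: "C \<in> sets borel"
  shows "AE y in hit_law C. y \<in> C"
proof (rule AE_I')
  have "{\<omega>. \<exists>j. first_entry C j \<omega> \<and> psum j \<omega> \<in> - C} = {}" by (auto simp: first_entry_def)
  then have "emeasure (hit_law C) (- C) = 0"
    by (subst emeasure_hit_law) (simp_all only: emeasure_empty assms borel_comp)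
  then show "- C \<in> null_sets (hit_law C)"
    by (intro null_setsI) auto
qed auto

text \<open>The maximum of \<open>S\<^sub>0, \<dots>, S\<^sub>n\<close>, in the recursive form
\<open>M\<^sub>n\<^sub>+\<^sub>1 = max 0 (X\<^sub>1 + M\<^sub>n \<circ> shift)\<close> that gives the maximal
inequality.\<close>

fun mx :: "nat \<Rightarrow> (nat \<Rightarrow> real) \<Rightarrow> real" where
  "mx 0 \<omega> = 0"
| "mx (Suc n) \<omega> = max 0 (\<omega> 0 + mx n (drop_seq 1 \<omega>))"

lemma mx_nonneg: "0 \<le> mx n \<omega>" by (cases n) auto

lemma mx_mono: "mx n \<omega> \<le> mx (Suc n) \<omega>"
proof (induction n arbitrary: \<omega>)
  case (Suc n)
  show ?case using Suc[of "drop_seq 1 \<omega>"] by (auto simp del: mx.simps simp: mx.simps(2)[of _ \<omega>])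
qed simp

lemma psum_le_mx: "k \<le> n \<Longrightarrow> psum k \<omega> \<le> mx n \<omega>"
proof (induction n arbitrary: k \<omega>)
  case (Suc n)
  show ?case
  proof (cases k)
    case (Suc i)
    then show ?thesis using Suc.IH[of i "drop_seq 1 \<omega>"] Suc.prems by (simp add: psum_Suc_drop)
  qed simp
qed simp

lemma mx_measurable [measurable]: "mx n \<in> borel_measurable Q"
  by (induction n) simp_all

lemma integrable_drop_seq:
  fixes f :: "(nat \<Rightarrow> real) \<Rightarrow> real"
  assumes "f \<in> borel_measurable Q"
  shows "integrable Q (\<lambda>\<omega>. f (drop_seq j \<omega>)) \<longleftrightarrow> integrable Q f"
    and "(LINT \<omega>|Q. f (drop_seq j \<omega>)) = (LINT \<omega>|Q. f \<omega>)"
  using integrable_distr_eq[OF drop_seq_measurable assms, of j] integral_distr[OF drop_seq_measurable assms, of j]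
  by (simp_all add: distr_drop_seq)

lemma distr_coord: "distr Q borel (\<lambda>\<omega>. \<omega> i) = \<mu>"
proof -
  have "distr Q \<mu> (\<lambda>\<omega>. \<omega> i) = \<mu>" by (rule PiM_component) simp
  moreover have "distr Q \<mu> (\<lambda>\<omega>. \<omega> i) = distr Q borel (\<lambda>\<omega>. \<omega> i)" by (rule distr_cong) (simp_all add: sets_mu)
  ultimately show ?thesis by simp
qed

lemma integrable_coord:
  assumes "integrable \<mu> (\<lambda>x. x)"
  shows "integrable Q (\<lambda>\<omega>. \<omega> i)" "(LINT \<omega>|Q. \<omega> i) = (LINT x|\<mu>. x)"
proof -
  have "integrable (distr Q borel (\<lambda>\<omega>. \<omega> i)) (\<lambda>x. x) \<longleftrightarrow> integrable Q (\<lambda>\<omega>. \<omega> i)"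
    by (rule integrable_distr_eq) auto
  then show "integrable Q (\<lambda>\<omega>. \<omega> i)" using assms unfolding distr_coord by blast
  have "(LINT x|distr Q borel (\<lambda>\<omega>. \<omega> i). x) = (LINT \<omega>|Q. \<omega> i)"
    by (rule integral_distr) auto
  then show "(LINT \<omega>|Q. \<omega> i) = (LINT x|\<mu>. x)" unfolding distr_coord by (rule sym)
qed

text \<open>Garsia's argument. On \<open>M\<^sub>n\<^sub>+\<^sub>1 > 0\<close> one has \<open>X\<^sub>1 =
M\<^sub>n\<^sub>+\<^sub>1 - M\<^sub>n \<circ> shift\<close>; since \<open>M\<^sub>n \<circ> shift\<close> is
nonnegative and distributed as \<open>M\<^sub>n \<le> M\<^sub>n\<^sub>+\<^sub>1\<close>, the mean of
\<open>X\<^sub>1\<close> on this event is nonnegative. If the walk were sure to become positive, these events would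
exhaust the space and \<open>X\<^sub>1\<close> would have nonnegative mean.\<close>

theorem asc_mass_less_1:
  assumes int: "integrable \<mu> (\<lambda>x. x)" and mean: "(LINT x|\<mu>. x) < 0"
  shows "measure (hit_law {0<..}) UNIV < 1"
proof (rule ccontr)
  assume "\<not> measure (hit_law {0<..}) UNIV < 1"
  then have one: "measure Q {\<omega>. \<exists>j. first_entry {0<..} j \<omega>} = 1"
    using P.prob_le_1 by (simp add: measure_hit_law not_less antisym)
  have int_mx: "integrable Q (mx n)" for n
  proof (induction n)
    case (Suc n)
    have "integrable Q (\<lambda>\<omega>. \<omega> 0 + mx n (drop_seq 1 \<omega>))"
      using integrable_coord[OF int] integrable_drop_seq(1)[of "mx n"] Suc by (intro Bochner_Integration.integrable_add) auto
    then show ?case by simp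
  qed simp
  have pos: "0 \<le> (LINT \<omega>|Q. \<omega> 0 * indicator {\<omega>. 0 < mx (Suc n) \<omega>} \<omega>)" for n
  proof -
    let ?I = "indicator {\<omega>. 0 < mx (Suc n) \<omega>} :: _ \<Rightarrow> real"
    have i1: "integrable Q (\<lambda>\<omega>. \<omega> 0 * ?I \<omega>)"
      using integrable_coord[OF int] by (intro integrable_real_mult_indicator sets_Q_Collect) measurable
    have i2: "integrable Q (\<lambda>\<omega>. mx n (drop_seq 1 \<omega>))" using integrable_drop_seq(1)[of "mx n"] int_mx by simp
    have "(LINT \<omega>|Q. mx n \<omega>) \<le> (LINT \<omega>|Q. mx (Suc n) \<omega>)"
      by (intro integral_mono int_mx mx_mono)
    also have "\<dots> \<le> (LINT \<omega>|Q. \<omega> 0 * ?I \<omega> + mx n (drop_seq 1 \<omega>))"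
    proof (intro integral_mono int_mx Bochner_Integration.integrable_add i1 i2)
      fix \<omega>
      show "mx (Suc n) \<omega> \<le> \<omega> 0 * ?I \<omega> + mx n (drop_seq 1 \<omega>)"
        using mx_nonneg[of n "drop_seq 1 \<omega>"] by (auto simp: indicator_def max_def)
    qed
    also have "\<dots> = (LINT \<omega>|Q. \<omega> 0 * ?I \<omega>) + (LINT \<omega>|Q. mx n \<omega>)"
      using i1 i2 integrable_drop_seq(2)[of "mx n" 1] by (subst Bochner_Integration.integral_add) auto
    finally show ?thesis by simp
  qed
  have "(\<lambda>n. LINT \<omega>|Q. \<omega> 0 * indicator {\<omega>. 0 < mx (Suc n) \<omega>} \<omega>) \<longlonglongrightarrow> (LINT \<omega>|Q. \<omega> 0)"
  proof (rule integral_dominated_convergence[where w = "\<lambda>\<omega>. \<bar>\<omega> 0\<bar>"])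
    have "AE \<omega> in Q. \<exists>j. first_entry {0<..} j \<omega>"
      using P.prob_eq_1[OF sets_Q_Collect, of "\<lambda>\<omega>. \<exists>j. first_entry {0<..} j \<omega>"] one by simp
    then show "AE \<omega> in Q. (\<lambda>n. \<omega> 0 * indicator {\<omega>. 0 < mx (Suc n) \<omega>} \<omega>) \<longlonglongrightarrow> \<omega> 0"
    proof eventually_elim
      case (elim \<omega>)
      then obtain j where j: "0 < psum j \<omega>" by (auto simp: first_entry_def)
      show ?case
      proof (rule tendsto_eventually, rule eventually_sequentiallyI[of j])
        fix n assume "j \<le> n"
        then have "psum j \<omega> \<le> mx (Suc n) \<omega>" by (intro psum_le_mx) simp
        then show "\<omega> 0 * indicator {\<omega>. 0 < mx (Suc n) \<omega>} \<omega> = \<omega> 0" using j by (simp del: mx.simps)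
      qed
    qed
    show "(\<lambda>\<omega>. \<omega> 0 * indicator {\<omega>. 0 < mx (Suc n) \<omega>} \<omega>) \<in> borel_measurable Q" for n
      by (intro borel_measurable_times borel_measurable_indicator sets_Q_Collect) measurable
  qed (use integrable_coord[OF int] in \<open>auto simp: indicator_def simp del: mx.simps\<close>)
  then have "0 \<le> (LINT \<omega>|Q. \<omega> 0)" by (rule LIMSEQ_le_const) (use pos in auto)
  then show False using mean integrable_coord[OF int] by simp
qed

end

context iid_walk
begin

definition sup_walk :: "(nat \<Rightarrow> real) \<Rightarrow> ereal" where
  "sup_walk \<omega> = (SUP n. ereal (psum n \<omega>))"

lemma sup_walk_measurable [measurable]: "sup_walk \<in> borel_measurable Q"
  unfolding sup_walk_def by measurable

lemma sup_walk_nonneg: "0 \<le> sup_walk \<omega>"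
  unfolding sup_walk_def by (rule SUP_upper2[of 0]) auto

lemma sup_walk_greater_iff: "ereal x < sup_walk \<omega> \<longleftrightarrow> (\<exists>n. x < psum n \<omega>)"
  unfolding sup_walk_def less_SUP_iff by simp

text \<open>Before its first strict ascending ladder epoch the walk stays nonpositive, so the supremum is attained
from that epoch on.\<close>

lemma sup_walk_decompose:
  assumes "first_entry {0<..} j \<omega>"
  shows "sup_walk \<omega> = ereal (psum j \<omega>) + sup_walk (drop_seq j \<omega>)"
proof -
  have eq: "ereal (psum j \<omega>) + sup_walk (drop_seq j \<omega>) = (SUP i. ereal (psum j \<omega>) + ereal (psum i (drop_seq j \<omega>)))"
    unfolding sup_walk_def by (rule SUP_ereal_add_right[symmetric]) auto
  show ?thesis
  proof (rule antisym)
    show "sup_walk \<omega> \<le> ereal (psum j \<omega>) + sup_walk (drop_seq j \<omega>)"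
      unfolding eq unfolding sup_walk_def
    proof (rule SUP_mono)
      fix n
      show "\<exists>i\<in>UNIV. ereal (psum n \<omega>) \<le> ereal (psum j \<omega>) + ereal (psum i (drop_seq j \<omega>))"
      proof (cases "n < j")
        case True
        then have "psum n \<omega> \<le> psum j \<omega>"
          using assms by (cases "n = 0") (auto simp: first_entry_def not_less intro: order_trans[of _ 0])
        then show ?thesis by (intro bexI[of _ 0]) auto
      next
        case False
        then show ?thesis using psum_add[of j "n - j" \<omega>] by (intro bexI[of _ "n - j"]) auto
      qed
    qed
    show "ereal (psum j \<omega>) + sup_walk (drop_seq j \<omega>) \<le> sup_walk \<omega>"
      unfolding eq unfolding sup_walk_def
      by (rule SUP_mono) (auto intro: exI[of _ "j + _"] simp: psum_add[symmetric])
  qed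
qed

lemma sup_walk_eq_0: "\<not> (\<exists>j. first_entry {0<..} j \<omega>) \<Longrightarrow> sup_walk \<omega> = 0"
  unfolding ex_first_entry_iff
  by (intro antisym sup_walk_nonneg) (auto simp: sup_walk_def not_less Suc_le_eq intro!: SUP_least, metis bot_nat_0.not_eq_extremum order_refl psum_0)

text \<open>The law of the supremum, infinity included, satisfies the compound geometric equation; that the supremum
is finite is then a consequence rather than a prerequisite.\<close>

theorem sup_walk_renewal:
  assumes f [measurable]: "f \<in> borel_measurable borel"
  shows "(\<integral>\<^sup>+\<omega>. f (sup_walk \<omega>) \<partial>Q) = ennreal (1 - measure (hit_law {0<..}) UNIV) * f 0 +
    (\<integral>\<^sup>+y. \<integral>\<^sup>+\<omega>. f (ereal y + sup_walk \<omega>) \<partial>Q \<partial>hit_law {0<..})"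
proof -
  let ?E = "\<lambda>\<omega>. \<exists>j. first_entry {0<..} j \<omega>"
  have pt: "f (sup_walk \<omega>) = f 0 * indicator {\<omega>. \<not> ?E \<omega>} \<omega> +
      (\<Sum>j. if first_entry {0<..} j \<omega> then f (ereal (psum j \<omega>) + sup_walk (drop_seq j \<omega>)) else 0)" for \<omega>
  proof (cases "?E \<omega>")
    case True
    then obtain j where j: "first_entry {0<..} j \<omega>" by blast
    show ?thesis using True unfolding suminf_first_entry[OF j] sup_walk_decompose[OF j] by auto
  next
    case False
    then show ?thesis by (simp add: sup_walk_eq_0)
  qed
  have "(\<integral>\<^sup>+\<omega>. f (sup_walk \<omega>) \<partial>Q) = (\<integral>\<^sup>+\<omega>. f 0 * indicator {\<omega>. \<not> ?E \<omega>} \<omega> \<partial>Q) +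
      (\<integral>\<^sup>+\<omega>. (\<Sum>j. if first_entry {0<..} j \<omega> then f (ereal (psum j \<omega>) + sup_walk (drop_seq j \<omega>)) else 0) \<partial>Q)"
  proof (subst nn_integral_add[symmetric])
    show "(\<lambda>\<omega>. f 0 * indicator {\<omega>. \<not> ?E \<omega>} \<omega>) \<in> borel_measurable Q"
      by (intro borel_measurable_times_ennreal borel_measurable_indicator sets_Q_Collect) measurable
  qed (measurable, simp only: pt[symmetric])
  also have "(\<integral>\<^sup>+\<omega>. f 0 * indicator {\<omega>. \<not> ?E \<omega>} \<omega> \<partial>Q) = f 0 * emeasure Q {\<omega>. \<not> ?E \<omega>}"
    by (rule nn_integral_cmult_indicator) (rule sets_Q_Collect, measurable)
  also have "emeasure Q {\<omega>. \<not> ?E \<omega>} = ennreal (1 - measure (hit_law {0<..}) UNIV)"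
  proof -
    have "{\<omega>. \<not> ?E \<omega>} = space Q - {\<omega>. ?E \<omega>}" by auto
    then have "measure Q {\<omega>. \<not> ?E \<omega>} = 1 - measure Q {\<omega>. ?E \<omega>}"
      using P.prob_compl[OF sets_Q_Collect, of ?E] by simp
    then show ?thesis by (simp add: P.emeasure_eq_measure measure_hit_law)
  qed
  also have "(\<integral>\<^sup>+\<omega>. (\<Sum>j. if first_entry {0<..} j \<omega> then f (ereal (psum j \<omega>) + sup_walk (drop_seq j \<omega>)) else 0) \<partial>Q) =
      (\<integral>\<^sup>+y. \<integral>\<^sup>+\<omega>. f (ereal y + sup_walk \<omega>) \<partial>Q \<partial>hit_law {0<..})"
    by (rule strong_markov) measurable
  finally show ?thesis by (simp add: mult.commute)
qed

text \<open>The renewal equation, tested on \<open>{\<infinity>\<close>}, reads \<open>q = p * q\<close> with \<open>p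
< 1\<close>.\<close>

theorem sup_walk_finite:
  assumes "measure (hit_law {0<..}) UNIV < 1"
  shows "AE \<omega> in Q. sup_walk \<omega> < \<infinity>"
proof -
  interpret H: finite_measure "hit_law {0<..}" by (rule finite_hit_law) simp
  let ?q = "(\<integral>\<^sup>+\<omega>. indicator {\<infinity>} (sup_walk \<omega>) \<partial>Q)"
  have q1: "?q \<le> 1"
    using nn_integral_mono[of Q "\<lambda>\<omega>. indicator {\<infinity>} (sup_walk \<omega>)" "\<lambda>_. 1"] P.emeasure_space_1
    by (auto simp: indicator_def)
  then obtain r where r: "?q = ennreal r" "0 \<le> r" using ennreal_cases by (metis ennreal_one_neq_top top.extremum_unique)
  have "?q = (\<integral>\<^sup>+y. \<integral>\<^sup>+\<omega>. indicator {\<infinity>} (ereal y + sup_walk \<omega>) \<partial>Q \<partial>hit_law {0<..})"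
    by (subst sup_walk_renewal) (simp_all add: indicator_def)
  also have "\<dots> = (\<integral>\<^sup>+y. ?q \<partial>hit_law {0<..})"
    by (intro nn_integral_cong) (auto simp: indicator_def)
  also have "\<dots> = ?q * ennreal (measure (hit_law {0<..}) UNIV)"
    by (simp add: H.emeasure_eq_measure)
  finally have "ennreal r = ennreal (r * measure (hit_law {0<..}) UNIV)"
    using r by (simp add: ennreal_mult)
  then have "r = r * measure (hit_law {0<..}) UNIV" using r by (subst (asm) ennreal_inj) auto
  then have "r = 0" using assms by simp
  then have "?q = 0" using r by simp
  then have "AE \<omega> in Q. indicator {\<infinity>} (sup_walk \<omega>) = (0 :: ennreal)"
    by (subst (asm) nn_integral_0_iff_AE) auto
  then show ?thesis by eventually_elim (auto simp: indicator_def split: if_splits)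
qed

definition sup_law :: "real measure" where
  "sup_law = distr Q borel (\<lambda>\<omega>. real_of_ereal (sup_walk \<omega>))"

lemma measure_sup_law:
  assumes "measure (hit_law {0<..}) UNIV < 1"
  shows "measure sup_law {x<..} = measure Q {\<omega>. ereal x < sup_walk \<omega>}"
proof -
  have "measure sup_law {x<..} = measure Q {\<omega>. x < real_of_ereal (sup_walk \<omega>)}"
    unfolding sup_law_def by (subst measure_distr) (auto simp: vimage_def)
  also have "\<dots> = measure Q {\<omega>. ereal x < sup_walk \<omega>}"
  proof (rule P.finite_measure_eq_AE)
    show "AE \<omega> in Q. \<omega> \<in> {\<omega>. x < real_of_ereal (sup_walk \<omega>)} \<longleftrightarrow> \<omega> \<in> {\<omega>. ereal x < sup_walk \<omega>}"
      using sup_walk_finite[OF assms]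
    proof eventually_elim
      case (elim \<omega>)
      then show ?case using sup_walk_nonneg[of \<omega>] by (cases "sup_walk \<omega>") auto
    qed
  qed (rule sets_Q_Collect; measurable)+
  finally show ?thesis .
qed

theorem compound_geometric_sup_law:
  assumes mass: "measure (hit_law {0<..}) UNIV < 1"
  shows "compound_geometric (hit_law {0<..}) sup_law"
proof (rule compound_geometric.intro)
  show "finite_measure (hit_law {0<..})" by (rule finite_hit_law) simp
  show "AE y in hit_law {0<..}. 0 \<le> y" using AE_hit_law[of "{0<..}"] by (auto elim!: eventually_mono)
  show "prob_space sup_law" unfolding sup_law_def by (rule P.prob_space_distr) measurable
  show "AE z in sup_law. 0 \<le> z"
    unfolding sup_law_def by (subst AE_distr_iff) (auto simp: sup_walk_nonneg real_of_ereal_pos)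
  fix f :: "real \<Rightarrow> ennreal" assume [measurable]: "f \<in> borel_measurable borel"
  have V: "(\<integral>\<^sup>+z. g z \<partial>sup_law) = (\<integral>\<^sup>+\<omega>. g (real_of_ereal (sup_walk \<omega>)) \<partial>Q)"
    if [measurable]: "g \<in> borel_measurable borel" for g :: "real \<Rightarrow> ennreal"
  proof -
    have m: "(\<lambda>\<omega>. real_of_ereal (sup_walk \<omega>)) \<in> borel_measurable Q" by measurable
    show ?thesis unfolding sup_law_def by (rule nn_integral_distr[OF m]) simp
  qed
  have "(\<integral>\<^sup>+z. f z \<partial>sup_law) = (\<integral>\<^sup>+\<omega>. f (real_of_ereal (sup_walk \<omega>)) \<partial>Q)" by (rule V) measurable
  also have "\<dots> = ennreal (1 - measure (hit_law {0<..}) UNIV) * f 0 +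
    (\<integral>\<^sup>+y. \<integral>\<^sup>+\<omega>. f (real_of_ereal (ereal y + sup_walk \<omega>)) \<partial>Q \<partial>hit_law {0<..})"
    by (subst sup_walk_renewal[of "\<lambda>z. f (real_of_ereal z)"]) simp_all
  also have "(\<integral>\<^sup>+y. \<integral>\<^sup>+\<omega>. f (real_of_ereal (ereal y + sup_walk \<omega>)) \<partial>Q \<partial>hit_law {0<..}) =
      (\<integral>\<^sup>+y. \<integral>\<^sup>+z. f (y + z) \<partial>sup_law \<partial>hit_law {0<..})"
  proof (rule nn_integral_cong)
    fix y
    have "(\<integral>\<^sup>+\<omega>. f (real_of_ereal (ereal y + sup_walk \<omega>)) \<partial>Q) = (\<integral>\<^sup>+\<omega>. f (y + real_of_ereal (sup_walk \<omega>)) \<partial>Q)"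
    proof (rule nn_integral_cong_AE)
      show "AE \<omega> in Q. f (real_of_ereal (ereal y + sup_walk \<omega>)) = f (y + real_of_ereal (sup_walk \<omega>))"
        using sup_walk_finite[OF mass]
      proof eventually_elim
        case (elim \<omega>)
        then show ?case using sup_walk_nonneg[of \<omega>] by (cases "sup_walk \<omega>") auto
      qed
    qed
    also have "\<dots> = (\<integral>\<^sup>+z. f (y + z) \<partial>sup_law)" by (rule V[symmetric]) measurable
    finally show "(\<integral>\<^sup>+\<omega>. f (real_of_ereal (ereal y + sup_walk \<omega>)) \<partial>Q) = (\<integral>\<^sup>+z. f (y + z) \<partial>sup_law)" .
  qed
  finally show "(\<integral>\<^sup>+z. f z \<partial>sup_law) = ennreal (1 - measure (hit_law {0<..}) UNIV) * f 0 +
    (\<integral>\<^sup>+y. \<integral>\<^sup>+z. f (y + z) \<partial>sup_law \<partial>hit_law {0<..})" .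
qed (simp_all add: sup_law_def mass)

end

lemma iid_seq_law:
  fixes X :: "nat \<Rightarrow> 'a \<Rightarrow> real"
  assumes "prob_space N" and indep: "prob_space.indep_vars N (\<lambda>_. borel) X UNIV"
    and law: "\<And>i. distr N borel (X i) = \<mu>"
  shows "distr N (\<Pi>\<^sub>M i\<in>UNIV. \<mu>) (\<lambda>x i. X i x) = (\<Pi>\<^sub>M i\<in>UNIV. \<mu>)"
proof -
  interpret prob_space N by fact
  have sets: "sets \<mu> = sets borel" by (simp flip: law[of 0])
  have rv: "random_variable borel (X i)" for i using indep by (auto simp: indep_vars_def)
  have "distr N (\<Pi>\<^sub>M i\<in>UNIV. borel) (\<lambda>x. \<lambda>i\<in>UNIV. X i x) = (\<Pi>\<^sub>M i\<in>UNIV. distr N borel (X i))"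
    using indep rv by (subst indep_vars_iff_distr_eq_PiM[symmetric]) auto
  moreover have "distr N (\<Pi>\<^sub>M i\<in>UNIV. borel) (\<lambda>x. \<lambda>i\<in>UNIV. X i x) = distr N (\<Pi>\<^sub>M i\<in>UNIV. \<mu>) (\<lambda>x i. X i x)"
    by (rule distr_cong) (auto intro!: sets_PiM_cong simp: sets restrict_def)
  ultimately show ?thesis by (simp add: law)
qed

lemma iid_walkI: "prob_space \<mu> \<Longrightarrow> sets \<mu> = sets borel \<Longrightarrow> iid_walk \<mu>"
  unfolding iid_walk_def iid_walk_axioms_def sequence_space_def product_prob_space_def
    product_sigma_finite_def product_prob_space_axioms_def
  by (auto intro: prob_space_imp_sigma_finite)

context iid_walk
begin

lemma indep_coords: "P.indep_vars (\<lambda>_. borel) (\<lambda>i \<omega>. \<omega> i) UNIV"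
proof (subst P.indep_vars_iff_distr_eq_PiM)
  have "distr Q (\<Pi>\<^sub>M i\<in>UNIV. borel) (\<lambda>\<omega>. \<lambda>i\<in>UNIV. \<omega> i) = distr Q Q (\<lambda>\<omega>. \<omega>)"
    by (rule distr_cong) (auto intro!: sets_PiM_cong simp: sets_mu restrict_def)
  then show "distr Q (\<Pi>\<^sub>M i\<in>UNIV. borel) (\<lambda>\<omega>. \<lambda>i\<in>UNIV. \<omega> i) = (\<Pi>\<^sub>M i\<in>UNIV. distr Q borel (\<lambda>\<omega>. \<omega> i))"
    by (simp add: distr_coord)
qed auto

text \<open>If \<open>\<epsilon>\<close> is so small that \<open>X\<^sub>1 + \<epsilon>\<close> has negative mean,
then the walk with increments \<open>X\<^sub>i + \<epsilon>\<close> is bounded above, whence \<open>S\<^sub>n \<le> r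
- n * \<epsilon>\<close>.\<close>

theorem desc_hit:
  assumes int: "integrable \<mu> (\<lambda>x. x)" and mean: "(LINT x|\<mu>. x) < 0"
  shows "AE \<omega> in Q. \<exists>j. first_entry {..0} j \<omega>"
proof -
  define \<epsilon> where "\<epsilon> = - (LINT x|\<mu>. x) / 2"
  have \<epsilon>: "0 < \<epsilon>" using mean by (simp add: \<epsilon>_def)
  define \<mu>' where "\<mu>' = distr \<mu> borel (\<lambda>x. x + \<epsilon>)"
  have add: "(\<lambda>x. x + \<epsilon>) \<in> measurable \<mu> borel"
    unfolding measurable_cong_sets[OF sets_mu refl] by (intro borel_measurable_add) auto
  have prob': "prob_space \<mu>'" unfolding \<mu>'_def by (rule M.prob_space_distr[OF add])
  have sets': "sets \<mu>' = sets borel" unfolding \<mu>'_def by (rule sets_distr)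
  interpret W: iid_walk \<mu>' by (rule iid_walkI[OF prob' sets'])
  have add_int: "integrable \<mu> (\<lambda>x. x + \<epsilon>)"
    by (intro Bochner_Integration.integrable_add int M.integrable_const)
  have int': "integrable \<mu>' (\<lambda>x. x)"
    unfolding \<mu>'_def by (rule integrable_distr_eq[OF add, THEN iffD2]) (rule measurable_ident_sets[OF refl], rule add_int)
  have "(LINT x|\<mu>'. x) = (LINT x|\<mu>. x + \<epsilon>)"
    unfolding \<mu>'_def by (rule integral_distr[OF add]) (rule measurable_ident_sets[OF refl])
  also have "\<dots> = (LINT x|\<mu>. x) + \<epsilon>"
    by (subst Bochner_Integration.integral_add[OF int M.integrable_const]) (simp add: M.prob_space[simplified])
  also have "\<dots> < 0" using mean by (simp add: \<epsilon>_def)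
  finally have mean': "(LINT x|\<mu>'. x) < 0" .
  have law: "distr Q W.Q (\<lambda>\<omega> i. \<omega> i + \<epsilon>) = W.Q"
  proof (rule iid_seq_law)
    show "prob_space Q" by (rule P.prob_space_axioms)
    show "P.indep_vars (\<lambda>_. borel) (\<lambda>i \<omega>. \<omega> i + \<epsilon>) UNIV"
      using P.indep_vars_compose2[OF indep_coords, of "\<lambda>_ x. x + \<epsilon>" "\<lambda>_. borel"] by simp
    have "\<mu>' = distr (distr Q borel (\<lambda>\<omega>. \<omega> i)) borel (\<lambda>x. x + \<epsilon>)" for i by (simp add: \<mu>'_def distr_coord)
    then show "distr Q borel (\<lambda>\<omega>. \<omega> i + \<epsilon>) = \<mu>'" for i by (simp add: distr_distr comp_def)
  qed
  have meas: "(\<lambda>\<omega> i. \<omega> i + \<epsilon>) \<in> measurable Q W.Q"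
    by (rule measurable_PiM_single') (auto simp: measurable_cong_sets[OF refl W.sets_mu])
  have "AE \<omega> in W.Q. W.sup_walk \<omega> < \<infinity>"
    by (rule W.sup_walk_finite[OF W.asc_mass_less_1[OF int' mean']])
  then have "AE \<omega> in distr Q W.Q (\<lambda>\<omega> i. \<omega> i + \<epsilon>). W.sup_walk \<omega> < \<infinity>" by (simp only: law)
  then have "AE \<omega> in Q. W.sup_walk (\<lambda>i. \<omega> i + \<epsilon>) < \<infinity>"
    by (rule AE_distrD[OF meas])
  then show ?thesis
  proof eventually_elim
    case (elim \<omega>)
    then obtain r where r: "W.sup_walk (\<lambda>i. \<omega> i + \<epsilon>) = ereal r"
      using W.sup_walk_nonneg[of "\<lambda>i. \<omega> i + \<epsilon>"] by (cases "W.sup_walk (\<lambda>i. \<omega> i + \<epsilon>)") auto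
    have le: "psum n (\<lambda>i. \<omega> i + \<epsilon>) \<le> r" for n
      using W.sup_walk_greater_iff[of r "\<lambda>i. \<omega> i + \<epsilon>"] unfolding r by (simp add: not_less)
    have eq: "psum n (\<lambda>i. \<omega> i + \<epsilon>) = psum n \<omega> + real n * \<epsilon>" for n
      by (simp add: psum_def sum.distrib)
    obtain n where n: "r < real n * \<epsilon>" using \<epsilon> reals_Archimedean3 by blast
    have "psum (Suc n) \<omega> \<le> 0" using le[of "Suc n"] n \<epsilon> unfolding eq by (simp add: algebra_simps)
    then show ?case unfolding ex_first_entry_iff by (intro exI[of _ "Suc n"]) auto
  qed
qed

end

section \<open>Wiener--Hopf factorization\<close>

text \<open>Later increments stay in place, so this is a permutation of coordinates on the whole sequence
space.\<close>

definition rev_seq :: "nat \<Rightarrow> (nat \<Rightarrow> real) \<Rightarrow> nat \<Rightarrow> real" where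
  "rev_seq j \<omega> i = \<omega> (if i < j then j - 1 - i else i)"

text \<open>The time reversal of the event that \<open>j\<close> is the first strict ascending ladder epoch: the walk
ends at a positive level that no earlier \<open>S\<^sub>i\<close>, \<open>i \<ge> 1\<close>, undercuts.\<close>

definition low_record :: "nat \<Rightarrow> (nat \<Rightarrow> real) \<Rightarrow> bool" where
  "low_record j \<omega> \<longleftrightarrow> 1 \<le> j \<and> 0 < psum j \<omega> \<and> (\<forall>i\<in>{1..<j}. psum j \<omega> \<le> psum i \<omega>)"

lemma psum_rev_seq: "i \<le> j \<Longrightarrow> psum i (rev_seq j \<omega>) = psum j \<omega> - psum (j - i) \<omega>"
proof (induction i)
  case (Suc i)
  have "psum (j - i) \<omega> = psum (j - Suc i) \<omega> + \<omega> (j - Suc i)"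
    using Suc.prems psum_Suc[of "j - Suc i" \<omega>] by (simp add: Suc_diff_Suc)
  then show ?case using Suc by (simp add: psum_Suc rev_seq_def)
qed simp

lemma first_entry_rev_seq: "first_entry {0<..} j (rev_seq j \<omega>) \<longleftrightarrow> low_record j \<omega>"
proof -
  have "(\<forall>i\<in>{1..<j}. psum i (rev_seq j \<omega>) \<notin> {0<..}) \<longleftrightarrow> (\<forall>i\<in>{1..<j}. psum j \<omega> \<le> psum (j - i) \<omega>)"
    by (intro ball_cong) (auto simp: psum_rev_seq)
  also have "\<dots> \<longleftrightarrow> (\<forall>i\<in>{1..<j}. psum j \<omega> \<le> psum i \<omega>)"
  proof
    assume L: "\<forall>i\<in>{1..<j}. psum j \<omega> \<le> psum (j - i) \<omega>"
    show "\<forall>i\<in>{1..<j}. psum j \<omega> \<le> psum i \<omega>"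
    proof
      fix i assume i: "i \<in> {1..<j}"
      then have "j - i \<in> {1..<j}" "j - (j - i) = i" by auto
      then show "psum j \<omega> \<le> psum i \<omega>" using L by metis
    qed
  qed auto
  finally show ?thesis by (auto simp: first_entry_def low_record_def psum_rev_seq)
qed

text \<open>At the later of two such times the walk would be both above and not above its position at the earlier
one.\<close>

lemma record_split_unique:
  assumes "low_record j \<omega>" "first_entry {..0} (n - j) (drop_seq j \<omega>)" "j < n"
    and "low_record k \<omega>" "first_entry {..0} (n - k) (drop_seq k \<omega>)" "k < n"
  shows "j = k"
proof -
  have False if "i < l" "l < n" "low_record l \<omega>" "first_entry {..0} (n - i) (drop_seq i \<omega>)" "low_record i \<omega>" for i l
  proof -
    have "0 < psum (l - i) (drop_seq i \<omega>)"
      using that by (auto simp: first_entry_def not_le dest: bspec[of _ _ "l - i"])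
    then have "psum i \<omega> < psum l \<omega>" using psum_add[of i "l - i" \<omega>] that by simp
    moreover have "psum l \<omega> \<le> psum i \<omega>" using that by (auto simp: low_record_def)
    ultimately show False by simp
  qed
  then show ?thesis using assms by (metis linorder_neqE_nat)
qed

text \<open>The cut is at the last argmin of \<open>S\<^sub>1, \<dots>, S\<^sub>n\<^sub>-\<^sub>1\<close>: up to there
the path is again of the type \<open>low_record\<close>, and from there on it first returns to a lower or equal level
at time \<open>n\<close>.\<close>

lemma record_split_exists:
  assumes "2 \<le> n" "low_record n \<omega>"
  shows "\<exists>j<n. low_record j \<omega> \<and> first_entry {..0} (n - j) (drop_seq j \<omega>)"
proof -
  define m where "m = Min ((\<lambda>i. psum i \<omega>) ` {1..<n})"
  define j where "j = Max {i \<in> {1..<n}. psum i \<omega> = m}"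
  have ne: "{1..<n} \<noteq> {}" using assms by auto
  have "m \<in> (\<lambda>i. psum i \<omega>) ` {1..<n}" unfolding m_def using ne by (intro Min_in) auto
  then have "j \<in> {i \<in> {1..<n}. psum i \<omega> = m}" unfolding j_def by (intro Max_in) auto
  then have j: "1 \<le> j" "j < n" "psum j \<omega> = m" by auto
  have ge: "m \<le> psum i \<omega>" if "i \<in> {1..<n}" for i unfolding m_def using that by (intro Min_le) auto
  have gt: "m < psum i \<omega>" if "j < i" "i < n" for i
  proof -
    have "psum i \<omega> \<noteq> m"
    proof
      assume "psum i \<omega> = m"
      then have "i \<le> j" unfolding j_def using that j by (intro Max_ge) auto
      then show False using that by simp
    qed
    then show ?thesis using ge[of i] that j by simp
  qed
  have n: "0 < psum n \<omega>" "psum n \<omega> \<le> m" using assms(2) j by (auto simp: low_record_def)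
  have shift: "psum i (drop_seq j \<omega>) = psum (j + i) \<omega> - m" for i using psum_add[of j i \<omega>] j by simp
  have "low_record j \<omega>" using j n ge by (auto simp: low_record_def)
  moreover have "first_entry {..0} (n - j) (drop_seq j \<omega>)"
    using j n gt by (auto simp: first_entry_def shift not_le)
  ultimately show ?thesis using j by blast
qed

lemma record_join:
  assumes "low_record j \<omega>" "first_entry {..0} k (drop_seq j \<omega>)" "0 < psum (j + k) \<omega>"
  shows "low_record (j + k) \<omega>"
proof -
  have le: "psum (j + k) \<omega> \<le> psum j \<omega>" using assms(2) psum_add[of j k \<omega>] by (auto simp: first_entry_def)
  have "psum (j + k) \<omega> \<le> psum i \<omega>" if i: "i \<in> {1..<j + k}" for i
  proof -
    consider "i < j" | "i = j" | "j < i" by linarith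
    then show ?thesis
    proof cases
      case 1
      then have "psum j \<omega> \<le> psum i \<omega>" using assms(1) i by (auto simp: low_record_def)
      then show ?thesis using le by simp
    next
      case 3
      then have "0 < psum (i - j) (drop_seq j \<omega>)"
        using assms(2) i by (auto simp: first_entry_def not_le dest: bspec[of _ _ "i - j"])
      then show ?thesis using le 3 psum_add[of j "i - j" \<omega>] by simp
    qed (use le in simp)
  qed
  then show ?thesis using assms by (auto simp: low_record_def)
qed

lemma suminf_ennreal_shift:
  fixes b :: "nat \<Rightarrow> ennreal"
  shows "(\<Sum>n. if j \<le> n then b (n - j) else 0) = (\<Sum>k. b k)"
proof -
  let ?f = "\<lambda>n. if j \<le> n then b (n - j) else 0"
  have "(\<lambda>N. sum ?f {..<N + j}) \<longlonglongrightarrow> suminf ?f"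
    by (rule LIMSEQ_ignore_initial_segment) (rule summable_LIMSEQ[OF summableI])
  moreover have "sum ?f {..<N + j} = sum b {..<N}" for N
  proof (induction N)
    case 0
    have "sum ?f {..<0 + j} = 0" by (intro sum.neutral) auto
    then show ?case by simp
  qed simp
  ultimately have "(\<lambda>N. sum b {..<N}) \<longlonglongrightarrow> suminf ?f" by simp
  then show ?thesis using LIMSEQ_unique summable_LIMSEQ[OF summableI, of b] by blast
qed

lemma suminf_ennreal_swap:
  fixes a :: "nat \<Rightarrow> nat \<Rightarrow> ennreal"
  shows "(\<Sum>n. \<Sum>j. a n j) = (\<Sum>j. \<Sum>n. a n j)"
proof -
  have "(\<Sum>n. \<Sum>j. a n j) = (\<integral>\<^sup>+n. (\<Sum>j. a n j) \<partial>count_space UNIV)" by (simp add: nn_integral_count_space_nat)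
  also have "\<dots> = (\<Sum>j. \<integral>\<^sup>+n. a n j \<partial>count_space UNIV)" by (rule nn_integral_suminf) simp
  finally show ?thesis by (simp add: nn_integral_count_space_nat)
qed

lemma suminf_ennreal_triangle:
  fixes a :: "nat \<Rightarrow> nat \<Rightarrow> ennreal"
  shows "(\<Sum>n. \<Sum>j. if j \<le> n then a j (n - j) else 0) = (\<Sum>j. \<Sum>k. a j k)"
  by (subst suminf_ennreal_swap) (simp add: suminf_ennreal_shift)

text \<open>Every path of the type \<open>low_record\<close> is a single step, or splits in exactly one way into a
shorter path of that type followed by a first descent. This is the combinatorial content of the Wiener--Hopf
factorization on the positive half line.\<close>

lemma record_decomposition:
  assumes x: "0 \<le> x"
  shows "(\<Sum>n. if low_record n \<omega> \<and> x < psum n \<omega> then 1 else 0) = (if x < psum 1 \<omega> then 1 else 0 :: ennreal) +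
    (\<Sum>j. \<Sum>k. if low_record j \<omega> \<and> first_entry {..0} k (drop_seq j \<omega>) \<and> x < psum (j + k) \<omega> then 1 else 0)"
proof -
  define W :: "nat \<Rightarrow> ennreal" where "W n = (if low_record n \<omega> \<and> x < psum n \<omega> then 1 else 0)" for n
  define a :: "nat \<Rightarrow> nat \<Rightarrow> ennreal" where
    "a j k = (if low_record j \<omega> \<and> first_entry {..0} k (drop_seq j \<omega>) \<and> x < psum (j + k) \<omega> then 1 else 0)" for j k
  define f :: "nat \<Rightarrow> ennreal" where "f n = (if n = 1 \<and> x < psum 1 \<omega> then 1 else 0)" for n
  have "W n = f n + (\<Sum>j. if j \<le> n then a j (n - j) else 0)" for n
  proof (cases "\<exists>j<n. low_record j \<omega> \<and> first_entry {..0} (n - j) (drop_seq j \<omega>)")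
    case True
    then obtain j where j: "j < n" "low_record j \<omega>" "first_entry {..0} (n - j) (drop_seq j \<omega>)" by blast
    have eq: "(if i \<le> n then a i (n - i) else 0) = (if i = j then if x < psum n \<omega> then 1 else 0 else 0)" for i
    proof (cases "i = j")
      case False
      have "a i (n - i) = 0" if "i \<le> n"
      proof (cases "i = n")
        case True
        then show ?thesis by (simp add: a_def first_entry_def)
      next
        case neq: False
        then show ?thesis using False that j record_split_unique[of i \<omega> n j] by (auto simp: a_def)
      qed
      then show ?thesis using False by simp
    qed (use j in \<open>simp add: a_def\<close>)
    have "(\<Sum>i. if i \<le> n then a i (n - i) else 0) = (if x < psum n \<omega> then 1 else 0)"
      unfolding eq using suminf_finite[of "{j}" "\<lambda>i. if i = j then if x < psum n \<omega> then 1 else (0 :: ennreal) else 0"] by simp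
    moreover have "f n = 0" using j by (auto simp: f_def low_record_def)
    moreover have "low_record n \<omega>" if "x < psum n \<omega>" using record_join[OF j(2,3)] j(1) that x by simp
    ultimately show ?thesis by (auto simp: W_def)
  next
    case False
    then have eq: "(if i \<le> n then a i (n - i) else 0) = 0" for i
      by (cases "i = n") (auto simp: a_def first_entry_def)
    have "\<not> 2 \<le> n" if "low_record n \<omega>" using record_split_exists that False by blast
    moreover consider "n = 0" | "n = 1" | "2 \<le> n" by linarith
    ultimately have "W n = f n" using x by cases (auto simp: W_def f_def low_record_def)
    then show ?thesis unfolding eq by simp
  qed
  then have "(\<Sum>n. W n) = (\<Sum>n. f n) + (\<Sum>n. \<Sum>j. if j \<le> n then a j (n - j) else 0)"
    by (simp add: suminf_add)
  also have "(\<Sum>n. f n) = (if x < psum 1 \<omega> then 1 else 0)"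
  proof -
    have "suminf f = sum f {1}" by (rule suminf_finite) (auto simp: f_def)
    then show ?thesis by (simp add: f_def[of 1] f_def[of "Suc 0"])
  qed
  also have "(\<Sum>n. \<Sum>j. if j \<le> n then a j (n - j) else 0) = (\<Sum>j. \<Sum>k. a j k)"
    by (rule suminf_ennreal_triangle)
  finally show ?thesis by (simp only: W_def a_def)
qed

context iid_walk
begin

lemma record_measurable [measurable (raw)]:
  assumes f [measurable]: "f \<in> measurable N Q"
  shows "Measurable.pred N (\<lambda>x. low_record j (f x))"
  unfolding low_record_def by measurable

text \<open>The duality principle: reversing the increments preserves the product measure.\<close>

lemma nn_integral_record:
  assumes G [measurable]: "G \<in> borel_measurable borel"
  shows "(\<integral>\<^sup>+\<omega>. (if low_record j \<omega> then G (psum j \<omega>) else 0) \<partial>Q) =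
    (\<integral>\<^sup>+\<omega>. (if first_entry {0<..} j \<omega> then G (psum j \<omega>) else 0) \<partial>Q)"
proof -
  have inj: "inj (\<lambda>i. if i < j then j - 1 - i else i)" by (rule injI) (auto split: if_splits)
  have D: "distr Q Q (rev_seq j) = Q" using distr_reindex[OF inj] by (simp add: rev_seq_def[abs_def])
  have [measurable]: "rev_seq j \<in> measurable Q Q"
  proof (rule measurable_PiM_single')
    show "(\<lambda>\<omega>. rev_seq j \<omega> i) \<in> measurable Q \<mu>" for i unfolding rev_seq_def by measurable
  qed auto
  have "(\<integral>\<^sup>+\<omega>. (if first_entry {0<..} j \<omega> then G (psum j \<omega>) else 0) \<partial>Q) =
      (\<integral>\<^sup>+\<omega>. (if first_entry {0<..} j \<omega> then G (psum j \<omega>) else 0) \<partial>distr Q Q (rev_seq j))"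
    by (simp only: D)
  also have "\<dots> = (\<integral>\<^sup>+\<omega>. (if first_entry {0<..} j (rev_seq j \<omega>) then G (psum j (rev_seq j \<omega>)) else 0) \<partial>Q)"
    by (rule nn_integral_distr) measurable
  finally show ?thesis by (simp add: first_entry_rev_seq psum_rev_seq cong: if_cong)
qed

text \<open>By duality, \<open>low_record\<close> and the first ascending ladder epoch give the position the same law,
so the unique splitting of such paths turns into \<open>F\<^sub>+ = F + F\<^sub>+ * F\<^sub>-\<close> on the positive
half line.\<close>

theorem wiener_hopf:
  assumes x: "0 \<le> x"
  shows "emeasure (hit_law {0<..}) {x<..} = emeasure \<mu> {x<..} +
    (\<integral>\<^sup>+y. \<integral>\<^sup>+z. indicator {x<..} (y + z) \<partial>hit_law {..0} \<partial>hit_law {0<..})"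
proof -
  interpret D: finite_measure "hit_law {..0}" by (rule finite_hit_law) simp
  define H :: "real \<Rightarrow> ennreal" where "H y = (\<integral>\<^sup>+z. indicator {x<..} (y + z) \<partial>hit_law {..0})" for y
  have [measurable]: "H \<in> borel_measurable borel" unfolding H_def by measurable
  have "emeasure (hit_law {0<..}) {x<..} = (\<integral>\<^sup>+y. indicator {x<..} y \<partial>hit_law {0<..})" by simp
  also have "\<dots> = (\<integral>\<^sup>+\<omega>. (\<Sum>n. if first_entry {0<..} n \<omega> then indicator {x<..} (psum n \<omega>) else 0) \<partial>Q)"
    by (rule nn_integral_hit_law) measurable
  also have "\<dots> = (\<Sum>n. \<integral>\<^sup>+\<omega>. (if first_entry {0<..} n \<omega> then indicator {x<..} (psum n \<omega>) else 0) \<partial>Q)"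
    by (rule nn_integral_suminf) measurable
  also have "\<dots> = (\<Sum>n. \<integral>\<^sup>+\<omega>. (if low_record n \<omega> then indicator {x<..} (psum n \<omega>) else 0) \<partial>Q)"
    by (subst nn_integral_record) simp_all
  also have "\<dots> = (\<integral>\<^sup>+\<omega>. (\<Sum>n. if low_record n \<omega> then indicator {x<..} (psum n \<omega>) else 0) \<partial>Q)"
    by (rule nn_integral_suminf[symmetric]) measurable
  also have "\<dots> = (\<integral>\<^sup>+\<omega>. (\<Sum>n. if low_record n \<omega> \<and> x < psum n \<omega> then 1 else 0) \<partial>Q)"
    by (intro nn_integral_cong arg_cong[where f = suminf] ext) (simp add: indicator_def)
  also have "\<dots> = (\<integral>\<^sup>+\<omega>. (if x < psum 1 \<omega> then 1 else 0) +
      (\<Sum>j. \<Sum>k. if low_record j \<omega> \<and> first_entry {..0} k (drop_seq j \<omega>) \<and> x < psum (j + k) \<omega> then 1 else 0) \<partial>Q)"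
    by (intro nn_integral_cong record_decomposition x)
  also have "\<dots> = (\<integral>\<^sup>+\<omega>. (if x < psum 1 \<omega> then 1 else 0) \<partial>Q) +
      (\<integral>\<^sup>+\<omega>. (\<Sum>j. \<Sum>k. if low_record j \<omega> \<and> first_entry {..0} k (drop_seq j \<omega>) \<and> x < psum (j + k) \<omega> then 1 else 0) \<partial>Q)"
    by (rule nn_integral_add) measurable
  also have "(\<integral>\<^sup>+\<omega>. (if x < psum 1 \<omega> then 1 else 0) \<partial>Q) = emeasure \<mu> {x<..}"
  proof -
    have "(\<integral>\<^sup>+\<omega>. (if x < psum 1 \<omega> then 1 else 0) \<partial>Q) = (\<integral>\<^sup>+\<omega>. indicator {x<..} (\<omega> 0) \<partial>Q)"
      by (intro nn_integral_cong) (simp add: psum_def indicator_def)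
    also have "\<dots> = (\<integral>\<^sup>+y. indicator {x<..} y \<partial>distr Q borel (\<lambda>\<omega>. \<omega> 0))"
      by (rule nn_integral_distr[symmetric]) auto
    finally show ?thesis by (simp add: distr_coord sets_mu)
  qed
  also have "(\<integral>\<^sup>+\<omega>. (\<Sum>j. \<Sum>k. if low_record j \<omega> \<and> first_entry {..0} k (drop_seq j \<omega>) \<and> x < psum (j + k) \<omega> then 1 else 0) \<partial>Q) =
      (\<Sum>j. \<integral>\<^sup>+\<omega>. (\<Sum>k. if low_record j \<omega> \<and> first_entry {..0} k (drop_seq j \<omega>) \<and> x < psum (j + k) \<omega> then 1 else 0) \<partial>Q)"
    by (rule nn_integral_suminf) measurable
  also have "\<dots> = (\<Sum>j. \<integral>\<^sup>+\<omega>. (if low_record j \<omega> then H (psum j \<omega>) else 0) \<partial>Q)"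
  proof (rule arg_cong[where f = suminf], rule ext)
    fix j
    have "(\<integral>\<^sup>+\<omega>. (\<Sum>k. if low_record j \<omega> \<and> first_entry {..0} k (drop_seq j \<omega>) \<and> x < psum (j + k) \<omega> then 1 else 0) \<partial>Q) =
        (\<integral>\<^sup>+\<omega>. \<integral>\<^sup>+\<omega>'. (\<Sum>k. if low_record j \<omega> \<and> first_entry {..0} k \<omega>' \<and> x < psum j \<omega> + psum k \<omega>' then 1 else 0) \<partial>Q \<partial>Q)"
    proof (subst nn_integral_comb_seq[where j = j])
      have "low_record j (comb_seq j \<omega> \<omega>') = low_record j \<omega>" for \<omega> \<omega>'
        by (auto simp: low_record_def psum_comb_seq)
      then show "(\<integral>\<^sup>+\<omega>. \<integral>\<^sup>+\<omega>'. (\<Sum>k. if low_record j (comb_seq j \<omega> \<omega>') \<and> first_entry {..0} k (drop_seq j (comb_seq j \<omega> \<omega>')) \<and>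
          x < psum (j + k) (comb_seq j \<omega> \<omega>') then 1 else 0) \<partial>Q \<partial>Q) =
        (\<integral>\<^sup>+\<omega>. \<integral>\<^sup>+\<omega>'. (\<Sum>k. if low_record j \<omega> \<and> first_entry {..0} k \<omega>' \<and> x < psum j \<omega> + psum k \<omega>' then 1 else 0) \<partial>Q \<partial>Q)"
        by (simp add: psum_add drop_comb_seq psum_comb_seq)
    qed measurable
    also have "\<dots> = (\<integral>\<^sup>+\<omega>. (if low_record j \<omega> then H (psum j \<omega>) else 0) \<partial>Q)"
    proof (rule nn_integral_cong)
      fix \<omega>
      have "H (psum j \<omega>) = (\<integral>\<^sup>+\<omega>'. (\<Sum>k. if first_entry {..0} k \<omega>' then indicator {x<..} (psum j \<omega> + psum k \<omega>') else 0) \<partial>Q)"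
        unfolding H_def by (rule nn_integral_hit_law) measurable
      also have "\<dots> = (\<integral>\<^sup>+\<omega>'. (\<Sum>k. if first_entry {..0} k \<omega>' \<and> x < psum j \<omega> + psum k \<omega>' then 1 else 0) \<partial>Q)"
        by (intro nn_integral_cong arg_cong[where f = suminf] ext) (simp add: indicator_def)
      finally show "(\<integral>\<^sup>+\<omega>'. (\<Sum>k. if low_record j \<omega> \<and> first_entry {..0} k \<omega>' \<and> x < psum j \<omega> + psum k \<omega>' then 1 else 0) \<partial>Q) =
          (if low_record j \<omega> then H (psum j \<omega>) else 0)" by simp
    qed
    finally show "(\<integral>\<^sup>+\<omega>. (\<Sum>k. if low_record j \<omega> \<and> first_entry {..0} k (drop_seq j \<omega>) \<and> x < psum (j + k) \<omega> then 1 else 0) \<partial>Q) = \<dots>" .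
  qed
  also have "\<dots> = (\<Sum>j. \<integral>\<^sup>+\<omega>. (if first_entry {0<..} j \<omega> then H (psum j \<omega>) else 0) \<partial>Q)"
    by (subst nn_integral_record) simp_all
  also have "\<dots> = (\<integral>\<^sup>+\<omega>. (\<Sum>j. if first_entry {0<..} j \<omega> then H (psum j \<omega>) else 0) \<partial>Q)"
    by (rule nn_integral_suminf[symmetric]) measurable
  also have "\<dots> = (\<integral>\<^sup>+y. H y \<partial>hit_law {0<..})"
    by (rule nn_integral_hit_law[symmetric]) measurable
  finally show ?thesis unfolding H_def .
qed

end

context iid_walk
begin

theorem wiener_hopf_tail:
  assumes x: "0 \<le> x"
  shows "measure (hit_law {0<..}) {x<..} = measure \<mu> {x<..} + (LINT z|hit_law {..0}. measure (hit_law {0<..}) {x - z<..})"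
proof -
  interpret U: finite_measure "hit_law {0<..}" by (rule finite_hit_law) simp
  interpret D: finite_measure "hit_law {..0}" by (rule finite_hit_law) simp
  interpret P: pair_sigma_finite "hit_law {0<..}" "hit_law {..0}" ..
  have tail: "(\<lambda>x. measure (hit_law {0<..}) {x<..}) \<in> borel_measurable borel"
    by (rule borel_measurable_tail[OF U.finite_measure_axioms]) simp
  have [measurable]: "(\<lambda>z. measure (hit_law {0<..}) {x - z<..}) \<in> borel_measurable borel"
    by (rule measurable_compose[OF _ tail, of "\<lambda>z. x - z" borel]) auto
  have "(\<lambda>z. measure (hit_law {0<..}) {x - z<..}) \<in> borel_measurable (hit_law {..0})"
    by (simp add: measurable_cong_sets[OF sets_hit_law refl])
  note [simp] = this
  have "(\<integral>\<^sup>+y. \<integral>\<^sup>+z. indicator {x<..} (y + z) \<partial>hit_law {..0} \<partial>hit_law {0<..}) =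
      (\<integral>\<^sup>+z. \<integral>\<^sup>+y. indicator {x<..} (y + z) \<partial>hit_law {0<..} \<partial>hit_law {..0})"
    by (rule P.Fubini'[symmetric]) measurable
  also have "\<dots> = (\<integral>\<^sup>+z. \<integral>\<^sup>+y. indicator {x - z<..} y \<partial>hit_law {0<..} \<partial>hit_law {..0})"
    by (intro nn_integral_cong) (auto simp: indicator_def)
  also have "\<dots> = (\<integral>\<^sup>+z. ennreal (measure (hit_law {0<..}) {x - z<..}) \<partial>hit_law {..0})"
    by (intro nn_integral_cong) (simp add: U.emeasure_eq_measure)
  also have "\<dots> = ennreal (LINT z|hit_law {..0}. measure (hit_law {0<..}) {x - z<..})"
    using U.bounded_measure
    by (intro nn_integral_eq_integral D.integrable_const_bound[of _ "measure (hit_law {0<..}) UNIV"]) (auto intro!: AE_I2)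
  finally have "ennreal (measure (hit_law {0<..}) {x<..}) =
      ennreal (measure \<mu> {x<..} + (LINT z|hit_law {..0}. measure (hit_law {0<..}) {x - z<..}))"
    using wiener_hopf[OF x] by (simp add: U.emeasure_eq_measure M.emeasure_eq_measure integral_nonneg_AE flip: ennreal_plus)
  then show ?thesis by (subst (asm) ennreal_inj) (auto intro!: add_nonneg_nonneg integral_nonneg_AE)
qed

lemma prob_space_desc:
  assumes "integrable \<mu> (\<lambda>x. x)" "(LINT x|\<mu>. x) < 0"
  shows "prob_space (hit_law {..0})"
proof (rule prob_spaceI)
  have "measure Q {\<omega>. \<exists>j. first_entry {..0} j \<omega>} = 1"
    using desc_hit[OF assms] P.prob_eq_1[OF sets_Q_Collect, of "\<lambda>\<omega>. \<exists>j. first_entry {..0} j \<omega>"] by simp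
  then show "emeasure (hit_law {..0}) (space (hit_law {..0})) = 1"
    by (simp add: emeasure_hit_law P.emeasure_eq_measure)
qed

lemma desc_charges_negative:
  assumes "integrable \<mu> (\<lambda>x. x)" "(LINT x|\<mu>. x) < 0"
  shows "0 < measure (hit_law {..0}) {..<0}"
proof -
  interpret D: finite_measure "hit_law {..0}" by (rule finite_hit_law) simp
  have "0 < measure \<mu> {..<0}"
  proof (rule ccontr)
    assume "\<not> 0 < measure \<mu> {..<0}"
    then have "measure \<mu> {..<0} = 0" by (simp add: not_less antisym)
    then have "{..<0} \<in> null_sets \<mu>" by (intro null_setsI) (auto simp: M.emeasure_eq_measure sets_mu)
    then have "AE x in \<mu>. x \<notin> {..<0}" by (rule AE_not_in)
    then have "0 \<le> (LINT x|\<mu>. x)" by (intro integral_nonneg_AE) (auto simp: not_less elim!: eventually_mono)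
    then show False using assms by simp
  qed
  also have "measure \<mu> {..<0} = measure Q {\<omega>. \<omega> 0 < 0}"
    using distr_coord[of 0] measure_distr[OF coord_measurable[of 0], of "{..<0}"] by (simp add: vimage_def)
  also have "\<dots> \<le> measure Q {\<omega>. \<exists>j. first_entry {..0} j \<omega> \<and> psum j \<omega> \<in> {..<0}}"
  proof (rule P.finite_measure_mono)
    show "{\<omega>. \<omega> 0 < 0} \<subseteq> {\<omega>. \<exists>j. first_entry {..0} j \<omega> \<and> psum j \<omega> \<in> {..<0}}"
      by (auto intro!: exI[of _ 1] simp: first_entry_def psum_def)
  qed (rule sets_Q_Collect, measurable)
  also have "\<dots> = measure (hit_law {..0}) {..<0}" by (subst measure_hit_law) auto
  finally show ?thesis .
qed

lemma desc_charges_below: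
  assumes "integrable \<mu> (\<lambda>x. x)" "(LINT x|\<mu>. x) < 0"
  shows "\<exists>\<delta>>0. 0 < measure (hit_law {..0}) {..- \<delta>}"
proof (rule ccontr)
  interpret D: finite_measure "hit_law {..0}" by (rule finite_hit_law) simp
  assume "\<not> ?thesis"
  then have zero: "measure (hit_law {..0}) {..- \<delta>} = 0" if "0 < \<delta>" for \<delta>
    using that by (metis measure_nonneg not_less order.antisym)
  have "emeasure (hit_law {..0}) (\<Union>n. {..- inverse (real (Suc n))}) = 0"
    by (rule emeasure_UN_eq_0) (auto simp: D.emeasure_eq_measure zero)
  moreover have "(\<Union>n. {..- inverse (real (Suc n))}) = {..<0}"
  proof safe
    fix n :: nat and x :: real assume "x \<le> - inverse (real (Suc n))"
    moreover have "0 < inverse (real (Suc n))" by simp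
    ultimately show "x < 0" by linarith
  next
    fix x :: real assume "x < 0"
    then obtain n where "inverse (real (Suc n)) < - x" using reals_Archimedean[of "- x"] by auto
    then show "x \<in> (\<Union>n. {..- inverse (real (Suc n))})" by (intro UN_I[of n]) auto
  qed
  ultimately show False using desc_charges_negative[OF assms] by (simp add: D.emeasure_eq_measure)
qed

lemma desc_mean_negative:
  assumes "integrable \<mu> (\<lambda>x. x)" "(LINT x|\<mu>. x) < 0" and int: "integrable (hit_law {..0}) (\<lambda>z. z)"
  shows "(LINT z|hit_law {..0}. z) < 0"
proof -
  interpret D: finite_measure "hit_law {..0}" by (rule finite_hit_law) simp
  obtain \<delta> where \<delta>: "0 < \<delta>" "0 < measure (hit_law {..0}) {..- \<delta>}" using desc_charges_below[OF assms(1,2)] by blast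
  have "(LINT z|hit_law {..0}. z) \<le> (LINT z|hit_law {..0}. - \<delta> * indicator {..- \<delta>} z)"
  proof (rule integral_mono_AE[OF int])
    show "integrable (hit_law {..0}) (\<lambda>z. - \<delta> * indicator {..- \<delta>} z)"
      by (intro integrable_mult_right integrable_real_indicator) (auto simp: less_top[symmetric])
    show "AE z in hit_law {..0}. z \<le> - \<delta> * indicator {..- \<delta>} z"
      using AE_hit_law[of "{..0}"] by (auto simp: indicator_def elim!: eventually_mono)
  qed
  also have "\<dots> = - \<delta> * measure (hit_law {..0}) {..- \<delta>}" by simp
  also have "\<dots> < 0" using \<delta> by (simp add: mult_pos_pos)
  finally show ?thesis .
qed

end

section \<open>The claim size tail under mixing\<close>

text \<open>The tail of \<open>A - c T\<close> at \<open>x\<close> is the mean of the tail of \<open>A\<close> at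
\<open>x + c T\<close>. Here \<open>D j\<close> stands for the \<open>j\<close>-th derivative of the latter tail, and
\<open>\<kappa>\<close> for the law of \<open>T\<close>.\<close>

locale smooth_mixture =
  fixes D :: "nat \<Rightarrow> real \<Rightarrow> real" and m :: nat and \<alpha> b c :: real and \<kappa> :: "real measure"
  assumes b: "0 \<le> b"
    and der: "\<And>j x. j \<le> m \<Longrightarrow> b < x \<Longrightarrow> (D j has_real_derivative D (Suc j) x) (at x)"
    and sgn: "\<And>j x. j \<le> Suc m \<Longrightarrow> b < x \<Longrightarrow> 0 < (-1) ^ j * D j x"
    and rv: "\<And>j l. j \<le> Suc m \<Longrightarrow> 0 < l \<Longrightarrow> ((\<lambda>x. D j (l * x) / D j x) \<longlongrightarrow> l powr (- \<alpha> - real j)) at_top"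
    and \<kappa>: "prob_space \<kappa>" "sets \<kappa> = sets borel" and \<kappa>_nonneg: "AE t in \<kappa>. 0 \<le> t" and c: "0 < c"
begin

sublocale prob_space \<kappa> by (rule \<kappa>(1))

declare \<kappa>(2) [measurable_cong]

text \<open>The derivatives are known beyond \<open>b\<close> only; extension by \<open>0\<close> makes them
measurable.\<close>

definition H :: "nat \<Rightarrow> real \<Rightarrow> real" where
  "H j y = (if y \<in> {b<..} then D j y else 0)"

definition G :: "nat \<Rightarrow> real \<Rightarrow> real" where
  "G j x = (LINT t|\<kappa>. H j (x + c * t))"

lemma H_measurable [measurable]:
  assumes j: "j \<le> m"
  shows "H j \<in> borel_measurable borel"
proof -
  have "isCont (D j) x" if "b < x" for x using DERIV_isCont[OF der[OF j that]] .
  then have "continuous_on {b<..} (D j)" by (intro continuous_at_imp_continuous_on) auto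
  then show ?thesis
    unfolding H_def by (intro borel_measurable_continuous_on_if continuous_on_const) auto
qed

lemma G_measurable [measurable]: "j \<le> m \<Longrightarrow> G j \<in> borel_measurable borel"
  unfolding G_def by measurable

lemma abs_D: "j \<le> Suc m \<Longrightarrow> b < x \<Longrightarrow> \<bar>D j x\<bar> = (-1) ^ j * D j x"
  using sgn[of j x] by (cases "even j") auto

lemma abs_D_pos: "j \<le> Suc m \<Longrightarrow> b < x \<Longrightarrow> 0 < \<bar>D j x\<bar>"
  using sgn[of j x] abs_D[of j x] by simp

lemma D_anti:
  assumes j: "j \<le> m" and x: "b < x" "x \<le> y"
  shows "\<bar>D j y\<bar> \<le> \<bar>D j x\<bar>"
proof -
  have "(-1) ^ j * D j y \<le> (-1) ^ j * D j x"
  proof (rule DERIV_nonpos_imp_nonincreasing[OF x(2)], rule exI, rule conjI)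
    fix z assume "x \<le> z" "z \<le> y"
    then have z: "b < z" using x by simp
    show "((\<lambda>z. (-1) ^ j * D j z) has_real_derivative (-1) ^ j * D (Suc j) z) (at z)"
      by (intro DERIV_cmult der j z)
    show "(-1) ^ j * D (Suc j) z \<le> 0" using sgn[of "Suc j" z] j z by simp
  qed
  then show ?thesis using j x by (simp add: abs_D)
qed

lemma H_bound: "j \<le> m \<Longrightarrow> b < x \<Longrightarrow> AE t in \<kappa>. \<bar>H j (x + c * t)\<bar> \<le> \<bar>D j x\<bar>"
  using \<kappa>_nonneg by eventually_elim (use c in \<open>auto simp: H_def intro!: D_anti\<close>)

lemma integrable_H: "j \<le> m \<Longrightarrow> b < x \<Longrightarrow> integrable \<kappa> (\<lambda>t. H j (x + c * t))"
  using H_bound[of j x] by (intro integrable_const_bound[of _ "\<bar>D j x\<bar>"]) auto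

lemma shift_gt: "b < x \<Longrightarrow> 0 \<le> t \<Longrightarrow> b < x + c * t"
  using mult_nonneg_nonneg[of c t] c by linarith

lemma G_sign:
  assumes j: "j \<le> m" and x: "b < x"
  shows "0 < (-1) ^ j * G j x"
proof -
  have "(LINT t|\<kappa>. 0) < (LINT t|\<kappa>. (-1) ^ j * H j (x + c * t))"
  proof (rule integral_less_AE_space)
    show "AE t in \<kappa>. 0 < (-1) ^ j * H j (x + c * t)"
      using \<kappa>_nonneg
    proof eventually_elim
      case (elim t)
      then have "b < x + c * t" using x by (intro shift_gt)
      then show ?case using sgn[of j "x + c * t"] j by (simp add: H_def)
    qed
    show "integrable \<kappa> (\<lambda>t. (-1) ^ j * H j (x + c * t))"
      by (intro integrable_mult_right integrable_H j x)
  qed (simp_all add: emeasure_space_1)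
  then show ?thesis by (simp add: G_def)
qed

lemma abs_G: "j \<le> m \<Longrightarrow> b < x \<Longrightarrow> \<bar>G j x\<bar> = (-1) ^ j * G j x"
  using G_sign[of j x] by (cases "even j") auto

lemma G_anti:
  assumes j: "j \<le> m" and x: "b < x" "x \<le> y"
  shows "\<bar>G j y\<bar> \<le> \<bar>G j x\<bar>"
proof -
  have "(LINT t|\<kappa>. (-1) ^ j * H j (y + c * t)) \<le> (LINT t|\<kappa>. (-1) ^ j * H j (x + c * t))"
  proof (rule integral_mono_AE)
    show "AE t in \<kappa>. (-1) ^ j * H j (y + c * t) \<le> (-1) ^ j * H j (x + c * t)"
      using \<kappa>_nonneg
    proof eventually_elim
      case (elim t)
      have "0 \<le> c * t" using c elim by simp
      then have z: "b < x + c * t" "b < y + c * t" "x + c * t \<le> y + c * t" using x by linarith+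
      then show ?case using D_anti[OF j z(1,3)] j abs_D[of j "x + c * t"] abs_D[of j "y + c * t"] by (simp add: H_def)
    qed
  qed (use x in \<open>auto intro!: integrable_mult_right integrable_H j\<close>)
  then show ?thesis using x j by (simp add: abs_G G_def[symmetric])
qed

text \<open>The difference quotients of \<open>D j\<close> are bounded by the value of \<open>D (j + 1)\<close> at a
point to the left of \<open>x\<close>, uniformly over the translations.\<close>

lemma G_deriv:
  assumes j: "j < m" and x: "b < x"
  shows "(G j has_real_derivative G (Suc j) x) (at x)"
  unfolding DERIV_def
proof (rule tendsto_at_iff_sequentially[THEN iffD2], intro allI impI)
  fix X :: "nat \<Rightarrow> real" assume X: "\<forall>i. X i \<in> UNIV - {0}" "X \<longlonglongrightarrow> 0"
  define x0 where "x0 = (b + x) / 2"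
  have x0: "b < x0" "x0 < x" using x by (auto simp: x0_def)
  have "eventually (\<lambda>i. \<bar>X i\<bar> < x - x0) sequentially"
    using order_tendstoD(2)[OF tendsto_rabs[OF X(2)], of "x - x0"] x0 by simp
  then obtain N where N: "\<And>i. N \<le> i \<Longrightarrow> \<bar>X i\<bar> < x - x0" by (auto simp: eventually_sequentially)
  have jm: "j \<le> m" "Suc j \<le> m" using j by auto
  have L: "(\<lambda>i. LINT t|\<kappa>. (H j (x + X (i + N) + c * t) - H j (x + c * t)) / X (i + N)) \<longlonglongrightarrow> (LINT t|\<kappa>. H (Suc j) (x + c * t))"
  proof (rule integral_dominated_convergence[where w = "\<lambda>_. \<bar>D (Suc j) x0\<bar>"])
    show "AE t in \<kappa>. norm ((H j (x + X (i + N) + c * t) - H j (x + c * t)) / X (i + N)) \<le> \<bar>D (Suc j) x0\<bar>" for i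
      using \<kappa>_nonneg
    proof eventually_elim
      case (elim t)
      define y where "y = x + c * t"
      define h where "h = X (i + N)"
      have y: "x \<le> y" using c elim by (simp add: y_def)
      have h: "h \<noteq> 0" "\<bar>h\<bar> < x - x0" using X(1) N[of "i + N"] by (auto simp: h_def)
      have ge: "x0 < y + h" using y h by linarith
      have "\<bar>D j (y + h) - D j y\<bar> \<le> \<bar>D (Suc j) x0\<bar> * \<bar>h\<bar>"
      proof (cases "0 < h")
        case True
        obtain z where "y < z" "z < y + h" "D j (y + h) - D j y = (y + h - y) * D (Suc j) z"
          using MVT2[of y "y + h" "D j" "D (Suc j)"] der[OF jm(1)] True y x by force
        then show ?thesis using D_anti[OF jm(2) x0(1), of z] y x0 by (simp add: abs_mult mult.commute mult_left_mono)
      next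
        case False
        then obtain z where "y + h < z" "z < y" "D j y - D j (y + h) = (y - (y + h)) * D (Suc j) z"
          using MVT2[of "y + h" y "D j" "D (Suc j)"] der[OF jm(1)] h ge x0 by force
        then show ?thesis using D_anti[OF jm(2) x0(1), of z] ge
          by (subst abs_minus_commute) (simp add: abs_mult mult.commute mult_left_mono)
      qed
      moreover have "H j (x + X (i + N) + c * t) = D j (y + h)" "H j (x + c * t) = D j y"
        using y ge x x0 by (auto simp: H_def y_def h_def algebra_simps)
      ultimately show ?case using h by (simp add: h_def[symmetric] abs_divide pos_divide_le_eq)
    qed
    show "AE t in \<kappa>. (\<lambda>i. (H j (x + X (i + N) + c * t) - H j (x + c * t)) / X (i + N)) \<longlonglongrightarrow> H (Suc j) (x + c * t)"
      using \<kappa>_nonneg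
    proof eventually_elim
      case (elim t)
      define y where "y = x + c * t"
      have y: "x \<le> y" "b < y" using c elim x shift_gt[of x t] by (auto simp: y_def)
      have "((\<lambda>h. (D j (y + h) - D j y) / h) \<longlongrightarrow> D (Suc j) y) (at 0)"
        using der[OF jm(1) y(2)] by (simp add: DERIV_def)
      from tendsto_at_iff_sequentially[THEN iffD1, OF this, rule_format, OF X(1)[rule_format] X(2)]
      have "(\<lambda>i. (D j (y + X i) - D j y) / X i) \<longlonglongrightarrow> D (Suc j) y" by (simp add: o_def)
      from LIMSEQ_ignore_initial_segment[OF this, of N]
      have "(\<lambda>i. (D j (y + X (i + N)) - D j y) / X (i + N)) \<longlonglongrightarrow> D (Suc j) y" .
      moreover have "H j (x + X (i + N) + c * t) = D j (y + X (i + N))" for i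
      proof -
        have "b < x + X (i + N) + c * t" using N[of "i + N"] y x0 by (simp add: y_def)
        then show ?thesis by (simp add: H_def y_def algebra_simps)
      qed
      ultimately show ?case using y by (simp add: H_def y_def)
    qed
  qed (use jm in auto)
  have E: "(LINT t|\<kappa>. (H j (x + X (i + N) + c * t) - H j (x + c * t)) / X (i + N)) =
      (G j (x + X (i + N)) - G j x) / X (i + N)" for i
  proof -
    have "b < x + X (i + N)" using N[of "i + N"] x0 by simp
    then show ?thesis unfolding G_def using jm x by (simp add: integrable_H)
  qed
  have "(\<lambda>i. (G j (x + X (i + N)) - G j x) / X (i + N)) \<longlonglongrightarrow> G (Suc j) x"
    using L unfolding E G_def[of "Suc j"] .
  then have "(\<lambda>i. (G j (x + X i) - G j x) / X i) \<longlonglongrightarrow> G (Suc j) x" by (rule LIMSEQ_offset)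
  then show "((\<lambda>h. (G j (x + h) - G j x) / h) \<circ> X) \<longlonglongrightarrow> G (Suc j) x" by (simp add: o_def)
qed

text \<open>Dominated convergence: the quotients \<open>D j (x + c * t) / D j x\<close> are bounded by
\<open>1\<close>, as \<open>D j\<close> is monotone, and tend to \<open>1\<close> for each \<open>t\<close>, as it is
long tailed.\<close>

lemma G_equiv:
  assumes j: "j \<le> m"
  shows "((\<lambda>x. G j x / D j x) \<longlongrightarrow> 1) at_top"
proof -
  have "((\<lambda>x. LINT t|\<kappa>. H j (x + c * t) / D j x) \<longlongrightarrow> (LINT t|\<kappa>. 1)) at_top"
  proof (rule integral_dominated_convergence_at_top[where w = "\<lambda>_. 1"])
    show "eventually (\<lambda>x. AE t in \<kappa>. norm (H j (x + c * t) / D j x) \<le> 1) at_top"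
      using eventually_gt_at_top[of b]
    proof eventually_elim
      case (elim x)
      then show ?case using H_bound[OF j elim] abs_D_pos[of j x] j
        by (auto simp: abs_divide divide_le_eq elim!: eventually_mono)
    qed
    show "AE t in \<kappa>. ((\<lambda>x. H j (x + c * t) / D j x) \<longlongrightarrow> 1) at_top"
      using \<kappa>_nonneg
    proof eventually_elim
      case (elim t)
      have ct: "0 \<le> c * t" using c elim by simp
      have abs_rv: "((\<lambda>x. \<bar>D j (l * x)\<bar> / \<bar>D j x\<bar>) \<longlongrightarrow> l powr (- \<alpha> - real j)) at_top" if "0 < l" for l
        using tendsto_rabs[OF rv[of j l]] j that by (simp add: abs_divide)
      have "((\<lambda>x. \<bar>D j (x + c * t)\<bar> / \<bar>D j x\<bar>) \<longlongrightarrow> 1) at_top"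
        using j by (intro long_tailed[where a = b and \<rho> = "- \<alpha> - real j"] abs_D_pos D_anti abs_rv ct) auto
      then show ?case
      proof (rule Lim_transform_eventually)
        show "eventually (\<lambda>x. \<bar>D j (x + c * t)\<bar> / \<bar>D j x\<bar> = H j (x + c * t) / D j x) at_top"
          using eventually_gt_at_top[of b]
        proof eventually_elim
          case (elim x)
          have z: "b < x + c * t" using elim ct by simp
          show ?case using j z elim abs_D[of j x] abs_D[of j "x + c * t"] by (simp add: H_def)
        qed
      qed
    qed
  qed (use j in auto)
  then show ?thesis by (simp add: G_def prob_space)
qed

lemma G_rv:
  assumes j: "j \<le> m" and l: "0 < l"
  shows "((\<lambda>x. G j (l * x) / G j x) \<longlongrightarrow> l powr (- \<alpha> - real j)) at_top"
proof -
  have lx: "filterlim (\<lambda>x. l * x) at_top at_top"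
    using l by (intro filterlim_tendsto_pos_mult_at_top[OF tendsto_const]) (auto intro: filterlim_ident)
  have "((\<lambda>x. G j (l * x) / D j (l * x) * (D j (l * x) / D j x) * inverse (G j x / D j x)) \<longlongrightarrow>
      1 * l powr (- \<alpha> - real j) * inverse 1) at_top"
    using j l by (intro tendsto_intros filterlim_compose[OF G_equiv[OF j] lx] rv G_equiv) auto
  then have "((\<lambda>x. G j (l * x) / D j (l * x) * (D j (l * x) / D j x) * inverse (G j x / D j x)) \<longlongrightarrow>
      l powr (- \<alpha> - real j)) at_top" by simp
  then show ?thesis
  proof (rule Lim_transform_eventually)
    show "eventually (\<lambda>x. G j (l * x) / D j (l * x) * (D j (l * x) / D j x) * inverse (G j x / D j x) = G j (l * x) / G j x) at_top"
      using eventually_gt_at_top[of b] eventually_gt_at_top[of "b / l"]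
    proof eventually_elim
      case (elim x)
      then have "b < l * x" using l by (simp add: field_simps)
      then show ?case using abs_D_pos[of j "l * x"] abs_D_pos[of j x] elim j by simp
    qed
  qed
qed

end

text \<open>Tonelli's theorem bounds the integral of the tail beyond \<open>t\<close> by the mean of \<open>\<bar>y -
t\<bar>\<close>.\<close>

lemma set_integrable_tail:
  assumes \<mu>: "prob_space \<mu>" "sets \<mu> = sets borel" and int: "integrable \<mu> (\<lambda>x::real. x)"
  shows "set_integrable lborel {t..} (\<lambda>x. measure \<mu> {x<..})"
proof -
  interpret prob_space \<mu> by (rule \<mu>(1))
  interpret P: pair_sigma_finite lborel \<mu> ..
  have [measurable_cong]: "sets \<mu> = sets borel" by (rule \<mu>(2))
  have [measurable]: "(\<lambda>x. measure \<mu> {x<..}) \<in> borel_measurable borel"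
    by (rule borel_measurable_tail[OF finite_measure_axioms \<mu>(2)])
  show ?thesis
    unfolding set_integrable_def
  proof (rule integrableI_bounded)
    have "(\<integral>\<^sup>+x. ennreal (norm (indicator {t..} x *\<^sub>R measure \<mu> {x<..})) \<partial>lborel) =
        (\<integral>\<^sup>+x. \<integral>\<^sup>+y. indicator {t..} x * indicator {x<..} y \<partial>\<mu> \<partial>lborel)"
      by (intro nn_integral_cong) (auto simp: nn_integral_cmult emeasure_eq_measure indicator_def[of "{t..}"])
    also have "\<dots> = (\<integral>\<^sup>+x. \<integral>\<^sup>+y. indicator {(x, y). t \<le> x \<and> x < y} (x, y) \<partial>\<mu> \<partial>lborel)"
      by (intro nn_integral_cong) (auto simp: indicator_def)
    also have "\<dots> = (\<integral>\<^sup>+y. \<integral>\<^sup>+x. indicator {(x, y). t \<le> x \<and> x < y} (x, y) \<partial>lborel \<partial>\<mu>)"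
      by (rule P.Fubini'[symmetric]) measurable
    also have "\<dots> \<le> (\<integral>\<^sup>+y. ennreal (norm (y - t)) \<partial>\<mu>)"
    proof (rule nn_integral_mono)
      fix y
      have "(\<integral>\<^sup>+x. indicator {(x, y). t \<le> x \<and> x < y} (x, y) \<partial>lborel) = (\<integral>\<^sup>+x. indicator {t..<y} x \<partial>lborel)"
        by (intro nn_integral_cong) (auto simp: indicator_def)
      also have "\<dots> \<le> ennreal (norm (y - t))" by (cases "t \<le> y") auto
      finally show "(\<integral>\<^sup>+x. indicator {(x, y). t \<le> x \<and> x < y} (x, y) \<partial>lborel) \<le> ennreal (norm (y - t))" .
    qed
    also have "\<dots> < \<infinity>" 
      using int by (intro has_bochner_integral_implies_finite_norm) (auto intro!: has_bochner_integral_integrable)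
    finally show "(\<integral>\<^sup>+x. ennreal (norm (indicator {t..} x *\<^sub>R measure \<mu> {x<..})) \<partial>lborel) < \<infinity>" .
  qed measurable
qed

lemma D_inv_tendsto_0:
  assumes "set_integrable lborel {0..} f"
  shows "(D_inv f \<longlongrightarrow> 0) at_top"
proof -
  have int: "integrable lborel (\<lambda>x. indicator {0..} x * f x)" using assms by (simp add: set_integrable_def)
  have "((\<lambda>t. LINT x|lborel. indicator {t..} x * (indicator {0..} x * f x)) \<longlongrightarrow> (LINT x::real|lborel. 0)) at_top"
  proof (rule integral_dominated_convergence_at_top[where w = "\<lambda>x. \<bar>indicator {0..} x * f x\<bar>"])
    show "AE x in lborel. ((\<lambda>t. indicator {t..} x * (indicator {0..} x * f x)) \<longlongrightarrow> 0) at_top"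
    proof (intro AE_I2 tendsto_eventually)
      fix x :: real
      show "eventually (\<lambda>t. indicator {t..} x * (indicator {0..} x * f x) = 0) at_top"
        using eventually_gt_at_top[of x] by eventually_elim simp
    qed
    show "(\<lambda>x. indicator {t..} x * (indicator {0..} x * f x)) \<in> borel_measurable lborel" for t
      by (rule borel_measurable_times[OF _ borel_measurable_integrable[OF int]]) simp
  qed (use int in \<open>auto simp: indicator_def intro!: always_eventually\<close>)
  then have "((\<lambda>t. - (LINT x|lborel. indicator {t..} x * (indicator {0..} x * f x))) \<longlongrightarrow> - 0) at_top"
    by (intro tendsto_minus) simp
  then have "((\<lambda>t. - (LINT x|lborel. indicator {t..} x * (indicator {0..} x * f x))) \<longlongrightarrow> 0) at_top" by simp
  then show ?thesis
  proof (rule Lim_transform_eventually)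
    show "eventually (\<lambda>t. - (LINT x|lborel. indicator {t..} x * (indicator {0..} x * f x)) = D_inv f t) at_top"
      using eventually_ge_at_top[of 0]
    proof eventually_elim
      case (elim t)
      then show ?case unfolding D_inv_def set_lebesgue_integral_def
        by (intro arg_cong[where f = uminus] Bochner_Integration.integral_cong) (auto simp: indicator_def)
    qed
  qed
qed

lemma D_inv_deriv:
  assumes int: "\<And>t. set_integrable lborel {t..} f" and cont: "continuous_on {b<..} f" and x: "b < x"
  shows "(D_inv f has_real_derivative f x) (at x)"
proof -
  define u where "u = (b + x) / 2"
  have u: "b < u" "u < x" using x by (auto simp: u_def)
  have sub: "{u..x + 1} \<subseteq> {b<..}" using u by auto
  have "((\<lambda>t. integral {u..t} f) has_real_derivative f x) (at x within {u..x + 1})"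
    using u by (intro integral_has_real_derivative continuous_on_subset[OF cont sub]) auto
  then have 1: "((\<lambda>t. integral {u..t} f) has_real_derivative f x) (at x)"
    using u by (subst (asm) at_within_Icc_at) auto
  have eq: "D_inv f t = D_inv f u + integral {u..t} f" if "u < t" for t
  proof -
    have un: "{u..} = {u..t} \<union> {t..}" using that by auto
    have "(LINT y:{u..}|lborel. f y) = (LINT y:{u..t}|lborel. f y) + (LINT y:{t..}|lborel. f y)"
      unfolding un
    proof (rule set_integral_Un_AE)
      show "AE y in lborel. \<not> (y \<in> {u..t} \<and> y \<in> {t..})"
        using AE_lborel_singleton[of t] by eventually_elim auto
      show "set_integrable lborel {u..t} f" by (rule set_integrable_subset[OF int[of u]]) auto
    qed (use int in auto)
    also have "(LINT y:{u..t}|lborel. f y) = integral {u..t} f"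
      by (rule set_borel_integral_eq_integral(2)) (rule set_integrable_subset[OF int[of u]]; auto)
    finally show ?thesis by (simp add: D_inv_def)
  qed
  have "((\<lambda>t. D_inv f u + integral {u..t} f) has_real_derivative f x) (at x)"
    using DERIV_add[OF DERIV_const 1] by simp
  then show ?thesis
    by (rule has_field_derivative_transform_within_open[where S = "{u<..}"]) (use u eq in auto)
qed

lemma deriv_iterate_eq:
  fixes d :: "nat \<Rightarrow> real \<Rightarrow> real"
  assumes der: "\<And>k x. k < m \<Longrightarrow> b < x \<Longrightarrow> (d k has_real_derivative d (Suc k) x) (at x)"
    and eq: "\<And>x. b < x \<Longrightarrow> f x = d 0 x"
  shows "k \<le> m \<Longrightarrow> b < x \<Longrightarrow> (deriv ^^ k) f x = d k x"
proof (induction k arbitrary: x)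
  case (Suc k)
  have "((deriv ^^ k) f has_real_derivative d (Suc k) x) (at x)"
    by (rule has_field_derivative_transform_within_open[where S = "{b<..}" and f = "d k"])
      (use der[of k x] Suc in auto)
  then show ?case using DERIV_imp_deriv by simp
qed (use eq in simp)

context smooth_mixture
begin

text \<open>The primitive \<open>D_inv f\<close> followed by its derivatives. As for \<open>H\<close>, values left of
\<open>b\<close> and orders beyond \<open>m\<close> are set to \<open>0\<close> for measurability.\<close>

definition scale :: "(real \<Rightarrow> real) \<Rightarrow> nat \<Rightarrow> real \<Rightarrow> real" where
  "scale f k x = (if x \<in> {b<..} then (case k of 0 \<Rightarrow> D_inv f x | Suc j \<Rightarrow> if j < m then G j x else 0) else 0)"

lemma scale_simps:
  assumes "b < x"
  shows "scale f 0 x = D_inv f x" "j < m \<Longrightarrow> scale f (Suc j) x = G j x"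
  using assms by (simp_all add: scale_def)

theorem deriv_scale_mixture:
  assumes m: "1 \<le> m" and \<alpha>: "real m < \<alpha>"
    and int: "\<And>t. set_integrable lborel {t..} f" and f: "\<And>x. b < x \<Longrightarrow> f x = G 0 x"
  shows "deriv_scale (scale f) m (\<alpha> - 1) b"
    and "k \<le> m \<Longrightarrow> b < x \<Longrightarrow> (deriv ^^ k) (D_inv f) x = scale f k x"
proof -
  have near: "(scale f k has_real_derivative y) (at x)"
    if "(g has_real_derivative y) (at x)" "\<And>z. b < z \<Longrightarrow> g z = scale f k z" "b < x" for k x y and g :: "real \<Rightarrow> real"
    by (rule has_field_derivative_transform_within_open[where S = "{b<..}" and f = g]) (use that in auto)
  have "isCont (G 0) x" if "b < x" for x using DERIV_isCont[OF G_deriv[of 0, OF _ that]] m by simp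
  then have "continuous_on {b<..} (G 0)" by (intro continuous_at_imp_continuous_on) auto
  then have cont: "continuous_on {b<..} f" by (rule continuous_on_eq) (use f in auto)
  have D0: "(D_inv f has_real_derivative f x) (at x)" if "b < x" for x
    by (rule D_inv_deriv[OF int cont that])
  have der: "(scale f j has_real_derivative scale f (Suc j) x) (at x)" if "j < m" "b < x" for j x
  proof (cases j)
    case 0
    then show ?thesis using that D0[OF that(2)] f[OF that(2)] by (intro near[of "D_inv f"]) (auto simp: scale_simps)
  next
    case (Suc i)
    then show ?thesis using that G_deriv[of i x] by (intro near[of "G i"]) (auto simp: scale_simps)
  qed
  have lim0: "(D_inv f \<longlongrightarrow> 0) at_top" by (rule D_inv_tendsto_0[OF int])
  have f_pos: "0 < f x" if "b < x" for x using G_sign[of 0 x] that by (simp add: f)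
  have neg: "D_inv f x < 0" if "b < x" for x
    by (rule pos_deriv_tendsto_0[OF D0 f_pos lim0 that])
  have rv0: "((\<lambda>x. D_inv f (l * x) / D_inv f x) \<longlongrightarrow> l powr (- (\<alpha> - 1) - real 0)) at_top" if l: "0 < l" for l
  proof -
    have lx: "filterlim (\<lambda>x. l * x) at_top at_top"
      using l by (intro filterlim_tendsto_pos_mult_at_top[OF tendsto_const]) (auto intro: filterlim_ident)
    have evf: "eventually (\<lambda>x. G 0 x = f x) at_top"
      using eventually_gt_at_top[of b] by eventually_elim (simp add: f)
    have "eventually (\<lambda>x. G 0 (l * x) = f (l * x)) at_top"
      using lx evf by (auto simp: filterlim_iff)
    with evf have "eventually (\<lambda>x. G 0 (l * x) / G 0 x = f (l * x) / f x) at_top"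
      by eventually_elim simp
    then have "((\<lambda>x. f (l * x) / f x) \<longlongrightarrow> l powr (- \<alpha> - real 0)) at_top"
      using G_rv[of 0 l] l by (auto intro: Lim_transform_eventually)
    then have "((\<lambda>x. D_inv f (l * x) / D_inv f x) \<longlongrightarrow> l * l powr (- \<alpha> - real 0)) at_top"
      using b l f_pos lim0 D0
      by (intro regular_variation_antiderivative[where a = b and s = 1 and g = f]) auto
    also have "l * l powr (- \<alpha> - real 0) = l powr (1 + (- \<alpha> - real 0))"
      using l by (intro powr_mult_base) simp
    finally show ?thesis by simp
  qed
  show S: "deriv_scale (scale f) m (\<alpha> - 1) b"
  proof
    show "scale f j \<in> borel_measurable borel" for j
    proof (cases j)
      case 0
      have "continuous_on {b<..} (D_inv f)"
        by (intro continuous_at_imp_continuous_on ballI DERIV_isCont[OF D0]) auto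
      then have "(\<lambda>x. if x \<in> {b<..} then D_inv f x else 0) \<in> borel_measurable borel"
        by (intro borel_measurable_continuous_on_if continuous_on_const) auto
      then show ?thesis using 0 by (simp add: scale_def[abs_def] cong: if_cong)
    next
      case (Suc i)
      show ?thesis
      proof (cases "i < m")
        case True
        then have [measurable]: "G i \<in> borel_measurable borel" by (intro G_measurable) simp
        have "(\<lambda>x. if x \<in> {b<..} then G i x else 0) \<in> borel_measurable borel" by measurable
        then show ?thesis using Suc True by (simp add: scale_def[abs_def] cong: if_cong)
      next
        case False
        then show ?thesis using Suc by (simp add: scale_def[abs_def] cong: if_cong)
      qed
    qed
    show sgn: "0 < (-1) ^ Suc j * scale f j x" if "j \<le> m" "b < x" for j x
      using that neg[of x] G_sign[of "j - 1" x] by (cases j) (auto simp: scale_simps)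
    show "\<bar>scale f j y\<bar> \<le> \<bar>scale f j x\<bar>" if "j \<le> m" "b < x" "x \<le> y" for j x y
    proof (cases j)
      case 0
      have "D_inv f x \<le> D_inv f y"
        by (rule DERIV_nonneg_imp_nondecreasing[OF that(3)], rule exI, rule conjI[OF D0 less_imp_le[OF f_pos]])
          (use that in auto)
      then show ?thesis using 0 that neg[of x] neg[of y] by (simp add: scale_simps)
    next
      case (Suc i)
      then show ?thesis using that G_anti[of i x y] by (simp add: scale_simps)
    qed
    show "((\<lambda>x. scale f j (l * x) / scale f j x) \<longlongrightarrow> l powr (- (\<alpha> - 1) - real j)) at_top" if "j \<le> m" "0 < l" for j l
    proof -
      have "eventually (\<lambda>x. b < x \<and> b < l * x) at_top"
        using eventually_gt_at_top[of b] eventually_gt_at_top[of "b / l"]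
        by eventually_elim (use that in \<open>simp add: field_simps\<close>)
      note ev = this
      show ?thesis
      proof (cases j)
        case 0
        have "eventually (\<lambda>x. D_inv f (l * x) / D_inv f x = scale f j (l * x) / scale f j x) at_top"
          using ev by eventually_elim (simp add: 0 scale_simps)
        then show ?thesis using rv0[OF that(2)] 0 by (auto intro: Lim_transform_eventually)
      next
        case (Suc i)
        have e: "- (\<alpha> - 1) - real j = - \<alpha> - real i" by (simp add: Suc)
        have "eventually (\<lambda>x. G i (l * x) / G i x = scale f j (l * x) / scale f j x) at_top"
          using ev by eventually_elim (use Suc that in \<open>simp add: scale_simps\<close>)
        moreover have "((\<lambda>x. G i (l * x) / G i x) \<longlongrightarrow> l powr (- \<alpha> - real i)) at_top"
          using that Suc by (intro G_rv) auto
        ultimately show ?thesis unfolding e by (rule Lim_transform_eventually[rotated])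
      qed
    qed
  qed (use m \<alpha> b der in auto)
  show "(deriv ^^ k) (D_inv f) x = scale f k x" if "k \<le> m" "b < x"
    using deriv_iterate_eq[where d = "scale f" and m = m and b = b and f = "D_inv f", OF der _ that] by (simp add: scale_simps)
qed

end

section \<open>The ring of truncated polynomials\<close>

lemma dvd_mod_diff: "(M :: real poly) dvd x mod M - x"
  by (metis dvd_minus_mod dvd_minus_iff minus_diff_eq)

lemma trunc_ring_unit:
  assumes "x \<in> carrier (trunc_ring n)" "coeff x 0 \<noteq> 0"
  shows "x \<in> Units (trunc_ring n)" 
proof -
  obtain B where B: "degree B \<le> n" "monom 1 (Suc n) dvd x * B - 1" using inverse_mod_monom[OF assms(2)] by blast
  have "(x * B) mod monom 1 (n + 1) = 1 mod monom 1 (n + 1)"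
    using B(2) by (simp add: mod_eq_dvd_iff)
  also have "\<dots> = 1" by (rule mod_poly_less) (simp add: degree_monom_eq)
  finally have "(x * B) mod monom 1 (n + 1) = 1" .
  then show ?thesis
    using assms(1) B(1) by (auto simp: Units_def trunc_ring_def mult.commute intro!: bexI[of _ B])
qed

lemma trunc_ring_inv:
  assumes "x \<in> carrier (trunc_ring n)" "coeff x 0 \<noteq> 0"
  shows "degree (inv\<^bsub>trunc_ring n\<^esub> x) \<le> n" "monom 1 (Suc n) dvd x * (inv\<^bsub>trunc_ring n\<^esub> x) - 1"
proof -
  interpret cring "trunc_ring n" by (rule trunc_ring_cring)
  have u: "x \<in> Units (trunc_ring n)" by (rule trunc_ring_unit[OF assms])
  have "inv\<^bsub>trunc_ring n\<^esub> x \<in> carrier (trunc_ring n)" using u by (rule Units_inv_closed)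
  then show "degree (inv\<^bsub>trunc_ring n\<^esub> x) \<le> n" by (simp add: trunc_ring_def)
  have "x \<otimes>\<^bsub>trunc_ring n\<^esub> inv\<^bsub>trunc_ring n\<^esub> x = \<one>\<^bsub>trunc_ring n\<^esub>" using u by (rule Units_r_inv)
  then have "(x * (inv\<^bsub>trunc_ring n\<^esub> x)) mod monom 1 (n + 1) = 1" by (simp add: trunc_ring_def)
  then show "monom 1 (Suc n) dvd x * (inv\<^bsub>trunc_ring n\<^esub> x) - 1"
    using dvd_minus_mod[of "monom 1 (Suc n)" "x * (inv\<^bsub>trunc_ring n\<^esub> x)"] by simp
qed

lemma trunc_ring_minus:
  assumes "x \<in> carrier (trunc_ring n)" "y \<in> carrier (trunc_ring n)"
  shows "x \<ominus>\<^bsub>trunc_ring n\<^esub> y = x - y"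
proof -
  interpret cring "trunc_ring n" by (rule trunc_ring_cring)
  have "\<ominus>\<^bsub>trunc_ring n\<^esub> y = - y"
    using assms by (intro minus_equality) (auto simp: trunc_ring_def)
  then show ?thesis by (simp add: a_minus_def) (simp add: trunc_ring_def)
qed

text \<open>The power \<open>-2\<close> of the ring, in the form of a congruence.\<close>

lemma trunc_ring_inverse_square:
  assumes a: "a \<in> carrier (trunc_ring n)" "coeff a 0 \<noteq> 0" and P: "P \<in> carrier (trunc_ring n)"
  defines "Q \<equiv> a [^]\<^bsub>trunc_ring n\<^esub> (-2 :: int) \<otimes>\<^bsub>trunc_ring n\<^esub> P"
  shows "degree Q \<le> n" "monom 1 (Suc n) dvd Q * a ^ 2 - P"
proof -
  interpret cring "trunc_ring n" by (rule trunc_ring_cring)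
  let ?M = "monom 1 (Suc n) :: real poly"
  define s where "s = (a * a) mod ?M"
  have s: "s \<in> carrier (trunc_ring n)" "coeff s 0 \<noteq> 0" "?M dvd s - a * a"
  proof -
    show "s \<in> carrier (trunc_ring n)" using mod_monom_in[of "a * a" n] by (simp add: s_def trunc_ring_def)
    show dvd: "?M dvd s - a * a" unfolding s_def by (rule dvd_mod_diff)
    then have "coeff (s - a * a) 0 = 0" by (simp add: monom_1_dvd_iff')
    then show "coeff s 0 \<noteq> 0" using a(2) by (simp add: coeff_mult)
  qed
  define i where "i = inv\<^bsub>trunc_ring n\<^esub> s"
  have i: "?M dvd s * i - 1" unfolding i_def by (rule trunc_ring_inv[OF s(1,2)])
  have "a [^]\<^bsub>trunc_ring n\<^esub> (2 :: nat) = s"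
    using a(1) by (simp add: numeral_2_eq_2 nat_pow_Suc s_def) (simp add: trunc_ring_def)
  then have "a [^]\<^bsub>trunc_ring n\<^esub> (-2 :: int) = i"
    by (simp add: int_pow_def2 i_def)
  then have Q: "Q = (i * P) mod ?M" by (simp add: Q_def trunc_ring_def)
  show "degree Q \<le> n" unfolding Q using mod_monom_in[of "i * P" n] by simp
  have "?M dvd Q - i * P" unfolding Q by (rule dvd_mod_diff)
  then have 1: "?M dvd (Q - i * P) * a ^ 2" by (rule dvd_mult2)
  have 2: "?M dvd (s - a * a) * (i * P)" using s(3) by (rule dvd_mult2)
  have 3: "?M dvd (s * i - 1) * P" using i by (rule dvd_mult2)
  have "Q * a ^ 2 - P = (Q - i * P) * a ^ 2 - (s - a * a) * (i * P) + (s * i - 1) * P"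
    by (simp add: algebra_simps power2_eq_square)
  then show "?M dvd Q * a ^ 2 - P" using 1 2 3 by (simp only: dvd_add dvd_diff)
qed

text \<open>The backward signed shift undoes multiplication by \<open>D\<close> up to sign. Total mass
\<open>1\<close> is what makes \<open>1 - L\<close> divisible by \<open>D\<close>.\<close>

lemma signed_shift_mult:
  assumes "coeff L 0 = 1"
  shows "monom 1 1 * signed_shift L = 1 - L"
  using assms by (auto simp: signed_shift_def poly_eq_iff coeff_monom_mult coeff_poly_shift)

lemma coeff_signed_shift: "coeff (signed_shift L) i = - coeff L (Suc i)"
  by (simp add: signed_shift_def coeff_poly_shift)

lemma degree_lchar: "degree (lchar \<nu> n) \<le> n"
  by (rule degree_le) (simp add: coeff_lchar)

lemma laplace_char_eq: "laplace_char G n = lchar (interval_measure G) n"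
  by (simp add: laplace_char_def lchar_def moment_def)

section \<open>Transfer from the probability space\<close>

text \<open>Both families are combined into one, so that the pairs \<open>(A n, T n)\<close> can be treated as
disjoint blocks of a single independent family.\<close>

lemma (in prob_space) indep_vars_pairs:
  fixes A T :: "nat \<Rightarrow> 'a \<Rightarrow> real"
  assumes A: "indep_vars (\<lambda>_. borel) A I" and T: "indep_vars (\<lambda>_. borel) T I"
    and AT: "indep_var (\<Pi>\<^sub>M n\<in>I. borel) (\<lambda>\<omega>. \<lambda>n\<in>I. A n \<omega>) (\<Pi>\<^sub>M n\<in>I. borel) (\<lambda>\<omega>. \<lambda>n\<in>I. T n \<omega>)"
  shows "indep_vars (\<lambda>_. borel) (\<lambda>(n, s). if s then A n else T n) (I \<times> UNIV)"
proof -
  define Z where "Z = (\<lambda>(n, s). if s then A n else T n)"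
  have rvA: "random_variable borel (A n)" and rvT: "random_variable borel (T n)" if "n \<in> I" for n
    using that A T by (auto simp: indep_vars_def)
  have prod: "prob {\<omega> \<in> space M. \<forall>n\<in>J. X n \<omega> \<in> B n} = (\<Prod>n\<in>J. prob (X n -` B n \<inter> space M))"
    if X: "indep_vars (\<lambda>_. borel) X I" and J: "finite J" "J \<subseteq> I" and B: "\<And>n. n \<in> J \<Longrightarrow> B n \<in> sets borel"
    for X :: "nat \<Rightarrow> 'a \<Rightarrow> real" and J B
  proof (cases "J = {}")
    case False
    have "{\<omega> \<in> space M. \<forall>n\<in>J. X n \<omega> \<in> B n} = (\<Inter>n\<in>J. X n -` B n \<inter> space M)" using False by auto
    then show ?thesis using indep_varsD[OF X False J, of B] B by simp
  qed (simp add: prob_space)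
  have cyl: "{f \<in> space (\<Pi>\<^sub>M n\<in>I. borel). \<forall>n\<in>J. f n \<in> B n} \<in> sets (\<Pi>\<^sub>M n\<in>I. (borel :: real measure))"
    if J: "finite J" "J \<subseteq> I" and B: "\<And>n. n \<in> J \<Longrightarrow> B n \<in> sets borel" for J B
    using that by (intro sets.sets_Collect_finite_All sets_Collect_single) auto
  have "indep_sets (\<lambda>i. {Z i -` B \<inter> space M | B. B \<in> sets borel}) (I \<times> UNIV)"
  proof (rule indep_setsI)
    fix E J assume J: "J \<noteq> {}" "J \<subseteq> I \<times> UNIV" "finite J"
      and E: "\<forall>j\<in>J. E j \<in> {Z j -` B \<inter> space M | B. B \<in> sets borel}"
    from E obtain B where B: "\<And>j. j \<in> J \<Longrightarrow> E j = Z j -` B j \<inter> space M" "\<And>j. j \<in> J \<Longrightarrow> B j \<in> sets borel"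
      by (auto simp: Bex_def) metis
    define J1 where "J1 = {n. (n, True) \<in> J}"
    define J2 where "J2 = {n. (n, False) \<in> J}"
    have fin: "finite J1" "finite J2"
      using finite_vimageI[OF J(3), of "\<lambda>n. (n, True)"] finite_vimageI[OF J(3), of "\<lambda>n. (n, False)"]
      by (auto simp: J1_def J2_def vimage_def inj_on_def)
    have sub: "J1 \<subseteq> I" "J2 \<subseteq> I" using J by (auto simp: J1_def J2_def)
    have B1: "B (n, True) \<in> sets borel" if "n \<in> J1" for n using B(2) that by (auto simp: J1_def)
    have B2: "B (n, False) \<in> sets borel" if "n \<in> J2" for n using B(2) that by (auto simp: J2_def)
    have J_eq: "J = (\<lambda>n. (n, True)) ` J1 \<union> (\<lambda>n. (n, False)) ` J2"
    proof (intro equalityI subsetI)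
      fix j assume "j \<in> J"
      then show "j \<in> (\<lambda>n. (n, True)) ` J1 \<union> (\<lambda>n. (n, False)) ` J2"
        by (cases j; cases "snd j") (auto simp: J1_def J2_def)
    qed (auto simp: J1_def J2_def)
    let ?C1 = "{f \<in> space (\<Pi>\<^sub>M n\<in>I. borel). \<forall>n\<in>J1. f n \<in> B (n, True)}"
    let ?C2 = "{f \<in> space (\<Pi>\<^sub>M n\<in>I. borel). \<forall>n\<in>J2. f n \<in> B (n, False)}"
    have v1: "(\<lambda>\<omega>. \<lambda>n\<in>I. A n \<omega>) -` ?C1 \<inter> space M = {\<omega> \<in> space M. \<forall>n\<in>J1. A n \<omega> \<in> B (n, True)}"
      using sub by (auto simp: space_PiM)
    have v2: "(\<lambda>\<omega>. \<lambda>n\<in>I. T n \<omega>) -` ?C2 \<inter> space M = {\<omega> \<in> space M. \<forall>n\<in>J2. T n \<omega> \<in> B (n, False)}"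
      using sub by (auto simp: space_PiM)
    have "(\<Inter>j\<in>J. E j) = (\<lambda>\<omega>. (\<lambda>n\<in>I. A n \<omega>, \<lambda>n\<in>I. T n \<omega>)) -` (?C1 \<times> ?C2) \<inter> space M"
    proof -
      have "(\<Inter>j\<in>J. E j) = {\<omega> \<in> space M. \<forall>j\<in>J. Z j \<omega> \<in> B j}" using J(1) B(1) by auto
      also have "\<dots> = {\<omega> \<in> space M. \<forall>n\<in>J1. A n \<omega> \<in> B (n, True)} \<inter> {\<omega> \<in> space M. \<forall>n\<in>J2. T n \<omega> \<in> B (n, False)}"
        unfolding J_eq by (auto simp: Z_def ball_Un)
      finally show ?thesis unfolding v1[symmetric] v2[symmetric] by auto
    qed
    then have "prob (\<Inter>j\<in>J. E j) = prob ((\<lambda>\<omega>. \<lambda>n\<in>I. A n \<omega>) -` ?C1 \<inter> space M) * prob ((\<lambda>\<omega>. \<lambda>n\<in>I. T n \<omega>) -` ?C2 \<inter> space M)"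
      using indep_varD[OF AT cyl[OF fin(1) sub(1) B1] cyl[OF fin(2) sub(2) B2]] by simp
    also have "\<dots> = (\<Prod>n\<in>J1. prob (A n -` B (n, True) \<inter> space M)) * (\<Prod>n\<in>J2. prob (T n -` B (n, False) \<inter> space M))"
      unfolding v1 v2 using prod[OF A fin(1) sub(1) B1] prod[OF T fin(2) sub(2) B2] by simp
    also have "\<dots> = (\<Prod>j\<in>J. prob (E j))"
    proof -
      have "(\<Prod>j\<in>J. prob (E j)) = (\<Prod>j\<in>J. prob (Z j -` B j \<inter> space M))" using B(1) by (intro prod.cong) auto
      also have "\<dots> = (\<Prod>j\<in>(\<lambda>n. (n, True)) ` J1. prob (Z j -` B j \<inter> space M)) * (\<Prod>j\<in>(\<lambda>n. (n, False)) ` J2. prob (Z j -` B j \<inter> space M))"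
        unfolding J_eq using fin by (intro prod.union_disjoint) auto
      also have "\<dots> = (\<Prod>n\<in>J1. prob (A n -` B (n, True) \<inter> space M)) * (\<Prod>n\<in>J2. prob (T n -` B (n, False) \<inter> space M))"
        by (simp add: prod.reindex inj_on_def Z_def)
      finally show ?thesis by simp
    qed
    finally show "prob (\<Inter>j\<in>J. E j) = (\<Prod>j\<in>J. prob (E j))" .
  next
    fix i assume "i \<in> I \<times> (UNIV :: bool set)"
    then have [measurable]: "random_variable borel (Z i)" using rvA rvT by (auto simp: Z_def)
    show "{Z i -` B \<inter> space M | B. B \<in> sets borel} \<subseteq> events" by (auto intro: measurable_sets)
  qed
  then have "indep_vars (\<lambda>_. borel) Z (I \<times> UNIV)"
    unfolding indep_vars_def2 using rvA rvT by (auto simp: Z_def)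
  then show ?thesis by (simp add: Z_def)
qed

lemma (in prob_space) indep_vars_differences:
  fixes A T :: "nat \<Rightarrow> 'a \<Rightarrow> real"
  assumes A: "indep_vars (\<lambda>_. borel) A {1..}" and T: "indep_vars (\<lambda>_. borel) T {1..}"
    and AT: "indep_var (\<Pi>\<^sub>M n\<in>{1..}. borel) (\<lambda>\<omega>. \<lambda>n\<in>{1..}. A n \<omega>) (\<Pi>\<^sub>M n\<in>{1..}. borel) (\<lambda>\<omega>. \<lambda>n\<in>{1..}. T n \<omega>)"
  shows "indep_vars (\<lambda>_. borel) (\<lambda>i \<omega>. A (Suc i) \<omega> - c * T (Suc i) \<omega>) UNIV"
proof -
  let ?Z = "\<lambda>(n, s). if s then A n else T n"
  let ?K = "\<lambda>i. {Suc i} \<times> (UNIV :: bool set)"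
  have "indep_vars (\<lambda>i. \<Pi>\<^sub>M j\<in>?K i. borel) (\<lambda>i \<omega>. \<lambda>j\<in>?K i. ?Z j \<omega>) UNIV"
    by (rule indep_vars_restrict[OF indep_vars_pairs[OF A T AT]]) (auto simp: disjoint_family_on_def)
  from indep_vars_compose2[OF this, of "\<lambda>i f. f (Suc i, True) - c * f (Suc i, False)" "\<lambda>_. borel"]
  have "indep_vars (\<lambda>_. borel) (\<lambda>i \<omega>. (\<lambda>j\<in>?K i. ?Z j \<omega>) (Suc i, True) - c * (\<lambda>j\<in>?K i. ?Z j \<omega>) (Suc i, False)) UNIV"
    by (auto intro!: borel_measurable_diff borel_measurable_times measurable_component_singleton)
  then show ?thesis by simp
qed

lemma (in prob_space) prob_difference:
  fixes a t :: "'a \<Rightarrow> real"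
  assumes ind: "indep_var borel a borel t" and B: "B \<in> sets borel"
  shows "measure (distr M borel (\<lambda>\<omega>. a \<omega> - c * t \<omega>)) B = (LINT s|distr M borel t. measure (distr M borel a) ((\<lambda>x. x - c * s) -` B))"
proof -
  have rv [measurable]: "random_variable borel a" "random_variable borel t"
    using ind by (auto dest: indep_var_rv1 indep_var_rv2)
  interpret a: prob_space "distr M borel a" by (rule prob_space_distr) measurable
  interpret t: prob_space "distr M borel t" by (rule prob_space_distr) measurable
  interpret P: pair_prob_space "distr M borel a" "distr M borel t" ..
  note [measurable] = B
  have joint: "distr M borel a \<Otimes>\<^sub>M distr M borel t = distr M (borel \<Otimes>\<^sub>M borel) (\<lambda>x. (a x, t x))"
    using ind by (simp add: indep_var_distribution_eq)
  have "emeasure (distr M borel (\<lambda>\<omega>. a \<omega> - c * t \<omega>)) B = (\<integral>\<^sup>+x. indicator B x \<partial>distr M borel (\<lambda>\<omega>. a \<omega> - c * t \<omega>))"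
    using B by (simp del: nn_integral_distr)
  also have "\<dots> = (\<integral>\<^sup>+\<omega>. indicator B (a \<omega> - c * t \<omega>) \<partial>M)" by (rule nn_integral_distr) measurable
  also have "\<dots> = (\<integral>\<^sup>+z. indicator B (fst z - c * snd z) \<partial>distr M (borel \<Otimes>\<^sub>M borel) (\<lambda>x. (a x, t x)))"
    by (subst nn_integral_distr) auto
  also have "\<dots> = (\<integral>\<^sup>+x. \<integral>\<^sup>+s. indicator B (x - c * s) \<partial>distr M borel t \<partial>distr M borel a)"
    unfolding joint[symmetric] by (subst t.nn_integral_fst[symmetric]) auto
  also have "\<dots> = (\<integral>\<^sup>+s. \<integral>\<^sup>+x. indicator B (x - c * s) \<partial>distr M borel a \<partial>distr M borel t)"
    by (rule P.Fubini'[symmetric]) measurable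
  also have "\<dots> = (\<integral>\<^sup>+s. ennreal (measure (distr M borel a) ((\<lambda>x. x - c * s) -` B)) \<partial>distr M borel t)"
  proof (rule nn_integral_cong)
    fix s
    have [measurable]: "(\<lambda>x. x - c * s) -` B \<in> sets borel"
      using measurable_sets[of "\<lambda>x. x - c * s" borel borel B] by simp
    have "(\<integral>\<^sup>+x. indicator B (x - c * s) \<partial>distr M borel a) = (\<integral>\<^sup>+x. indicator ((\<lambda>x. x - c * s) -` B) x \<partial>distr M borel a)"
      by (intro nn_integral_cong) (auto simp: indicator_def)
    also have "\<dots> = emeasure (distr M borel a) ((\<lambda>x. x - c * s) -` B)" by (rule nn_integral_indicator) simp
    finally show "(\<integral>\<^sup>+x. indicator B (x - c * s) \<partial>distr M borel a) = ennreal (measure (distr M borel a) ((\<lambda>x. x - c * s) -` B))"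
      by (simp only: a.emeasure_eq_measure)
  qed
  finally have eq: "emeasure (distr M borel (\<lambda>\<omega>. a \<omega> - c * t \<omega>)) B =
      (\<integral>\<^sup>+s. ennreal (measure (distr M borel a) ((\<lambda>x. x - c * s) -` B)) \<partial>distr M borel t)" .
  have [measurable]: "(\<lambda>s. measure (distr M borel a) ((\<lambda>x. x - c * s) -` B)) \<in> borel_measurable borel"
  proof -
    have "(\<lambda>s. enn2real (\<integral>\<^sup>+x. indicator B (x - c * s) \<partial>distr M borel a)) \<in> borel_measurable borel" by measurable
    moreover have "enn2real (\<integral>\<^sup>+x. indicator B (x - c * s) \<partial>distr M borel a) = measure (distr M borel a) ((\<lambda>x. x - c * s) -` B)" for s
    proof -
      have "(\<lambda>x. x - c * s) -` B \<in> sets borel"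
        using measurable_sets[of "\<lambda>x. x - c * s" borel borel B] by simp
      then have "(\<integral>\<^sup>+x. indicator ((\<lambda>x. x - c * s) -` B) x \<partial>distr M borel a) = emeasure (distr M borel a) ((\<lambda>x. x - c * s) -` B)"
        by (intro nn_integral_indicator) simp
      moreover have "(\<integral>\<^sup>+x. indicator B (x - c * s) \<partial>distr M borel a) = (\<integral>\<^sup>+x. indicator ((\<lambda>x. x - c * s) -` B) x \<partial>distr M borel a)"
        by (intro nn_integral_cong) (auto simp: indicator_def)
      ultimately show ?thesis by (simp add: measure_def)
    qed
    ultimately show ?thesis by simp
  qed
  have "(\<integral>\<^sup>+s. ennreal (measure (distr M borel a) ((\<lambda>x. x - c * s) -` B)) \<partial>distr M borel t) =
      ennreal (LINT s|distr M borel t. measure (distr M borel a) ((\<lambda>x. x - c * s) -` B))"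
    by (intro nn_integral_eq_integral t.integrable_const_bound[of _ 1]) (auto intro!: AE_I2)
  then show ?thesis unfolding measure_def[of "distr M borel (\<lambda>\<omega>. a \<omega> - c * t \<omega>)"] eq
    by (simp add: integral_nonneg_AE)
qed

lemma interval_measure_cdf:
  assumes "finite_measure N" "sets N = sets borel"
  shows "interval_measure (cdf N) = N"
proof -
  interpret finite_borel_measure N using assms by (auto simp: finite_borel_measure_def finite_borel_measure_axioms_def)
  have sp: "space N = UNIV" using sets_eq_imp_space_eq[OF assms(2)] by simp
  have I: "emeasure (interval_measure (cdf N)) UNIV = ennreal (measure N (space N))"
    by (rule interval_measure_UNIV[OF cdf_nondecreasing cdf_is_right_cont cdf_lim_at_bot cdf_lim_at_top measure_nonneg])
  have Iic: "measure (interval_measure (cdf N)) {..x} = cdf N x" for x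
    by (rule measure_interval_measure_Iic[OF cdf_nondecreasing cdf_is_right_cont cdf_lim_at_bot])
  have fin: "finite_measure (interval_measure (cdf N))" by (rule finite_measureI) (simp add: I)
  interpret I: finite_measure "interval_measure (cdf N)" by (rule fin)
  have total: "measure (interval_measure (cdf N)) UNIV = measure N UNIV"
    unfolding measure_def[of "interval_measure (cdf N)"] I sp by simp
  have "measure (interval_measure (cdf N)) {x<..} = measure N {x<..}" for x
  proof -
    have c: "{x<..} = UNIV - {..x}" by auto
    have "measure (interval_measure (cdf N)) {x<..} = measure (interval_measure (cdf N)) UNIV - measure (interval_measure (cdf N)) {..x}"
      unfolding c using I.finite_measure_compl[of "{..x}"] by simp
    also have "\<dots> = measure N UNIV - cdf N x"
      unfolding total Iic by (rule refl)
    also have "\<dots> = measure N {x<..}" unfolding c using finite_measure_compl[of "{..x}"] assms(2) by (simp add: sp cdf_def)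
    finally show ?thesis .
  qed
  then show ?thesis
    using assms(2) by (intro measure_eqI_lessThan) (auto simp: I.emeasure_eq_measure emeasure_eq_measure)
qed

lemma tail_cdf:
  assumes "prob_space N" "sets N = sets borel"
  shows "tail (cdf N) x = measure N {x<..}"
proof -
  interpret prob_space N by fact
  interpret finite_borel_measure N using assms by unfold_locales
  have sp: "space N = UNIV" using sets_eq_imp_space_eq[OF assms(2)] by simp
  have "Lim at_top (cdf N) = measure N (space N)" by (rule tendsto_Lim[OF _ cdf_lim_at_top]) simp
  moreover have "{x<..} = UNIV - {..x}" by auto
  ultimately show ?thesis
    using finite_measure_compl[of "{..x}"] assms(2) by (simp add: tail_def sp cdf_def)
qed

lemma Inf_first_entry:
  "(\<exists>j. Inf (enat ` {n. n \<ge> 1 \<and> psum n v \<in> C}) = enat j \<and> P j) \<longleftrightarrow> (\<exists>j. first_entry C j v \<and> P j)"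
proof -
  have "Inf (enat ` {n. n \<ge> 1 \<and> psum n v \<in> C}) = enat j" if "first_entry C j v" for j
  proof (rule antisym)
    show "Inf (enat ` {n. n \<ge> 1 \<and> psum n v \<in> C}) \<le> enat j" using that by (intro Inf_lower) (auto simp: first_entry_def)
    show "enat j \<le> Inf (enat ` {n. n \<ge> 1 \<and> psum n v \<in> C})"
      using that by (intro Inf_greatest) (auto simp: first_entry_def not_less[symmetric])
  qed
  moreover have "Inf (enat ` {n. n \<ge> 1 \<and> psum n v \<in> C}) = \<infinity>" if "\<not> (\<exists>j. first_entry C j v)"
  proof -
    have "{n. n \<ge> 1 \<and> psum n v \<in> C} = {}" using that unfolding ex_first_entry_iff by auto
    then show ?thesis by (simp only: image_empty Inf_empty top_enat_def)
  qed
  ultimately show ?thesis by (metis enat.distinct(1) enat.inject)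
qed

section \<open>The ruin probability\<close>

context iid_walk
begin

text \<open>The expansion for a random walk with negative mean whose tail is one of the functions of a scale. The two
divisibility hypotheses express \<open>P = (S L\<^sub>-)\<^sup>-\<^sup>1\<close> and \<open>R = (1 - p) (1 -
L\<^sub>+)\<^sup>-\<^sup>2 P\<close> without reference to the ring.\<close>

theorem ruin_expansion:
  assumes scale: "deriv_scale d m \<beta> a" and d1: "\<And>x. a < x \<Longrightarrow> d 1 x = measure \<mu> {x<..}"
    and int: "integrable \<mu> (\<lambda>x. x)" and mean: "(LINT x|\<mu>. x) < 0"
    and mom: "integrable (hit_law {..0}) (\<lambda>z. z ^ m)"
    and P: "degree P < m" "monom 1 (Suc m) dvd P * (1 - lchar (hit_law {..0}) m) - monom 1 1"
    and R: "monom 1 m dvd R * (1 - lchar (hit_law {0<..}) (m - 1)) ^ 2 - smult (1 - measure (hit_law {0<..}) UNIV) P"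
  shows "(\<lambda>x. measure sup_law {x<..} - deriv_scale.act d (m - 1) R x) \<in> o(d (m - 1))"
proof -
  interpret S: deriv_scale d m \<beta> a by (rule scale)
  interpret U: finite_measure "hit_law {0<..}" by (rule finite_hit_law) simp
  have mass: "measure (hit_law {0<..}) UNIV < 1" by (rule asc_mass_less_1[OF int mean])
  define B where "B x = measure (hit_law {0<..}) {x<..}" for x
  obtain \<delta> where \<delta>: "0 < \<delta>" "0 < measure (hit_law {..0}) {..- \<delta>}" using desc_charges_below[OF int mean] by blast
  have "(\<lambda>x. B x - S.act (m - 1) P x) \<in> o(d (m - 1))"
  proof (rule S.ladder_expansion[where \<nu> = "hit_law {..0}" and \<delta> = \<delta> and K = 1])
    show "prob_space (hit_law {..0})" by (rule prob_space_desc[OF int mean])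
    show "AE y in hit_law {..0}. y \<le> 0" using AE_hit_law[of "{..0}"] by simp
    show "B \<in> borel_measurable borel"
      unfolding B_def by (rule borel_measurable_tail[OF U.finite_measure_axioms]) simp
    show "\<bar>B x\<bar> \<le> 1" for x using U.bounded_measure[of "{x<..}"] mass by (simp add: B_def)
    show "(B \<longlongrightarrow> 0) at_top"
    proof -
      interpret finite_borel_measure "hit_law {0<..}" by unfold_locales simp
      have "B = (\<lambda>x. measure (hit_law {0<..}) UNIV - cdf (hit_law {0<..}) x)"
      proof
        fix x :: real
        have "{x<..} = UNIV - {..x}" by auto
        then show "B x = measure (hit_law {0<..}) UNIV - cdf (hit_law {0<..}) x"
          using U.finite_measure_compl[of "{..x}"] by (simp add: B_def cdf_def)
      qed
      moreover have "((\<lambda>x. measure (hit_law {0<..}) UNIV - cdf (hit_law {0<..}) x) \<longlongrightarrow>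
          measure (hit_law {0<..}) UNIV - measure (hit_law {0<..}) UNIV) at_top"
        using cdf_lim_at_top by (intro tendsto_diff tendsto_const) simp
      ultimately show ?thesis by simp
    qed
    show "eventually (\<lambda>x. B x = d 1 x + (LINT y|hit_law {..0}. B (x - y))) at_top"
      using eventually_gt_at_top[of a]
    proof eventually_elim
      case (elim x)
      then show ?case using wiener_hopf_tail[of x] S.a_nonneg d1[of x] by (simp add: B_def)
    qed
    show "coeff (P * (1 - lchar (hit_law {..0}) m)) i = (if i = 1 then 1 else 0)" if "i \<le> m" for i
      using P(2) that unfolding monom_1_dvd_iff' by (auto simp: coeff_monom less_Suc_eq_le split: if_splits)
  qed (use \<delta> mom P(1) in auto)
  then show ?thesis
    by (intro S.compound_expansion[OF compound_geometric_sup_law[OF mass] _ R]) (simp add: B_def)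
qed

end

theorem mainTheorem2:
  fixes M :: "'a measure"
    and A T X S :: "nat \<Rightarrow> 'a \<Rightarrow> real"
    and L K F Fp Fm :: "real \<Rightarrow> real"
    and c \<alpha> p :: real
    and m :: nat
  defines "X \<equiv> \<lambda>n \<omega>. A n \<omega> - c * T n \<omega>"
    and "S \<equiv> walk X"
    and "F \<equiv> \<lambda>x. LINT t:{0..}|interval_measure K. L (x + c * t)"
    and "Fp \<equiv> asc_ladder_df M S"
    and "Fm \<equiv> desc_ladder_df M S"
    and "p \<equiv> asc_ladder_mass M S"
  assumes "prob_space M"
    and "prob_space.indep_vars M (\<lambda>_. borel) A {1..}"
    and "prob_space.indep_vars M (\<lambda>_. borel) T {1..}"
    and "prob_space.indep_var M
           (\<Pi>\<^sub>M n\<in>{1..}. borel) (\<lambda>\<omega>. \<lambda>n\<in>{1..}. A n \<omega>)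
           (\<Pi>\<^sub>M n\<in>{1..}. borel) (\<lambda>\<omega>. \<lambda>n\<in>{1..}. T n \<omega>)"
    and "\<And>n. n \<ge> 1 \<Longrightarrow> cdf (distr M borel (A n)) = L"
    and "\<And>n. n \<ge> 1 \<Longrightarrow> cdf (distr M borel (T n)) = K"
    and "\<And>n. n \<ge> 1 \<Longrightarrow> (AE \<omega> in M. T n \<omega> \<ge> 0)"
    and "c > 0"
    and "m \<ge> 1"
    and "smoothly_varying (tail L) (- \<alpha>) (m + 1)"
    and "integrable M (A 1)" and "integrable M (T 1)"
    and "(LINT \<omega>|M. A 1 \<omega>) - c * (LINT \<omega>|M. T 1 \<omega>) < 0"
    and "real m < \<alpha>"
    and "finite_moment Fm m"
  shows "(\<lambda>x. ruin_prob M S x -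
            apply_D
              (smult (1 - p)
                 ((\<one>\<^bsub>trunc_ring (m - 1)\<^esub> \<ominus>\<^bsub>trunc_ring (m - 1)\<^esub> laplace_char Fp (m - 1))
                    [^]\<^bsub>trunc_ring (m - 1)\<^esub> (-2 :: int)
                  \<otimes>\<^bsub>trunc_ring (m - 1)\<^esub>
                  inv\<^bsub>trunc_ring (m - 1)\<^esub> (signed_shift (laplace_char Fm m))))
              (D_inv (tail F)) x)
         \<in> o[at_top](\<lambda>x. x powi (2 - int m) * tail F x)"
proof -
  note [simp del] = One_nat_def
  interpret M: prob_space M by (rule assms(7))
  have c: "0 < c" and m: "1 \<le> m" and \<alpha>: "real m < \<alpha>" by (fact assms)+
  have rv: "A n \<in> borel_measurable M" "T n \<in> borel_measurable M" if "1 \<le> n" for n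
    using assms(8,9) that by (auto simp: M.indep_vars_def)
  define LA where "LA = distr M borel (A 1)"
  define \<kappa> where "\<kappa> = distr M borel (T 1)"
  define \<mu> where "\<mu> = distr M borel (X 1)"
  have law: "distr M borel (A n) = LA" "distr M borel (T n) = \<kappa>" if "1 \<le> n" for n
    unfolding LA_def \<kappa>_def using that assms(11,12)
    by (intro cdf_unique M.real_distribution_distr rv; simp)+
  have L: "L = cdf LA" and K: "K = cdf \<kappa>" using assms(11,12)[of 1] by (simp_all add: LA_def \<kappa>_def)
  have LA: "prob_space LA" "sets LA = sets borel" and \<kappa>: "prob_space \<kappa>" "sets \<kappa> = sets borel"
    unfolding LA_def \<kappa>_def by (auto intro!: M.prob_space_distr rv)
  interpret LA: prob_space LA by (rule LA(1))
  interpret \<kappa>: prob_space \<kappa> by (rule \<kappa>(1))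
  have \<kappa>_nonneg: "AE t in \<kappa>. 0 \<le> t"
    unfolding \<kappa>_def using assms(13)[of 1] rv by (subst AE_distr_iff) auto
  have ind: "M.indep_var borel (A n) borel (T n)" if n: "1 \<le> n" for n
  proof -
    have "M.indep_var borel ((\<lambda>f. f n) \<circ> (\<lambda>\<omega>. \<lambda>n\<in>{1..}. A n \<omega>)) borel ((\<lambda>f. f n) \<circ> (\<lambda>\<omega>. \<lambda>n\<in>{1..}. T n \<omega>))"
      using n by (intro M.indep_var_compose[OF assms(10)] measurable_component_singleton) auto
    moreover have "(\<lambda>f. f n) \<circ> (\<lambda>\<omega>. \<lambda>n\<in>{1..}. Y n \<omega>) = Y n" for Y :: "nat \<Rightarrow> 'a \<Rightarrow> real"
      using n by auto
    ultimately show ?thesis by simp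
  qed
  have prob_X: "measure (distr M borel (X n)) B = (LINT s|\<kappa>. measure LA ((\<lambda>x. x - c * s) -` B))"
    if "1 \<le> n" "B \<in> sets borel" for n B
    unfolding X_def using M.prob_difference[OF ind[OF that(1)] that(2), of c] law[OF that(1)] by simp
  have rvX: "X n \<in> borel_measurable M" if "1 \<le> n" for n unfolding X_def using rv[OF that] by measurable
  have law_X: "distr M borel (X n) = \<mu>" if n: "1 \<le> n" for n
  proof (rule measure_eqI)
    interpret a: prob_space "distr M borel (X n)" by (rule M.prob_space_distr[OF rvX[OF n]])
    interpret b: prob_space \<mu> unfolding \<mu>_def by (rule M.prob_space_distr[OF rvX]) simp
    fix B assume "B \<in> sets (distr M borel (X n))"
    then show "emeasure (distr M borel (X n)) B = emeasure \<mu> B"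
      using prob_X[OF n, of B] prob_X[of 1 B, folded \<mu>_def] by (simp add: a.emeasure_eq_measure b.emeasure_eq_measure)
  qed (simp add: \<mu>_def)
  have \<mu>: "prob_space \<mu>" "sets \<mu> = sets borel" unfolding \<mu>_def by (auto intro!: M.prob_space_distr rvX)
  interpret W: iid_walk \<mu> by (rule iid_walkI[OF \<mu>])
  have intX: "integrable M (X 1)" unfolding X_def using assms(17,18) by (intro Bochner_Integration.integrable_diff integrable_mult_right)
  have int: "integrable \<mu> (\<lambda>x. x)"
    unfolding \<mu>_def using intX rvX[of 1] by (subst integrable_distr_eq) auto
  have "(LINT x|\<mu>. x) = (LINT \<omega>|M. X 1 \<omega>)" unfolding \<mu>_def using rvX[of 1] by (subst integral_distr) auto
  also have "\<dots> = (LINT \<omega>|M. A 1 \<omega>) - c * (LINT \<omega>|M. T 1 \<omega>)"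
    unfolding X_def using assms(17,18) by (subst Bochner_Integration.integral_diff) auto
  finally have mean: "(LINT x|\<mu>. x) < 0" using assms(19) by simp
  have mass: "measure (W.hit_law {0<..}) UNIV < 1" by (rule W.asc_mass_less_1[OF int mean])

  define \<xi> where "\<xi> \<omega> i = X (Suc i) \<omega>" for \<omega> i
  have "M.indep_vars (\<lambda>_. borel) (\<lambda>i \<omega>. A (Suc i) \<omega> - c * T (Suc i) \<omega>) UNIV"
    by (rule M.indep_vars_differences[OF assms(8,9,10)])
  then have "distr M W.Q (\<lambda>\<omega> i. X (Suc i) \<omega>) = W.Q"
    by (intro iid_seq_law[OF assms(7)] law_X) (simp_all add: X_def)
  then have law_\<xi>: "distr M W.Q \<xi> = W.Q" by (simp add: \<xi>_def[abs_def])
  have \<xi>_meas: "\<xi> \<in> measurable M W.Q"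
  proof (rule measurable_PiM_single')
    show "(\<lambda>\<omega>. \<xi> \<omega> i) \<in> measurable M \<mu>" for i
      unfolding \<xi>_def measurable_cong_sets[OF refl \<mu>(2)] by (rule rvX) simp
  qed (simp add: W.space_mu)
  have S_eq: "S n \<omega> = psum n (\<xi> \<omega>)" for n \<omega>
    unfolding S_def walk_def psum_def \<xi>_def One_nat_def by (rule sum.atLeast1_atMost_eq)
  have transfer: "measure M {\<omega> \<in> space M. R (\<xi> \<omega>)} = measure W.Q {v. R v}" if "Measurable.pred W.Q R" for R
  proof -
    have "measure W.Q {v. R v} = measure (distr M W.Q \<xi>) {v. R v}" by (simp only: law_\<xi>)
    also have "\<dots> = measure M (\<xi> -` {v. R v} \<inter> space M)"
      by (rule measure_distr[OF \<xi>_meas W.sets_Q_Collect[OF that]])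
    also have "\<xi> -` {v. R v} \<inter> space M = {\<omega> \<in> space M. R (\<xi> \<omega>)}" by auto
    finally show ?thesis by simp
  qed
  have hit: "(t < \<infinity> \<and> S (the_enat t) \<omega> \<in> E) \<longleftrightarrow> (\<exists>j. first_entry C j (\<xi> \<omega>) \<and> psum j (\<xi> \<omega>) \<in> E)"
    if "t = Inf (enat ` {n. n \<ge> 1 \<and> psum n (\<xi> \<omega>) \<in> C})" for t E C \<omega>
    unfolding Inf_first_entry[symmetric, of C "\<xi> \<omega>"] that[symmetric] by (cases t) (auto simp: S_eq)
  have hit_measure: "measure M {\<omega> \<in> space M. Inf (enat ` {n. n \<ge> 1 \<and> psum n (\<xi> \<omega>) \<in> C}) < \<infinity> \<and>
      S (the_enat (Inf (enat ` {n. n \<ge> 1 \<and> psum n (\<xi> \<omega>) \<in> C}))) \<omega> \<in> E} = measure (W.hit_law C) E"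
    if CE: "C \<in> sets borel" "E \<in> sets borel" for C E
  proof -
    note [measurable] = CE
    show ?thesis unfolding hit[OF refl] W.measure_hit_law[OF CE] by (rule transfer) measurable
  qed
  have Fp: "Fp = cdf (W.hit_law {0<..})"
    using hit_measure[of "{0<..}" "{.._}"]
    by (intro ext) (simp add: Fp_def asc_ladder_df_def asc_ladder_time_def cdf_def S_eq)
  have Fm: "Fm = cdf (W.hit_law {..0})"
    using hit_measure[of "{..0}" "{.._}"]
    by (intro ext) (simp add: Fm_def desc_ladder_df_def desc_ladder_time_def cdf_def S_eq)
  have p: "p = measure (W.hit_law {0<..}) UNIV"
    using hit_measure[of "{0<..}" UNIV] by (simp add: p_def asc_ladder_mass_def asc_ladder_time_def S_eq)
  have im: "interval_measure Fp = W.hit_law {0<..}" "interval_measure Fm = W.hit_law {..0}"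
    unfolding Fp Fm by (auto intro!: interval_measure_cdf W.finite_hit_law)
  have ruin: "ruin_prob M S x = measure W.sup_law {x<..}" for x
  proof -
    have "ruin_prob M S x = measure M {\<omega> \<in> space M. ereal x < W.sup_walk (\<xi> \<omega>)}"
      by (simp add: ruin_prob_def W.sup_walk_def S_eq)
    also have "\<dots> = measure W.Q {v. ereal x < W.sup_walk v}" by (rule transfer) measurable
    finally show ?thesis by (simp add: W.measure_sup_law[OF mass])
  qed

  have vimage: "(\<lambda>y. y - c * s) -` {..x} = {..x + c * s}" "(\<lambda>y. y - c * s) -` {x<..} = {x + c * s<..}" for s x
    by auto
  have affine: "(\<lambda>t. x + c * t) \<in> borel_measurable \<kappa>" for x
    unfolding measurable_cong_sets[OF \<kappa>(2) refl] by simp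
  have K': "interval_measure K = \<kappa>"
    unfolding K by (rule interval_measure_cdf[OF \<kappa>.finite_measure_axioms \<kappa>(2)])
  have F: "F = cdf \<mu>"
  proof
    fix x
    have "F x = (LINT t|\<kappa>. indicator {0..} t *\<^sub>R measure LA {..x + c * t})"
      unfolding F_def K' set_lebesgue_integral_def unfolding L cdf_def by (rule refl)
    also have "\<dots> = (LINT t|\<kappa>. measure LA {..x + c * t})"
    proof (rule integral_cong_AE)
      have "(\<lambda>y. measure LA {..y}) \<in> borel_measurable borel"
        using LA(2) by (intro borel_measurable_mono monoI LA.finite_measure_mono) auto
      then show *: "(\<lambda>t. measure LA {..x + c * t}) \<in> borel_measurable \<kappa>"
        by (rule measurable_compose[OF affine])
      have "(\<lambda>t. indicator {0..} t :: real) \<in> borel_measurable \<kappa>"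
        using \<kappa>(2) by (intro borel_measurable_indicator) simp
      then show "(\<lambda>t. indicator {0..} t *\<^sub>R measure LA {..x + c * t}) \<in> borel_measurable \<kappa>"
        using * by (intro borel_measurable_scaleR)
      show "AE t in \<kappa>. indicator {0..} t *\<^sub>R measure LA {..x + c * t} = measure LA {..x + c * t}"
        using \<kappa>_nonneg by eventually_elim simp
    qed
    also have "\<dots> = cdf \<mu> x" using prob_X[of 1 "{..x}"] by (simp add: cdf_def \<mu>_def vimage)
    finally show "F x = cdf \<mu> x" .
  qed
  have tail_F: "tail F = (\<lambda>x. measure \<mu> {x<..})" unfolding F by (rule ext) (rule tail_cdf[OF \<mu>])
  have tail_L: "tail L = (\<lambda>x. measure LA {x<..})" unfolding L by (rule ext) (rule tail_cdf[OF LA])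
  have tail_L_lim: "(tail L \<longlongrightarrow> 0) at_top"
  proof -
    interpret real_distribution LA using LA by (simp add: real_distribution_def real_distribution_axioms_def)
    have "((\<lambda>x. Lim at_top L - L x) \<longlongrightarrow> 1 - 1) at_top"
      unfolding L by (intro tendsto_diff cdf_lim_at_top_prob) (simp add: tendsto_Lim[OF _ cdf_lim_at_top_prob])
    then show ?thesis by (simp add: tail_def[abs_def])
  qed
  have "smoothly_varying (tail L) (- \<alpha>) (Suc m)" using assms(16) by (simp only: Suc_eq_plus1)
  moreover have "0 \<le> tail L x" for x by (simp add: tail_L)
  ultimately obtain b where b: "0 \<le> b"
    "\<And>j x. j \<le> m \<Longrightarrow> b < x \<Longrightarrow> ((deriv ^^ j) (tail L) has_real_derivative (deriv ^^ Suc j) (tail L) x) (at x)"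
    "\<And>j x. j \<le> Suc m \<Longrightarrow> b < x \<Longrightarrow> 0 < (-1) ^ j * (deriv ^^ j) (tail L) x"
    "\<And>j l. j \<le> Suc m \<Longrightarrow> 0 < l \<Longrightarrow>
      ((\<lambda>x. (deriv ^^ j) (tail L) (l * x) / (deriv ^^ j) (tail L) x) \<longlongrightarrow> l powr (- \<alpha> - real j)) at_top"
    using smoothly_varying_derivs[of "tail L" \<alpha> m] tail_L_lim by blast
  interpret X: smooth_mixture "\<lambda>j. (deriv ^^ j) (tail L)" m \<alpha> b c \<kappa>
    by (rule smooth_mixture.intro) (fact b \<kappa> \<kappa>_nonneg c)+
  have tail_int: "set_integrable lborel {t..} (tail F)" for t unfolding tail_F by (rule set_integrable_tail[OF \<mu> int])
  have tail_G: "tail F x = X.G 0 x" if x: "b < x" for x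
  proof -
    have "tail F x = (LINT s|\<kappa>. tail L (x + c * s))"
      using prob_X[of 1 "{x<..}"] by (simp add: tail_F tail_L \<mu>_def vimage)
    also have "\<dots> = X.G 0 x"
      unfolding X.G_def
    proof (rule integral_cong_AE)
      show "(\<lambda>t. tail L (x + c * t)) \<in> borel_measurable \<kappa>"
        unfolding tail_L
        by (rule measurable_compose[OF affine borel_measurable_tail[OF LA.finite_measure_axioms LA(2)]])
      show "(\<lambda>t. X.H 0 (x + c * t)) \<in> borel_measurable \<kappa>"
        by (rule measurable_compose[OF affine X.H_measurable]) simp
      show "AE t in \<kappa>. tail L (x + c * t) = X.H 0 (x + c * t)"
        using \<kappa>_nonneg by eventually_elim (use X.shift_gt[OF x] in \<open>simp add: X.H_def\<close>)
    qed
    finally show ?thesis .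
  qed
  define d where "d = X.scale (tail F)"
  have scale: "deriv_scale d m (\<alpha> - 1) b"
    unfolding d_def by (rule X.deriv_scale_mixture[OF m \<alpha> tail_int tail_G])
  have derivs: "(deriv ^^ k) (D_inv (tail F)) x = d k x" if "k \<le> m" "b < x" for k x
    unfolding d_def using X.deriv_scale_mixture(2)[OF m \<alpha> tail_int tail_G that] .
  interpret D: deriv_scale d m "\<alpha> - 1" b by (rule scale)
  have d1: "d 1 x = tail F x" if "b < x" for x
    using X.scale_simps(2)[OF that, of 0 "tail F"] m tail_G[OF that] by (simp add: d_def One_nat_def)
  have mom: "integrable (W.hit_law {..0}) (\<lambda>z. z ^ m)" using assms(21) by (simp add: finite_moment_def im)

  define n where "n = m - 1"
  have n: "Suc n = m" "n + 1 = m" using m by (auto simp: n_def)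
  define L1 where "L1 = laplace_char Fp n"
  have L1: "L1 = lchar (W.hit_law {0<..}) n" by (simp add: L1_def laplace_char_eq im)
  define Lm where "Lm = laplace_char Fm m"
  have Lm: "Lm = lchar (W.hit_law {..0}) m" by (simp add: Lm_def laplace_char_eq im)
  define P where "P = inv\<^bsub>trunc_ring n\<^esub> (signed_shift Lm)"
  have ss: "signed_shift Lm \<in> carrier (trunc_ring n)" "coeff (signed_shift Lm) 0 \<noteq> 0"
  proof -
    have "degree (signed_shift Lm) \<le> n"
      using n by (intro degree_le) (auto simp: coeff_signed_shift Lm coeff_lchar)
    then show "signed_shift Lm \<in> carrier (trunc_ring n)" by (simp add: trunc_ring_def)
    have "integrable (W.hit_law {..0}) (\<lambda>z. z ^ 1)"
      using m by (intro integrable_power_le[OF _ _ mom] W.finite_hit_law) auto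
    then have "(LINT z|W.hit_law {..0}. z) < 0" by (intro W.desc_mean_negative[OF int mean]) simp
    then show "coeff (signed_shift Lm) 0 \<noteq> 0"
      using m by (simp add: coeff_signed_shift Lm coeff_lchar flip: One_nat_def)
  qed
  have P: "degree P \<le> n" "monom 1 (Suc n) dvd signed_shift Lm * P - 1"
    unfolding P_def by (rule trunc_ring_inv[OF ss])+
  have one: "\<one>\<^bsub>trunc_ring n\<^esub> = 1" by (simp add: trunc_ring_def)
  define a where "a = \<one>\<^bsub>trunc_ring n\<^esub> \<ominus>\<^bsub>trunc_ring n\<^esub> L1"
  have L1_deg: "degree L1 \<le> n" unfolding L1 by (rule degree_lchar)
  have a: "a = 1 - L1"
    unfolding a_def one using L1_deg by (intro trunc_ring_minus) (auto simp: trunc_ring_def)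
  have a_unit: "a \<in> carrier (trunc_ring n)" "coeff a 0 \<noteq> 0"
    unfolding a using L1_deg mass by (auto simp: trunc_ring_def L1 coeff_lchar intro!: degree_diff_le)
  define R where "R = a [^]\<^bsub>trunc_ring n\<^esub> (-2 :: int) \<otimes>\<^bsub>trunc_ring n\<^esub> P"
  have R: "degree R \<le> n" "monom 1 (Suc n) dvd R * a ^ 2 - P"
    unfolding R_def using P(1) by (intro trunc_ring_inverse_square[OF a_unit]; simp add: trunc_ring_def)+
  define Q where "Q = smult (1 - p) R"
  have "(\<lambda>x. measure W.sup_law {x<..} - D.act (m - 1) Q x) \<in> o(d (m - 1))"
  proof (rule W.ruin_expansion[OF scale _ int mean mom])
    show "d 1 x = measure \<mu> {x<..}" if "b < x" for x using d1[OF that] by (simp add: tail_F)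
    show "degree P < m" using P(1) n by simp
    have "monom 1 (Suc m) dvd monom 1 1 * (signed_shift Lm * P - 1)"
    proof -
      \<comment> \<open>A congruence modulo \<open>D ^ m\<close> gains one order on multiplication by \<open>D\<close>.\<close>
      have "monom 1 (Suc m) = monom 1 1 * (monom 1 m :: real poly)" by (simp add: mult_monom plus_1_eq_Suc)
      then show ?thesis using P(2) n by (simp only: mult_dvd_mono dvd_refl)
    qed
    also have "monom 1 1 * (signed_shift Lm * P - 1) = P * (monom 1 1 * signed_shift Lm) - monom 1 1"
      by (simp add: algebra_simps)
    also have "monom 1 1 * signed_shift Lm = 1 - Lm"
    proof (rule signed_shift_mult)
      interpret Dm: prob_space "W.hit_law {..0}" by (rule W.prob_space_desc[OF int mean])
      show "coeff Lm 0 = 1" using Dm.prob_space by (simp add: Lm coeff_lchar)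
    qed
    finally show "monom 1 (Suc m) dvd P * (1 - lchar (W.hit_law {..0}) m) - monom 1 1" by (simp add: Lm)
    have "monom 1 m dvd smult (1 - p) (R * a ^ 2 - P)" using R(2) n by (intro dvd_smult) simp
    then show "monom 1 m dvd Q * (1 - lchar (W.hit_law {0<..}) (m - 1)) ^ 2 - smult (1 - measure (W.hit_law {0<..}) UNIV) P"
      by (simp add: Q_def a L1 p n_def smult_diff_right)
  qed
  moreover have "eventually (\<lambda>x. measure W.sup_law {x<..} - D.act (m - 1) Q x = ruin_prob M S x - apply_D Q (D_inv (tail F)) x) at_top"
    using eventually_gt_at_top[of b]
  proof eventually_elim
    case (elim x)
    have "degree Q \<le> n" unfolding Q_def using R(1) degree_smult_le[of "1 - p" R] by simp
    then have "apply_D Q (D_inv (tail F)) x = (\<Sum>k\<le>n. coeff Q k * (deriv ^^ k) (D_inv (tail F)) x)"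
      unfolding apply_D_def by (intro sum.mono_neutral_left) (auto simp: coeff_eq_0)
    also have "\<dots> = D.act (m - 1) Q x"
      unfolding D.act_def n_def[symmetric] using n elim by (intro sum.cong) (auto simp: derivs)
    finally show ?case by (simp add: ruin)
  qed
  ultimately have "(\<lambda>x. ruin_prob M S x - apply_D Q (D_inv (tail F)) x) \<in> o(d (m - 1))"
    by (subst (asm) landau_o.small.in_cong)
  moreover have "d (m - 1) \<in> O(\<lambda>x. x powi (2 - int m) * tail F x)"
  proof -
    have "d (m - 1) \<in> O(\<lambda>x. x powi (2 - int m) * d 1 x)"
    proof (cases "m = 1")
      case True
      then show ?thesis using D.bigo_deriv[of 0] by (simp add: One_nat_def)
    next
      case False
      then have m2: "1 + (m - 2) = m - 1" "1 + (m - 2) \<le> m" using m by auto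
      have "(\<lambda>x. x powi (2 - int m) * (x ^ (m - 2) * d (m - 1) x)) \<in> O(\<lambda>x. x powi (2 - int m) * d 1 x)"
        using D.bigo_power(2)[OF m2(2)] unfolding m2(1) by (rule landau_o.big.mult_left)
      moreover have "eventually (\<lambda>x. x powi (2 - int m) * (x ^ (m - 2) * d (m - 1) x) = d (m - 1) x) at_top"
        using eventually_gt_at_top[of 0]
      proof eventually_elim
        case (elim x)
        have "2 - int m = - int (m - 2)" using False m by simp
        then have "x powi (2 - int m) = inverse (x ^ (m - 2))" by (simp only: power_int_minus power_int_of_nat)
        then show ?case using elim by simp
      qed
      ultimately show ?thesis by (subst (asm) landau_o.big.in_cong)
    qed
    moreover have "eventually (\<lambda>x. x powi (2 - int m) * d 1 x = x powi (2 - int m) * tail F x) at_top"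
      using eventually_gt_at_top[of b] by eventually_elim (simp add: d1)
    ultimately show ?thesis by (subst (asm) landau_o.big.cong)
  qed
  ultimately have "(\<lambda>x. ruin_prob M S x - apply_D Q (D_inv (tail F)) x) \<in> o(\<lambda>x. x powi (2 - int m) * tail F x)"
    by (rule landau_o.small_big_trans)
  then show ?thesis unfolding Q_def R_def a_def P_def L1_def Lm_def n_def .
qed

end
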